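(* For all real $\mu_0>0$ and all integers $m\ge 1$ there exists a constant $C_{m,\mu_0}>0$ such that for all integers $L\ge 1$ with $L\geq m-1$, all $z\in\mathbb{C}_{\mu_0}$, with $\sigma=\Re z$, and all $f$ as in the context with $\|f^{(m)}\|_{\varrho_m}<\infty$, $$|I_{L,z}(f)-I_{z}(f)| \leq C_{m,\mu_0}\, L^{1-m}\, (1+|\sigma|)^{-3/4} \min\left\{\frac{1}{L},\ \frac{1}{|z|}(1+|\sigma|)^{1/2} \right\}\|f^{(m)}\|_{\varrho_{m}}.$$ Moreover, for every real $m_0>7/2$ and every integer $m\geq m_0$ there exists a constant $C'_{m,m_0,\mu_0}>0$, depending on $m$, $m_0$ and $\mu_0$ but independent of $L$, $z$ and $f$, such that for all integers $L\ge m-1$, all $z\in\mathbb{C}_{\mu_0}$, and all such $f$, $$|I_{L,z}(f)-I_{z}(f)|\leq C'_{m,m_0,\mu_0}\, (1+|z|)^{-2}\, L^{m_0-m-1}\left(1+ (1+|\sigma|)^{-1/2} L\right)\|f^{(m)}\|_{\varrho_{m}}.$$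
   Context: For real $\mu_0$, $\mathbb{C}_{\mu_0}:=\{z\in\mathbb{C}: \Re z\le \mu_0\}$. For continuous $f:[0,2]\to\mathbb{C}$, $I_z(f):=\int_0^2 f(s)e^{sz}\,ds$. For an integer $L\ge 1$, $Q_Lf$ is the unique polynomial of degree at most $L$ with $(Q_Lf)(1+\cos(\ell\pi/L))=f(1+\cos(\ell\pi/L))$ for $\ell=0,\ldots,L$, and $I_{L,z}(f):=\int_0^2 (Q_Lf)(s)e^{sz}\,ds$. For an integer $m\ge 0$, $\varrho_m(s):=(s(2-s))^{m-1/2}$ and $\|g\|_{\varrho_m}^2:=\int_0^2|g(s)|^2\varrho_m(s)\,ds$. The functions $f$ considered are continuous on $[0,2]$, with $f^{(m-1)}$ locally absolutely continuous on $(0,2)$ (so that $f^{(m)}$ exists a.e.). When $z=0$, $1/|z|$ is read as $+\infty$. *)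

theory Defs
  imports "HOL-Analysis.Analysis" "HOL-Computational_Algebra.Polynomial"
begin

definition half_plane :: "real \<Rightarrow> complex set" where
  "half_plane \<mu>0 = {z. Re z \<le> \<mu>0}"

definition osc_integral :: "complex \<Rightarrow> (real \<Rightarrow> complex) \<Rightarrow> complex" where
  "osc_integral z f = integral {0..2} (\<lambda>s. f s * exp (of_real s * z))"

definition cc_node :: "nat \<Rightarrow> nat \<Rightarrow> real" where
  "cc_node L l = 1 + cos (real l * pi / real L)"

text \<open>For \<open>L \<ge> 1\<close> the \<open>L + 1\<close> nodes are distinct, so the interpolating polynomial exists and
  is unique.\<close>

definition cc_interp :: "nat \<Rightarrow> (real \<Rightarrow> complex) \<Rightarrow> complex poly" where
  "cc_interp L f = (THE p. degree p \<le> L \<and>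
     (\<forall>l\<in>{0..L}. poly p (of_real (cc_node L l)) = f (cc_node L l)))"

definition fcc_rule :: "nat \<Rightarrow> complex \<Rightarrow> (real \<Rightarrow> complex) \<Rightarrow> complex" where
  "fcc_rule L z f = osc_integral z (\<lambda>s. poly (cc_interp L f) (of_real s))"

definition nth_vderiv :: "nat \<Rightarrow> (real \<Rightarrow> complex) \<Rightarrow> real \<Rightarrow> complex" where
  "nth_vderiv n = (\<lambda>g x. vector_derivative g (at x)) ^^ n"

text \<open>Absolute continuity on a compact interval. The \<open>n\<close> subintervals may be degenerate, which
  contributes nothing to either sum.\<close>

definition abs_continuous_on_interval :: "real \<Rightarrow> real \<Rightarrow> (real \<Rightarrow> complex) \<Rightarrow> bool" where
  "abs_continuous_on_interval a b g \<longleftrightarrow>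
     (\<forall>\<epsilon>>0. \<exists>\<delta>>0. \<forall>(n::nat) u v.
        (\<forall>i<n. a \<le> u i \<and> u i \<le> v i \<and> v i \<le> b) \<longrightarrow>
        (\<forall>i<n. \<forall>j<n. i \<noteq> j \<longrightarrow> {u i<..<v i} \<inter> {u j<..<v j} = {}) \<longrightarrow>
        (\<Sum>i<n. v i - u i) < \<delta> \<longrightarrow>
        (\<Sum>i<n. norm (g (v i) - g (u i))) < \<epsilon>)"

definition loc_abs_continuous :: "(real \<Rightarrow> complex) \<Rightarrow> bool" where
  "loc_abs_continuous g \<longleftrightarrow>
     (\<forall>a b. 0 < a \<longrightarrow> a \<le> b \<longrightarrow> b < 2 \<longrightarrow> abs_continuous_on_interval a b g)"

text \<open>For \<open>m \<ge> 1\<close>: \<open>vector_derivative\<close> is total, so the existence on \<open>(0, 2)\<close> of the derivatives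
  up to order \<open>m - 1\<close> has to be required separately.\<close>

definition admissible :: "nat \<Rightarrow> (real \<Rightarrow> complex) \<Rightarrow> bool" where
  "admissible m f \<longleftrightarrow>
     continuous_on {0..2} f \<and>
     (\<forall>k<m - 1. \<forall>x\<in>{0<..<2}. nth_vderiv k f differentiable (at x)) \<and>
     loc_abs_continuous (nth_vderiv (m - 1) f)"

definition rho :: "nat \<Rightarrow> real \<Rightarrow> real" where
  "rho m s = (s * (2 - s)) powr (real m - 1/2)"

text \<open>The derivative \<open>nth_vderiv m f\<close> of an admissible \<open>f\<close> is an unspecified value on a null set only.
  Since \<open>lebesgue\<close> is complete, it is therefore measurable, and integrability below expresses
  just that the norm is finite; the value of the norm is not affected by that null set.\<close>

definition rho_norm_finite :: "nat \<Rightarrow> (real \<Rightarrow> complex) \<Rightarrow> bool" where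
  "rho_norm_finite m g \<longleftrightarrow> set_integrable lebesgue {0..2} (\<lambda>s. (norm (g s))\<^sup>2 * rho m s)"

definition rho_norm :: "nat \<Rightarrow> (real \<Rightarrow> complex) \<Rightarrow> real" where
  "rho_norm m g = sqrt (LINT s:{0..2}|lebesgue. (norm (g s))\<^sup>2 * rho m s)"

end

theory Submission
  imports Defs
begin

text \<open>The quadrature error is the integral of \<open>E = Q\<^sub>L f - f\<close> against \<open>exp (s z)\<close>.  With
  \<open>s = 1 + cos t\<close> the nodes become equidistant, \<open>T\<^sub>n (s - 1) = cos (n t)\<close>, and everything is read
  off from the Chebyshev coefficients \<open>a\<^sub>n\<close> of \<open>f\<close>.

  \<^bold>\<open>The norm.\<close>  The derivatives \<open>T\<^sub>n\<^sup>(\<^sup>m\<^sup>)\<close> are orthogonal for the weight \<open>rho m\<close>, with squared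
  norm \<open>(pi / 2) \<Prod>k<m. (n\<^sup>2 - k\<^sup>2)\<close>, which is of the order \<open>n\<^sup>2\<^sup>m\<close> for \<open>n \<ge> m\<close> and \<open>0\<close> for \<open>n < m\<close>
  (\<open>cheb_derivatives_orthogonal\<close>).  Hence the square of the norm of the \<open>m\<close>-th derivative of \<open>f\<close>
  dominates \<open>W = \<Sum>n\<ge>m. n\<^sup>2\<^sup>m |a\<^sub>n|\<^sup>2\<close> (\<open>weighted_coefficients_le\<close>).

  \<^bold>\<open>The interpolation error.\<close>  On the nodes \<open>T\<^sub>n\<close> coincides with \<open>T\<^sub>j\<close>, where \<open>j \<le> L\<close> arises from \<open>n\<close>
  by folding at multiples of \<open>L\<close>.  So \<open>E = \<Sum>n>L. a\<^sub>n (T\<^sub>j - T\<^sub>n)\<close> (\<open>cc_interp_cheb_sum\<close>).  An index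
  \<open>j\<close> has at most one source \<open>n\<close> in each block \<open>[q L, (q + 1) L)\<close>, and \<open>\<Sum>q. 1 / q\<^sup>2\<close> converges;
  Cauchy-Schwarz therefore bounds, as functions of \<open>t\<close>, the squared \<open>L\<^sup>2\<close> norms of \<open>E\<close> and
  \<open>dE/dt\<close> by multiples of \<open>L\<^sup>-\<^sup>2\<^sup>m W\<close> and \<open>L\<^sup>2\<^sup>-\<^sup>2\<^sup>m W\<close> (\<open>alias_error_energy\<close>).

  \<^bold>\<open>The oscillatory integral.\<close>  The error is \<open>\<integral> E exp ((1 + cos t) z) sin t dt\<close>.  The squared
  \<open>L\<^sup>2\<close> norm of \<open>exp (Re z (1 + cos t)) sin t\<close> is \<open>O((1 + |Re z|) powr -(3/2))\<close>, which gives the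
  first member of the minimum.  For the second, integrate by parts once: \<open>E\<close> vanishes at both
  endpoints, which are nodes, and without the factor \<open>sin t\<close> the kernel has squared norm
  \<open>O((1 + |Re z|) powr -(1/2))\<close>.  For the second estimate, integrate by parts twice.  The boundary
  terms are at most \<open>\<Sum>n>L. n\<^sup>2 |a\<^sub>n|\<close> and the remaining integrand at most \<open>\<Sum>n>L. n\<^sup>3 |a\<^sub>n|\<close> times
  the kernel, up to constants.  By Cauchy-Schwarz these sums are \<open>O(L powr (5/2 - m))\<close> and
  \<open>O(L powr (7/2 - m))\<close> times \<open>sqrt W\<close>, where \<open>m \<ge> 4\<close> makes them converge; since \<open>m0 > 7/2\<close>, the
  factor \<open>L powr (5/2 - m)\<close> is at most \<open>L powr (m0 - m - 1)\<close>.

  \<^bold>\<open>Reduction to polynomials.\<close>  The computations above are done for finite Chebyshev sums.  For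
  fixed \<open>L\<close> and \<open>z\<close> the error is continuous in the uniform norm, so it suffices to approximate \<open>f\<close>
  uniformly by polynomials whose weighted norms are asymptotically at most that of \<open>f\<close>
  (\<open>polynomials_dense_in_weighted_norm\<close>).  The dilation \<open>f (1 + r (s - 1))\<close>, \<open>r < 1\<close>, is uniformly
  close to \<open>f\<close>, its weighted norm is not larger, and its \<open>m\<close>-th derivative is square integrable
  without weight.  This derivative is approximated in \<open>L\<^sup>2\<close> by polynomials, which are then
  integrated \<open>m\<close> times.  The integration requires that the locally absolutely continuous function
  of order \<open>m - 1\<close> is the integral of its derivative, i.e. Lebesgue's theorem that an absolutely
  continuous function is differentiable almost everywhere and satisfies the fundamental theorem
  of calculus.  It is derived first, from the Vitali covering theorem and the Henstock integral.\<close>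

section \<open>Absolutely continuous functions and their derivatives\<close>

abbreviation (input) ivl :: "real \<times> real \<Rightarrow> real set" where
  "ivl p \<equiv> {fst p..snd p}"

abbreviation (input) oivl :: "real \<times> real \<Rightarrow> real set" where
  "oivl p \<equiv> {fst p<..<snd p}"

abbreviation (input) disjoint_ivls :: "(real \<times> real) set \<Rightarrow> bool" where
  "disjoint_ivls \<equiv> pairwise (\<lambda>p q. disjnt (ivl p) (ivl q))"

definition increment :: "(real \<Rightarrow> 'a::real_normed_vector) \<Rightarrow> real \<times> real \<Rightarrow> 'a" where
  "increment g p = g (snd p) - g (fst p)"

definition nonoverlapping :: "(real \<times> real) set \<Rightarrow> bool" where
  "nonoverlapping S \<longleftrightarrow>
     pairwise (\<lambda>p q. oivl p \<inter> oivl q = {}) S"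

text \<open>Covering theorems and tagged divisions produce finite sets of intervals rather than indexed
  families; this is absolute continuity in that form.\<close>

lemma abs_continuous_finite_family:
  assumes "abs_continuous_on_interval a b g" "\<epsilon> > 0"
  obtains \<delta> where "\<delta> > 0"
    "\<And>S. \<lbrakk>finite S; \<And>p. p \<in> S \<Longrightarrow> a \<le> fst p \<and> fst p \<le> snd p \<and> snd p \<le> b;
       nonoverlapping S; (\<Sum>p\<in>S. snd p - fst p) < \<delta>\<rbrakk> \<Longrightarrow> (\<Sum>p\<in>S. norm (increment g p)) < \<epsilon>"
proof -
  from assms(1)[unfolded abs_continuous_on_interval_def, THEN spec, THEN mp, OF assms(2)]
  obtain \<delta> where d: "\<delta> > 0" and A: "\<forall>(n::nat) u v. (\<forall>i<n. a \<le> u i \<and> u i \<le> v i \<and> v i \<le> b) \<longrightarrow>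
        (\<forall>i<n. \<forall>j<n. i \<noteq> j \<longrightarrow> {u i<..<v i} \<inter> {u j<..<v j} = {}) \<longrightarrow>
        (\<Sum>i<n. v i - u i) < \<delta> \<longrightarrow> (\<Sum>i<n. norm (g (v i) - g (u i))) < \<epsilon>"
    by (elim exE conjE)
  show ?thesis
  proof (rule that[OF d])
    fix S :: "(real \<times> real) set"
    assume S: "finite S" "\<And>p. p \<in> S \<Longrightarrow> a \<le> fst p \<and> fst p \<le> snd p \<and> snd p \<le> b"
      "nonoverlapping S" "(\<Sum>p\<in>S. snd p - fst p) < \<delta>"
    obtain h where h: "bij_betw h {..<card S} S"
      using ex_bij_betw_nat_finite[OF S(1)] by (auto simp: atLeast0LessThan)
    have hin: "h i \<in> S" if "i < card S" for i
      using h that by (auto simp: bij_betw_def)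
    have "(\<Sum>i<card S. norm (g (snd (h i)) - g (fst (h i)))) < \<epsilon>"
    proof (rule A[THEN spec, THEN spec, THEN spec, THEN mp, THEN mp, THEN mp])
      show "\<forall>i<card S. a \<le> fst (h i) \<and> fst (h i) \<le> snd (h i) \<and> snd (h i) \<le> b"
        using S(2) hin by blast
      show "\<forall>i<card S. \<forall>j<card S. i \<noteq> j \<longrightarrow> oivl (h i) \<inter> oivl (h j) = {}"
      proof (intro allI impI)
        fix i j assume "i < card S" "j < card S" "i \<noteq> j"
        then have "h i \<noteq> h j" using h by (auto simp: bij_betw_def inj_on_def)
        then show "oivl (h i) \<inter> oivl (h j) = {}"
          using S(3) hin \<open>i < card S\<close> \<open>j < card S\<close> unfolding nonoverlapping_def pairwise_def by blast
      qed
      show "(\<Sum>i<card S. snd (h i) - fst (h i)) < \<delta>"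
        using S(4) sum.reindex_bij_betw[OF h, of "\<lambda>p. snd p - fst p"] by simp
    qed
    then show "(\<Sum>p\<in>S. norm (increment g p)) < \<epsilon>"
      using sum.reindex_bij_betw[OF h, of "\<lambda>p. norm (increment g p)"] by (simp add: increment_def)
  qed
qed

text \<open>Vitali's theorem yields a countable disjoint subfamily that covers up to a null set.  The measures
  of its tails tend to \<open>0\<close>, so a finite part covers up to an arbitrarily small set \<open>R\<close>.\<close>

lemma vitali_intervals_finite:
  fixes S :: "real set" and K :: "(real \<times> real) set"
  assumes K: "\<And>p. p \<in> K \<Longrightarrow> a \<le> fst p \<and> fst p < snd p \<and> snd p \<le> b"
    and S: "\<And>x d. \<lbrakk>x \<in> S; 0 < d\<rbrakk> \<Longrightarrow> \<exists>p\<in>K. fst p \<le> x \<and> x \<le> snd p \<and> snd p - fst p < d"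
    and "\<delta> > 0"
  obtains F R where "finite F" "F \<subseteq> K" "disjoint_ivls F"
    "R \<in> lmeasurable" "measure lebesgue R < \<delta>" "S \<subseteq> R \<union> (\<Union>p\<in>F. ivl p)"
proof -
  define m where "m p = (fst p + snd p) / 2" for p :: "real \<times> real"
  define r where "r p = (snd p - fst p) / 2" for p :: "real \<times> real"
  have cb: "cball (m p) (r p) = ivl p" for p
    by (auto simp: m_def r_def cball_eq_atLeastAtMost field_simps)
  obtain C where C: "countable C" "C \<subseteq> K"
      "pairwise (\<lambda>i j. disjnt (cball (m i) (r i)) (cball (m j) (r j))) C"
      "negligible (S - (\<Union>i \<in> C. cball (m i) (r i)))"
  proof (rule Vitali_covering_theorem_cballs[of K r S m])
    show "0 < r i" if "i \<in> K" for i using K[OF that] by (simp add: r_def)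
    show "\<exists>i. i \<in> K \<and> x \<in> cball (m i) (r i) \<and> r i < d" if "x \<in> S" "0 < d" for x d
    proof -
      from S[OF that] obtain p where p: "p \<in> K" "fst p \<le> x" "x \<le> snd p" "snd p - fst p < d"
        by blast
      have "r p < d" using p K[OF p(1)] by (simp add: r_def)
      moreover have "x \<in> cball (m p) (r p)" unfolding cb using p by auto
      ultimately show ?thesis using p(1) by blast
    qed
  qed
  note C' = C(3,4)[unfolded cb]
  define T where "T = (\<Union>p\<in>C. ivl p)"
  have Tm: "T \<in> lmeasurable"
  proof (rule bounded_set_imp_lmeasurable)
    show "bounded T"
    proof (rule bounded_subset[OF bounded_closed_interval])
      show "T \<subseteq> {a..b}" using C(2) K unfolding T_def by force
    qed
    show "T \<in> sets lebesgue" unfolding T_def using C(1) by (intro sets.countable_UN'') auto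
  qed
  have "\<exists>F. finite F \<and> F \<subseteq> C \<and> measure lebesgue (T - (\<Union>p\<in>F. ivl p)) < \<delta>"
  proof (cases "C = {}")
    case True then show ?thesis using \<open>\<delta> > 0\<close> by (auto simp: T_def)
  next
    case False
    define e where "e = from_nat_into C"
    have rng: "range e = C" unfolding e_def using False C(1) by (simp add: range_from_nat_into)
    define A where "A n = T - (\<Union>p\<in>e ` {..<n}. ivl p)" for n
    have Am: "A n \<in> lmeasurable" for n
      unfolding A_def by (intro fmeasurable_Diff Tm) (auto intro!: sets.finite_UN)
    have "(\<lambda>n. measure lebesgue (A n)) \<longlonglongrightarrow> measure lebesgue (\<Inter>n. A n)"
    proof (rule Lim_measure_decseq)
      show "range A \<subseteq> sets lebesgue" using Am by auto
      show "decseq A" unfolding decseq_def A_def by auto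
      show "emeasure lebesgue (A i) \<noteq> \<infinity>" for i using Am[of i] by (auto simp: fmeasurable_def)
    qed
    moreover have "(\<Inter>n. A n) = {}"
    proof -
      have False if x: "x \<in> (\<Inter>n. A n)" for x
      proof -
        have "x \<in> T" using x by (auto simp: A_def)
        then obtain p where "p \<in> C" "x \<in> ivl p" by (auto simp: T_def)
        then obtain i where "p = e i" using rng by blast
        then have "x \<notin> A (Suc i)" using \<open>x \<in> ivl p\<close> by (auto simp: A_def)
        then show False using x by blast
      qed
      then show ?thesis by blast
    qed
    ultimately have "(\<lambda>n. measure lebesgue (A n)) \<longlonglongrightarrow> 0" by simp
    then have "eventually (\<lambda>n. measure lebesgue (A n) < \<delta>) sequentially"
      using \<open>\<delta> > 0\<close> by (simp add: order_tendstoD(2))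
    then obtain n where n: "measure lebesgue (A n) < \<delta>" by (auto simp: eventually_sequentially)
    show ?thesis
      by (rule exI[of _ "e ` {..<n}"]) (use n rng in \<open>auto simp: A_def\<close>)
  qed
  then obtain F where F: "finite F" "F \<subseteq> C" "measure lebesgue (T - (\<Union>p\<in>F. ivl p)) < \<delta>" by blast
  define N where "N = S - T"
  have N: "negligible N" using C'(2) by (simp add: N_def T_def)
  define R0 where "R0 = T - (\<Union>p\<in>F. ivl p)"
  have R0: "R0 \<in> lmeasurable"
    unfolding R0_def using F(1) by (intro fmeasurable_Diff Tm) (auto intro!: sets.finite_UN)
  show ?thesis
  proof (rule that[of F "R0 \<union> N"])
    show "finite F" "F \<subseteq> K" using F C by auto
    show "disjoint_ivls F"
      using C'(1) F(2) by (rule pairwise_subset)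
    show "R0 \<union> N \<in> lmeasurable" using R0 N by (simp add: negligible_imp_measurable fmeasurable.Un)
    have "measure lebesgue (R0 \<union> N) \<le> measure lebesgue R0 + measure lebesgue N"
      using R0 N by (intro measure_Un_le) (auto simp: negligible_imp_sets)
    then show "measure lebesgue (R0 \<union> N) < \<delta>"
      using F(3) N by (simp add: R0_def negligible_imp_measure0)
    show "S \<subseteq> R0 \<union> N \<union> (\<Union>p\<in>F. ivl p)" by (auto simp: R0_def N_def)
  qed
qed

text \<open>The gaps of a disjoint family again form a finite family of intervals, and increments are additive
  over the whole.  The identity holds for all \<open>\<phi>\<close> at once, because it is used for the given function
  and for the length.\<close>

lemma complementary_intervals:
  fixes F :: "(real \<times> real) set"
  assumes "\<alpha> \<le> \<beta>" and F: "finite F" "\<And>p. p \<in> F \<Longrightarrow> \<alpha> \<le> fst p \<and> fst p < snd p \<and> snd p \<le> \<beta>"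
    and disj: "disjoint_ivls F"
  obtains G where "finite G" "\<And>p. p \<in> G \<Longrightarrow> \<alpha> \<le> fst p \<and> fst p \<le> snd p \<and> snd p \<le> \<beta>"
    "nonoverlapping G"
    "\<And>\<phi> :: real \<Rightarrow> real. sum (increment \<phi>) F + sum (increment \<phi>) G = \<phi> \<beta> - \<phi> \<alpha>"
proof -
  define I where "I p = ivl p" for p :: "real \<times> real"
  define J where "J K = (Inf K, Sup K)" for K :: "real set"
  have JI: "J (I p) = p" if "fst p \<le> snd p" for p using that by (simp add: J_def I_def)
  have injI: "inj_on I F" by (rule inj_on_inverseI[of _ J]) (use F JI in force)
  have fin: "finite (I ` F)" using F by simp
  have "(I ` F) division_of (\<Union>(I ` F))"
  proof (rule division_ofI[OF fin])
    fix K assume "K \<in> I ` F"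
    then obtain p where p: "p \<in> F" "K = I p" by blast
    show "K \<subseteq> \<Union>(I ` F)" using \<open>K \<in> I ` F\<close> by blast
    show "K \<noteq> {}" using p F(2)[OF p(1)] by (auto simp: I_def)
    show "\<exists>a b. K = cbox a b" using p by (auto simp: I_def)
    fix K2 assume "K2 \<in> I ` F" "K \<noteq> K2"
    then obtain q where q: "q \<in> F" "K2 = I q" "p \<noteq> q" using p by blast
    then have "K \<inter> K2 = {}" using disj p unfolding pairwise_def disjnt_def I_def by blast
    then show "interior K \<inter> interior K2 = {}" using interior_subset by blast
  qed simp
  moreover have "\<Union>(I ` F) \<subseteq> cbox \<alpha> \<beta>" using F(2) by (force simp: I_def)
  ultimately obtain Q where Q: "I ` F \<subseteq> Q" "Q division_of cbox \<alpha> \<beta>"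
    by (rule partial_division_extend_interval)
  have finQ: "finite Q" using Q(2) by blast
  have QE: "\<exists>u v. K = {u..v} \<and> \<alpha> \<le> u \<and> u \<le> v \<and> v \<le> \<beta>" if "K \<in> Q" for K
  proof -
    have "K \<subseteq> {\<alpha>..\<beta>}" "K \<noteq> {}" "\<exists>a b. K = cbox a b"
      using division_ofD(2,3,4)[OF Q(2) that] by auto
    then obtain u v where "K = {u..v}" by auto
    then show ?thesis using \<open>K \<subseteq> {\<alpha>..\<beta>}\<close> \<open>K \<noteq> {}\<close> by auto
  qed
  have injJ: "inj_on J Q"
  proof (rule inj_onI)
    fix K L assume "K \<in> Q" "L \<in> Q" "J K = J L"
    then show "K = L" using QE[of K] QE[of L] by (auto simp: J_def)
  qed
  have tot: "(\<Sum>K\<in>Q. increment \<phi> (J K)) = \<phi> \<beta> - \<phi> \<alpha>" for \<phi> :: "real \<Rightarrow> real"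
  proof -
    let ?q = "(\<lambda>K. (Inf K, K)) ` Q"
    have "?q tagged_division_of {\<alpha>..\<beta>}"
    proof (rule tagged_division_ofI)
      show "finite ?q" using finQ by simp
      show "\<Union>{K. \<exists>x. (x, K) \<in> ?q} = {\<alpha>..\<beta>}"
      proof -
        have "{K. \<exists>x. (x, K) \<in> ?q} = Q" by auto
        then show ?thesis using division_ofD(6)[OF Q(2)] by simp
      qed
      fix x K assume xK: "(x, K) \<in> ?q"
      then have KQ: "K \<in> Q" "x = Inf K" by auto
      show "x \<in> K" "K \<subseteq> {\<alpha>..\<beta>}" "\<exists>a b. K = cbox a b" using QE[OF KQ(1)] KQ by auto
      fix y L assume "(y, L) \<in> ?q" "(x, K) \<noteq> (y, L)"
      then show "interior K \<inter> interior L = {}" using KQ division_ofD(5)[OF Q(2)] by auto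
    qed
    from additive_tagged_division_1[OF \<open>\<alpha> \<le> \<beta>\<close> this, of \<phi>]
    show ?thesis
      by (subst (asm) sum.reindex) (auto simp: inj_on_def increment_def J_def)
  qed
  define G where "G = J ` (Q - I ` F)"
  show ?thesis
  proof (rule that[of G])
    show "finite G" using finQ by (simp add: G_def)
    show "\<alpha> \<le> fst p \<and> fst p \<le> snd p \<and> snd p \<le> \<beta>" if "p \<in> G" for p
      using that QE by (force simp: G_def J_def)
    show "nonoverlapping G"
      unfolding nonoverlapping_def
    proof (rule pairwiseI)
      fix p q assume "p \<in> G" "q \<in> G" "p \<noteq> q"
      then obtain K L where KL: "K \<in> Q" "L \<in> Q" "p = J K" "q = J L" "K \<noteq> L" by (auto simp: G_def)
      then have "interior K \<inter> interior L = {}" using division_ofD(5)[OF Q(2)] by blast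
      then show "oivl p \<inter> oivl q = {}"
        using QE[OF KL(1)] QE[OF KL(2)] KL(3,4) by (auto simp: J_def interior_atLeastAtMost_real)
    qed
    fix \<phi> :: "real \<Rightarrow> real"
    have "sum (increment \<phi>) F = (\<Sum>K\<in>I ` F. increment \<phi> (J K))"
      using F(2) JI by (subst sum.reindex[OF injI]) (force intro!: sum.cong)
    moreover have "sum (increment \<phi>) G = (\<Sum>K\<in>Q - I ` F. increment \<phi> (J K))"
      unfolding G_def by (subst sum.reindex) (auto intro: inj_on_subset[OF injJ])
    ultimately show "sum (increment \<phi>) F + sum (increment \<phi>) G = \<phi> \<beta> - \<phi> \<alpha>"
      using tot[of \<phi>] sum.subset_diff[OF Q(1) finQ, of "\<lambda>K. increment \<phi> (J K)"] by simp
  qed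
qed

lemma measure_disjoint_intervals:
  fixes F :: "(real \<times> real) set"
  assumes "finite F" "\<And>p. p \<in> F \<Longrightarrow> fst p \<le> snd p"
    "disjoint_ivls F"
  shows "measure lebesgue (\<Union>p\<in>F. ivl p) = (\<Sum>p\<in>F. snd p - fst p)"
proof -
  have "measure lebesgue (\<Union>p\<in>F. ivl p) = (\<Sum>p\<in>F. measure lebesgue (ivl p))"
    by (rule measure_UNION') (use assms in auto)
  also have "\<dots> = (\<Sum>p\<in>F. snd p - fst p)" using assms(2) by (intro sum.cong) auto
  finally show ?thesis .
qed

text \<open>If every point of \<open>E\<close> has arbitrarily short difference quotients with property \<open>P\<close>, the intervals
  between the two arguments form a Vitali cover.\<close>

lemma vitali_slopes:
  fixes \<phi> :: "real \<Rightarrow> real"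
  assumes U: "open U" "E \<subseteq> U" "U \<subseteq> {a..b}" and "\<delta> > 0"
    and P: "\<And>x d. \<lbrakk>x \<in> E; d > 0\<rbrakk> \<Longrightarrow> \<exists>y. y \<noteq> x \<and> \<bar>y - x\<bar> < d \<and> P ((\<phi> y - \<phi> x) / (y - x))"
  obtains F R where "finite F" "\<And>p. p \<in> F \<Longrightarrow> fst p < snd p" "\<And>p. p \<in> F \<Longrightarrow> ivl p \<subseteq> U"
    "\<And>p. p \<in> F \<Longrightarrow> P (increment \<phi> p / (snd p - fst p))"
    "disjoint_ivls F"
    "R \<in> lmeasurable" "measure lebesgue R < \<delta>" "E \<subseteq> R \<union> (\<Union>p\<in>F. ivl p)"
proof -
  define K where "K = {p. fst p < snd p \<and> ivl p \<subseteq> U \<and> P (increment \<phi> p / (snd p - fst p))}"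
  obtain F R where F: "finite F" "F \<subseteq> K" "disjoint_ivls F"
    "R \<in> lmeasurable" "measure lebesgue R < \<delta>" "E \<subseteq> R \<union> (\<Union>p\<in>F. ivl p)"
  proof (rule vitali_intervals_finite[of K a b E \<delta>])
    fix p assume "p \<in> K"
    then have p: "ivl p \<subseteq> U" "fst p < snd p" by (auto simp: K_def)
    then have "ivl p \<subseteq> {a..b}" "fst p < snd p" using U(3) by (blast, simp)
    then show "a \<le> fst p \<and> fst p < snd p \<and> snd p \<le> b" by auto
  next
    fix x d :: real assume x: "x \<in> E" "0 < d"
    obtain r where r: "r > 0" "ball x r \<subseteq> U" using U x by (meson open_contains_ball subsetD)
    have "min d r > 0" using x r by simp
    from P[OF x(1) this] obtain y where y: "y \<noteq> x" "\<bar>y - x\<bar> < min d r" "P ((\<phi> y - \<phi> x) / (y - x))"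
      by blast
    let ?p = "(min x y, max x y)"
    have "{min x y..max x y} \<subseteq> ball x r"
      using y(2) by (auto simp: dist_real_def)
    then have "{fst ?p..snd ?p} \<subseteq> U" using r by auto
    moreover have "increment \<phi> ?p / (snd ?p - fst ?p) = (\<phi> y - \<phi> x) / (y - x)"
      using y(1) by (cases "x < y") (auto simp: increment_def min_def max_def field_simps)
    ultimately have "?p \<in> K" using y by (auto simp: K_def)
    moreover have "fst ?p \<le> x \<and> x \<le> snd ?p \<and> snd ?p - fst ?p < d" using y(2) by auto
    ultimately show "\<exists>p\<in>K. fst p \<le> x \<and> x \<le> snd p \<and> snd p - fst p < d" by blast
  qed (use \<open>\<delta> > 0\<close> in auto)
  show ?thesis
    by (rule that[OF F(1) _ _ _ F(3-6)]) (use F(2) in \<open>auto simp: K_def\<close>)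
qed

lemma disjoint_imp_nonoverlapping:
  assumes "disjoint_ivls F"
  shows "nonoverlapping F"
  unfolding nonoverlapping_def
  by (rule pairwise_mono[OF assms _ order_refl]) (fastforce simp: disjnt_def)

lemma lmeasurable_interval_Union:
  assumes "finite (F :: (real \<times> real) set)"
  shows "(\<Union>p\<in>F. ivl p) \<in> lmeasurable"
  using assms by (intro fmeasurable.finite_UN) auto

text \<open>Here lies the reason for almost everywhere differentiability.  Choose an open \<open>U \<supseteq> E\<close> of nearly the
  outer measure \<open>e\<close> of \<open>E\<close>.  Cover almost all of \<open>E\<close> by disjoint intervals \<open>F\<close> inside \<open>U\<close> on which
  \<open>\<phi>\<close> falls with slope below \<open>-c\<close>; inside these, cover almost all of \<open>E\<close> by disjoint intervals \<open>G\<close> on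
  which \<open>\<phi>\<close> grows with slope above \<open>c\<close>.  Both families have total length close to \<open>e\<close>, so the gaps
  \<open>F - G\<close> are short and \<open>\<phi>\<close> hardly changes over them.  But \<open>\<phi>\<close> does not grow over \<open>F\<close> and grows by
  about \<open>c e\<close> over \<open>G\<close>, which forces \<open>e = 0\<close>.\<close>

lemma negligible_two_sided_slopes:
  fixes \<phi> :: "real \<Rightarrow> real"
  assumes ac: "abs_continuous_on_interval a b (\<lambda>x. complex_of_real (\<phi> x))"
    and E: "E \<subseteq> {a<..<b}" and "c > 0"
    and neg: "\<And>x d. \<lbrakk>x \<in> E; d > 0\<rbrakk> \<Longrightarrow> \<exists>y. y \<noteq> x \<and> \<bar>y - x\<bar> < d \<and> (\<phi> y - \<phi> x) / (y - x) < -c"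
    and pos: "\<And>x d. \<lbrakk>x \<in> E; d > 0\<rbrakk> \<Longrightarrow> \<exists>y. y \<noteq> x \<and> \<bar>y - x\<bar> < d \<and> c < (\<phi> y - \<phi> x) / (y - x)"
  shows "negligible E"
proof (rule ccontr)
  assume "\<not> negligible E"
  define M where "M = measure lebesgue ` {T. E \<subseteq> T \<and> T \<in> lmeasurable}"
  define e where "e = Inf M"
  have bdd: "bdd_below M" unfolding M_def by (rule bdd_belowI[of _ 0]) auto
  have ne: "M \<noteq> {}" using E unfolding M_def by (auto intro!: exI[of _ "{a<..<b}"])
  have e_le: "e \<le> measure lebesgue T" if "E \<subseteq> T" "T \<in> lmeasurable" for T
    unfolding e_def by (rule cInf_lower[OF _ bdd]) (use that in \<open>auto simp: M_def\<close>)
  from \<open>\<not> negligible E\<close> obtain e0 where "e0 > 0"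
    and e0: "\<And>T. E \<subseteq> T \<Longrightarrow> T \<in> lmeasurable \<Longrightarrow> e0 \<le> measure lebesgue T"
    unfolding negligible_outer by (meson not_less)
  have "e0 \<le> e" unfolding e_def by (rule cInf_greatest[OF ne]) (use e0 in \<open>auto simp: M_def\<close>)
  have "c * e0 / 2 > 0" using \<open>c > 0\<close> \<open>e0 > 0\<close> by simp
  from abs_continuous_finite_family[OF ac this] obtain \<delta>0 where "\<delta>0 > 0" and
    AC: "\<And>S. \<lbrakk>finite S; \<And>p. p \<in> S \<Longrightarrow> a \<le> fst p \<and> fst p \<le> snd p \<and> snd p \<le> b;
       nonoverlapping S; (\<Sum>p\<in>S. snd p - fst p) < \<delta>0\<rbrakk>
       \<Longrightarrow> (\<Sum>p\<in>S. norm (increment (\<lambda>x. complex_of_real (\<phi> x)) p)) < c * e0 / 2" by blast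
  define \<delta> where "\<delta> = min (\<delta>0 / 4) (e0 / 4)"
  have d: "\<delta> > 0" "4 * \<delta> \<le> \<delta>0" "4 * \<delta> \<le> e0"
    using \<open>\<delta>0 > 0\<close> \<open>e0 > 0\<close> by (auto simp: \<delta>_def)
  obtain U where U: "open U" "E \<subseteq> U" "U \<subseteq> {a<..<b}" "U \<in> lmeasurable" "measure lebesgue U < e + 2 * \<delta>"
  proof -
    have "\<exists>t\<in>M. t < e + \<delta>" using cInf_less_iff[OF ne bdd, of "e + \<delta>"] d(1) by (simp add: e_def)
    then obtain T where T: "E \<subseteq> T" "T \<in> lmeasurable" "measure lebesgue T < e + \<delta>" by (auto simp: M_def)
    obtain V where V: "open V" "T \<subseteq> V" "V - T \<in> lmeasurable" "emeasure lebesgue (V - T) < ennreal \<delta>"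
      using sets_lebesgue_outer_open[of T \<delta>] T(2) d(1) by auto
    have "measure lebesgue (V - T) < \<delta>"
      using V(3,4) d(1) by (simp add: emeasure_eq_measure2 ennreal_less_iff)
    moreover have "V = T \<union> (V - T)" using V(2) by blast
    ultimately have Vm: "V \<in> lmeasurable" "measure lebesgue V < e + 2 * \<delta>"
      using T V(3) measure_Un_le[of T lebesgue "V - T"] by (auto dest: fmeasurable.Un)
    have "measure lebesgue (V \<inter> {a<..<b}) \<le> measure lebesgue V"
      using Vm(1) by (intro measure_mono_fmeasurable) auto
    then show ?thesis
      using V T(1) E Vm by (intro that[of "V \<inter> {a<..<b}"]) (auto intro: fmeasurable.Int)
  qed
  have "U \<subseteq> {a..b}" using U(3) by force
  obtain F R where F: "finite F" "\<And>p. p \<in> F \<Longrightarrow> fst p < snd p" "\<And>p. p \<in> F \<Longrightarrow> ivl p \<subseteq> U"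
    "\<And>p. p \<in> F \<Longrightarrow> increment \<phi> p / (snd p - fst p) < -c"
    "disjoint_ivls F"
    "R \<in> lmeasurable" "measure lebesgue R < \<delta>" "E \<subseteq> R \<union> (\<Union>p\<in>F. ivl p)"
    by (rule vitali_slopes[OF U(1,2) \<open>U \<subseteq> {a..b}\<close> d(1), of "\<lambda>t. t < -c" \<phi>]) (rule neg that; simp)+
  define V where "V = (\<Union>p\<in>F. oivl p)"
  have "open V" "E \<inter> V \<subseteq> V" by (auto simp: V_def)
  have "oivl p \<subseteq> {a..b}" if "p \<in> F" for p
    using F(3)[OF that] \<open>U \<subseteq> {a..b}\<close> greaterThanLessThan_subseteq_atLeastAtMost_iff by blast
  then have "V \<subseteq> {a..b}" unfolding V_def by blast
  have posV: "\<exists>y. y \<noteq> x \<and> \<bar>y - x\<bar> < d \<and> c < (\<phi> y - \<phi> x) / (y - x)" if "x \<in> E \<inter> V" "d > 0" for x d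
    using pos[of x d] that by simp
  obtain G R' where G: "finite G" "\<And>p. p \<in> G \<Longrightarrow> fst p < snd p" "\<And>p. p \<in> G \<Longrightarrow> ivl p \<subseteq> V"
    "\<And>p. p \<in> G \<Longrightarrow> c < increment \<phi> p / (snd p - fst p)"
    "disjoint_ivls G"
    "R' \<in> lmeasurable" "measure lebesgue R' < \<delta>" "E \<inter> V \<subseteq> R' \<union> (\<Union>p\<in>G. ivl p)"
    by (rule vitali_slopes[OF \<open>open V\<close> \<open>E \<inter> V \<subseteq> V\<close> \<open>V \<subseteq> {a..b}\<close> d(1), of "\<lambda>t. c < t" \<phi>]) (rule posV that; simp)+
  have lenF: "(\<Sum>p\<in>F. snd p - fst p) < e + 2 * \<delta>"
  proof -
    have "(\<Sum>p\<in>F. snd p - fst p) = measure lebesgue (\<Union>p\<in>F. ivl p)"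
      using measure_disjoint_intervals[OF F(1) less_imp_le[OF F(2)] F(5)] by simp
    also have "\<dots> \<le> measure lebesgue U"
      using F(3) U(4) lmeasurable_interval_Union[OF F(1)] by (intro measure_mono_fmeasurable) auto
    finally show ?thesis using U(5) by simp
  qed
  have lenG: "(\<Sum>p\<in>G. snd p - fst p) \<ge> e - 2 * \<delta>"
  proof -
    define B where "B = fst ` F \<union> snd ` F"
    have B: "B \<in> lmeasurable" "measure lebesgue B = 0"
      using F(1) negligible_finite[of B] by (auto simp: B_def negligible_imp_measurable negligible_imp_measure0)
    have GU: "(\<Union>p\<in>G. ivl p) \<in> lmeasurable" by (rule lmeasurable_interval_Union[OF G(1)])
    have "E \<subseteq> R \<union> (R' \<union> (B \<union> (\<Union>p\<in>G. ivl p)))"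
    proof
      fix x assume x: "x \<in> E"
      show "x \<in> R \<union> (R' \<union> (B \<union> (\<Union>p\<in>G. ivl p)))"
      proof (cases "x \<in> R")
        case False
        then obtain p where p: "p \<in> F" "x \<in> ivl p" using F(8) x by blast
        then have "x \<in> B \<or> x \<in> V" by (force simp: B_def V_def)
        then show ?thesis using G(8) x by blast
      qed simp
    qed
    then have "e \<le> measure lebesgue (R \<union> (R' \<union> (B \<union> (\<Union>p\<in>G. ivl p))))"
      using F(6) G(6) B GU by (intro e_le) (auto intro!: fmeasurable.Un)
    also have "\<dots> \<le> measure lebesgue R + (measure lebesgue R' + (measure lebesgue B + measure lebesgue (\<Union>p\<in>G. ivl p)))"
      using F(6) G(6) B GU by (intro order_trans[OF measure_Un_le] add_mono order_refl) auto
    also have "measure lebesgue (\<Union>p\<in>G. ivl p) = (\<Sum>p\<in>G. snd p - fst p)"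
      using measure_disjoint_intervals[OF G(1) less_imp_le[OF G(2)] G(5)] by simp
    finally show ?thesis using F(7) G(7) B(2) by linarith
  qed

  \<comment> \<open>A second-generation interval is connected and lies in the disjoint union of the open
  first-generation intervals, hence in one of them.\<close>
  define GI where "GI p = {q \<in> G. ivl q \<subseteq> oivl p}" for p
  have Gun: "G = (\<Union>p\<in>F. GI p)"
  proof
    show "G \<subseteq> (\<Union>p\<in>F. GI p)"
    proof
      fix q assume q: "q \<in> G"
      have "fst q \<in> V" using G(2,3)[OF q] by auto
      then obtain p where p: "p \<in> F" "fst q \<in> oivl p" by (auto simp: V_def)
      have "snd q < snd p"
      proof (rule ccontr)
        assume "\<not> snd q < snd p"
        then have "snd p \<in> ivl q" using p by auto
        then have "snd p \<in> V" using G(3)[OF q] by blast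
        then obtain p' where p': "p' \<in> F" "snd p \<in> oivl p'" by (auto simp: V_def)
        then have "p \<noteq> p'" by auto
        then have "disjnt (ivl p) (ivl p')" using F(5) p(1) p'(1) by (auto simp: pairwise_def)
        moreover have "snd p \<in> ivl p" "snd p \<in> ivl p'" using p' F(2)[OF p(1)] by auto
        ultimately show False by (auto simp: disjnt_iff)
      qed
      then have "q \<in> GI p" using q p by (auto simp: GI_def)
      then show "q \<in> (\<Union>p\<in>F. GI p)" using p(1) by blast
    qed
  qed (auto simp: GI_def)
  have GIdisj: "GI p \<inter> GI p' = {}" if "p \<in> F" "p' \<in> F" "p \<noteq> p'" for p p'
  proof -
    have "disjnt (ivl p) (ivl p')" using F(5) that by (auto simp: pairwise_def)
    moreover have "fst q \<in> ivl p \<inter> ivl p'" if "q \<in> GI p" "q \<in> GI p'" for q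
    proof -
      have "fst q \<in> ivl q" using that(1) G(2)[of q] by (auto simp: GI_def)
      then show ?thesis using that unfolding GI_def by fastforce
    qed
    ultimately show ?thesis by (auto simp: disjnt_iff)
  qed
  have finGI: "finite (GI p)" for p using G(1) by (simp add: GI_def)
  have sumG: "sum h G = (\<Sum>p\<in>F. sum h (GI p))" for h :: "real \<times> real \<Rightarrow> real"
    unfolding Gun by (rule sum.UNION_disjoint) (use F(1) finGI GIdisj in auto)
  have "\<exists>H. finite H \<and> (\<forall>q\<in>H. fst p \<le> fst q \<and> fst q \<le> snd q \<and> snd q \<le> snd p) \<and> nonoverlapping H \<and>
     (\<forall>\<psi>::real \<Rightarrow> real. sum (increment \<psi>) (GI p) + sum (increment \<psi>) H = increment \<psi> p)"
    if p: "p \<in> F" for p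
  proof -
    obtain H where "finite H" "\<And>q. q \<in> H \<Longrightarrow> fst p \<le> fst q \<and> fst q \<le> snd q \<and> snd q \<le> snd p" "nonoverlapping H"
      "\<And>\<psi>::real \<Rightarrow> real. sum (increment \<psi>) (GI p) + sum (increment \<psi>) H = \<psi> (snd p) - \<psi> (fst p)"
    proof (rule complementary_intervals[of "fst p" "snd p" "GI p"])
      show "fst p \<le> snd p" using F(2)[OF p] by simp
      show "fst p \<le> fst q \<and> fst q < snd q \<and> snd q \<le> snd p" if "q \<in> GI p" for q
      proof -
        have q: "ivl q \<subseteq> oivl p" "fst q < snd q" using that G(2) by (auto simp: GI_def)
        show ?thesis using subsetD[OF q(1), of "fst q"] subsetD[OF q(1), of "snd q"] q(2) by auto
      qed
      show "disjoint_ivls (GI p)"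
        by (rule pairwise_subset[OF G(5)]) (auto simp: GI_def)
    qed (use finGI in auto)
    then show ?thesis unfolding increment_def by blast
  qed
  then obtain H where H: "\<And>p. p \<in> F \<Longrightarrow> finite (H p)"
    "\<And>p q. p \<in> F \<Longrightarrow> q \<in> H p \<Longrightarrow> fst p \<le> fst q \<and> fst q \<le> snd q \<and> snd q \<le> snd p"
    "\<And>p. p \<in> F \<Longrightarrow> nonoverlapping (H p)"
    "\<And>p \<psi>. p \<in> F \<Longrightarrow> sum (increment \<psi>) (GI p) + sum (increment \<psi>) (H p) = (increment \<psi> p :: real)"
    by metis
  have Hsum: "(\<Sum>p\<in>F. sum (increment \<psi>) (H p)) = sum (increment \<psi>) F - sum (increment \<psi>) G" for \<psi> :: "real \<Rightarrow> real"
  proof -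
    have "(\<Sum>p\<in>F. sum (increment \<psi>) (GI p) + sum (increment \<psi>) (H p)) = sum (increment \<psi>) F"
      by (rule sum.cong) (use H(4) in auto)
    then show ?thesis by (simp add: sum.distrib sumG)
  qed
  \<comment> \<open>A degenerate gap may belong to several parents, which would spoil the sum over the union.\<close>
  define H' where "H' p = {q \<in> H p. fst q < snd q}" for p
  define A where "A = (\<Union>p\<in>F. H' p)"
  have H'disj: "oivl q \<inter> oivl q' = {}"
    if "p \<in> F" "p' \<in> F" "p \<noteq> p'" "q \<in> H' p" "q' \<in> H' p'" for p p' q q'
  proof -
    have dj: "disjnt (ivl p) (ivl p')" using F(5) that by (auto simp: pairwise_def)
    have "oivl q \<subseteq> ivl p" "oivl q' \<subseteq> ivl p'"
      using H(2)[of p q] H(2)[of p' q'] that by (auto simp: H'_def)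
    then show ?thesis using dj unfolding disjnt_def by blast
  qed
  have sumA: "sum (increment \<psi>) A = sum (increment \<psi>) F - sum (increment \<psi>) G" for \<psi> :: "real \<Rightarrow> real"
  proof -
    have "H' p \<inter> H' p' = {}" if "p \<in> F" "p' \<in> F" "p \<noteq> p'" for p p'
    proof -
      have "False" if q: "q \<in> H' p" "q \<in> H' p'" for q
      proof -
        have "oivl q = {}" using H'disj[OF \<open>p \<in> F\<close> \<open>p' \<in> F\<close> \<open>p \<noteq> p'\<close> q] by simp
        then show False using q(1) by (auto simp: H'_def)
      qed
      then show ?thesis by blast
    qed
    then have "sum (increment \<psi>) A = (\<Sum>p\<in>F. sum (increment \<psi>) (H' p))"
      unfolding A_def using H(1) F(1) by (intro sum.UNION_disjoint) (auto simp: H'_def)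
    also have "\<dots> = (\<Sum>p\<in>F. sum (increment \<psi>) (H p))"
    proof (rule sum.cong[OF refl])
      fix p assume p: "p \<in> F"
      have "increment \<psi> q = 0" if "q \<in> H p - H' p" for q
      proof -
        have "fst q \<le> snd q" "\<not> fst q < snd q" using H(2)[OF p, of q] that unfolding H'_def by blast+
        then have "fst q = snd q" by linarith
        then show ?thesis by (simp add: increment_def)
      qed
      then show "sum (increment \<psi>) (H' p) = sum (increment \<psi>) (H p)"
        using H(1)[OF p] by (intro sum.mono_neutral_left) (auto simp: H'_def)
    qed
    finally show ?thesis using Hsum by simp
  qed
  have "(\<Sum>q\<in>A. norm (increment (\<lambda>x. complex_of_real (\<phi> x)) q)) < c * e0 / 2"
  proof (rule AC)
    show "finite A" unfolding A_def using F(1) H(1) by (auto simp: H'_def)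
    show "a \<le> fst q \<and> fst q \<le> snd q \<and> snd q \<le> b" if "q \<in> A" for q
    proof -
      from that obtain p where p: "p \<in> F" "q \<in> H p" unfolding A_def H'_def by blast
      have "ivl p \<subseteq> {a..b}" using F(3)[OF p(1)] \<open>U \<subseteq> {a..b}\<close> by blast
      then show ?thesis using H(2)[OF p] F(2)[OF p(1)] by auto
    qed
    show "nonoverlapping A"
      unfolding nonoverlapping_def
    proof (rule pairwiseI)
      fix q q' assume q: "q \<in> A" "q' \<in> A" "q \<noteq> q'"
      then obtain p p' where p: "p \<in> F" "p' \<in> F" "q \<in> H' p" "q' \<in> H' p'" unfolding A_def by blast
      show "oivl q \<inter> oivl q' = {}"
      proof (cases "p = p'")
        case True
        then show ?thesis using H(3)[OF p(1)] p q(3) by (auto simp: nonoverlapping_def pairwise_def H'_def)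
      next
        case False
        then show ?thesis using H'disj p by blast
      qed
    qed
    have "(\<Sum>q\<in>A. snd q - fst q) = (\<Sum>p\<in>F. snd p - fst p) - (\<Sum>p\<in>G. snd p - fst p)"
      using sumA[of "\<lambda>x. x"] by (simp add: increment_def[abs_def])
    then show "(\<Sum>q\<in>A. snd q - fst q) < \<delta>0" using lenF lenG d(2) by linarith
  qed
  moreover have "norm (increment (\<lambda>x. complex_of_real (\<phi> x)) q) = \<bar>increment \<phi> q\<bar>" for q
    by (simp add: increment_def flip: of_real_diff)
  ultimately have small: "(\<Sum>q\<in>A. \<bar>increment \<phi> q\<bar>) < c * e0 / 2" by simp
  have "sum (increment \<phi>) F \<le> 0"
  proof (rule sum_nonpos)
    fix p assume p: "p \<in> F"
    have "increment \<phi> p / (snd p - fst p) < 0" using F(4)[OF p] \<open>c > 0\<close> by linarith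
    then show "increment \<phi> p \<le> 0" using F(2)[OF p] by (simp add: divide_less_0_iff)
  qed
  moreover have "sum (increment \<phi>) G \<ge> c * e0 / 2"
  proof -
    have "c * (e0 / 2) \<le> c * (\<Sum>p\<in>G. snd p - fst p)"
      using lenG d(3) \<open>e0 \<le> e\<close> \<open>c > 0\<close> by (intro mult_left_mono) auto
    also have "\<dots> \<le> sum (increment \<phi>) G"
      unfolding sum_distrib_left
    proof (rule sum_mono)
      fix p assume p: "p \<in> G"
      show "c * (snd p - fst p) \<le> increment \<phi> p"
        using G(4)[OF p] G(2)[OF p] by (simp add: field_simps)
    qed
    finally show ?thesis by simp
  qed
  ultimately have "c * e0 / 2 \<le> - sum (increment \<phi>) A" using sumA[of \<phi>] by simp
  also have "\<dots> \<le> (\<Sum>q\<in>A. \<bar>increment \<phi> q\<bar>)" using sum_abs[of "increment \<phi>" A] by linarith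
  finally show False using small by simp
qed

text \<open>In a ball so small that the increments of \<open>\<phi>\<close> over disjoint subintervals sum to less than \<open>1\<close>,
  disjoint intervals with slopes above \<open>2 / e\<close> have total length below \<open>e / 2\<close>.\<close>

lemma negligible_infinite_slopes:
  fixes \<phi> :: "real \<Rightarrow> real"
  assumes ac: "abs_continuous_on_interval a b (\<lambda>x. complex_of_real (\<phi> x))"
    and E: "E \<subseteq> {a<..<b}"
    and inf: "\<And>x d M. \<lbrakk>x \<in> E; d > 0\<rbrakk> \<Longrightarrow> \<exists>y. y \<noteq> x \<and> \<bar>y - x\<bar> < d \<and> M < \<bar>(\<phi> y - \<phi> x) / (y - x)\<bar>"
  shows "negligible E"
proof -
  from abs_continuous_finite_family[OF ac zero_less_one] obtain \<delta> where "\<delta> > 0" and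
    AC: "\<And>S. \<lbrakk>finite S; \<And>p. p \<in> S \<Longrightarrow> a \<le> fst p \<and> fst p \<le> snd p \<and> snd p \<le> b;
       nonoverlapping S; (\<Sum>p\<in>S. snd p - fst p) < \<delta>\<rbrakk>
       \<Longrightarrow> (\<Sum>p\<in>S. norm (increment (\<lambda>x. complex_of_real (\<phi> x)) p)) < 1" by blast
  have "negligible (E \<inter> ball x0 (\<delta> / 3))" for x0
    unfolding negligible_outer
  proof (intro allI impI)
    fix e :: real assume "e > 0"
    define U where "U = {a<..<b} \<inter> ball x0 (\<delta> / 3)"
    have U: "open U" "E \<inter> ball x0 (\<delta> / 3) \<subseteq> U" "U \<subseteq> {a..b}" using E by (auto simp: U_def)
    have "e / 2 > 0" using \<open>e > 0\<close> by simp
    have inf': "\<exists>y. y \<noteq> x \<and> \<bar>y - x\<bar> < d \<and> 2 / e < \<bar>(\<phi> y - \<phi> x) / (y - x)\<bar>"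
      if "x \<in> E \<inter> ball x0 (\<delta> / 3)" "d > 0" for x d
      using inf[of x d "2 / e"] that by simp
    obtain F R where F: "finite F" "\<And>p. p \<in> F \<Longrightarrow> fst p < snd p" "\<And>p. p \<in> F \<Longrightarrow> ivl p \<subseteq> U"
      "\<And>p. p \<in> F \<Longrightarrow> 2 / e < \<bar>increment \<phi> p / (snd p - fst p)\<bar>"
      "disjoint_ivls F"
      "R \<in> lmeasurable" "measure lebesgue R < e / 2" "E \<inter> ball x0 (\<delta> / 3) \<subseteq> R \<union> (\<Union>p\<in>F. ivl p)"
      by (rule vitali_slopes[OF U(1,2,3) \<open>e / 2 > 0\<close>, of "\<lambda>t. 2 / e < \<bar>t\<bar>" \<phi>]) (rule inf' that; simp)+
    have len: "(\<Sum>p\<in>F. snd p - fst p) = measure lebesgue (\<Union>p\<in>F. ivl p)"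
      using measure_disjoint_intervals[OF F(1) less_imp_le[OF F(2)] F(5)] by simp
    also have "\<dots> \<le> measure lebesgue (ball x0 (\<delta> / 3))"
    proof (rule measure_mono_fmeasurable)
      show "(\<Union>p\<in>F. ivl p) \<subseteq> ball x0 (\<delta> / 3)" using F(3) by (auto simp: U_def)
    qed (use lmeasurable_interval_Union[OF F(1)] in auto)
    also have "\<dots> < \<delta>" using \<open>\<delta> > 0\<close> by (simp add: ball_eq_greaterThanLessThan)
    finally have "(\<Sum>p\<in>F. snd p - fst p) < \<delta>" .
    have "(\<Sum>p\<in>F. norm (increment (\<lambda>x. complex_of_real (\<phi> x)) p)) < 1"
    proof (rule AC[OF F(1) _ disjoint_imp_nonoverlapping[OF F(5)]])
      fix p assume p: "p \<in> F"
      have "ivl p \<subseteq> {a..b}" using F(3)[OF p] U(3) by blast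
      then show "a \<le> fst p \<and> fst p \<le> snd p \<and> snd p \<le> b" using F(2)[OF p] by auto
    qed fact
    moreover have "norm (increment (\<lambda>x. complex_of_real (\<phi> x)) q) = \<bar>increment \<phi> q\<bar>" for q
      by (simp add: increment_def flip: of_real_diff)
    ultimately have "(\<Sum>p\<in>F. \<bar>increment \<phi> p\<bar>) < 1" by simp
    moreover have "2 / e * (\<Sum>p\<in>F. snd p - fst p) \<le> (\<Sum>p\<in>F. \<bar>increment \<phi> p\<bar>)"
      unfolding sum_distrib_left
    proof (rule sum_mono)
      fix p assume p: "p \<in> F"
      show "2 / e * (snd p - fst p) \<le> \<bar>increment \<phi> p\<bar>"
        using F(4)[OF p] F(2)[OF p] by (simp add: abs_divide pos_less_divide_eq)
    qed
    ultimately have "2 / e * (\<Sum>p\<in>F. snd p - fst p) < 1" by linarith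
    then have small: "(\<Sum>p\<in>F. snd p - fst p) < e / 2" using \<open>e > 0\<close> by (simp add: field_simps)
    show "\<exists>T. E \<inter> ball x0 (\<delta> / 3) \<subseteq> T \<and> T \<in> lmeasurable \<and> measure lebesgue T < e"
    proof (intro exI conjI)
      show "E \<inter> ball x0 (\<delta> / 3) \<subseteq> R \<union> (\<Union>p\<in>F. ivl p)" by (rule F(8))
      show "R \<union> (\<Union>p\<in>F. ivl p) \<in> lmeasurable"
        using F(6) lmeasurable_interval_Union[OF F(1)] by (rule fmeasurable.Un)
      have "measure lebesgue (R \<union> (\<Union>p\<in>F. ivl p)) \<le> measure lebesgue R + measure lebesgue (\<Union>p\<in>F. ivl p)"
        using F(6) lmeasurable_interval_Union[OF F(1)] by (intro measure_Un_le) auto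
      then show "measure lebesgue (R \<union> (\<Union>p\<in>F. ivl p)) < e" using F(7) small len by linarith
    qed
  qed
  then show ?thesis
    unfolding locally_negligible_alt[of E]
    using \<open>\<delta> > 0\<close> by (metis centre_in_ball openin_open_Int open_ball IntI zero_less_divide_iff zero_less_numeral)
qed

lemma abs_continuous_comparison:
  assumes ac: "abs_continuous_on_interval a b g" and "k \<ge> 0"
    and le: "\<And>x y. x \<le> y \<Longrightarrow> norm (h y - h x) \<le> norm (g y - g x) + k * (y - x)"
  shows "abs_continuous_on_interval a b h"
  unfolding abs_continuous_on_interval_def
proof (intro allI impI)
  fix e :: real assume "e > 0"
  then have "e / 2 > 0" by simp
  from ac[unfolded abs_continuous_on_interval_def, THEN spec, THEN mp, OF this]
  obtain \<delta> where d: "\<delta> > 0" and A: "\<forall>(n::nat) u v. (\<forall>i<n. a \<le> u i \<and> u i \<le> v i \<and> v i \<le> b) \<longrightarrow>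
        (\<forall>i<n. \<forall>j<n. i \<noteq> j \<longrightarrow> {u i<..<v i} \<inter> {u j<..<v j} = {}) \<longrightarrow>
        (\<Sum>i<n. v i - u i) < \<delta> \<longrightarrow> (\<Sum>i<n. norm (g (v i) - g (u i))) < e / 2"
    by (elim exE conjE)
  define \<delta>' where "\<delta>' = min \<delta> (e / (2 * (k + 1)))"
  have d': "\<delta>' > 0" "\<delta>' \<le> \<delta>" "k * \<delta>' \<le> e / 2"
  proof -
    show "\<delta>' > 0" "\<delta>' \<le> \<delta>" using d \<open>e > 0\<close> \<open>k \<ge> 0\<close> by (auto simp: \<delta>'_def)
    then have "k * \<delta>' \<le> (k + 1) * (e / (2 * (k + 1)))"
      using \<open>k \<ge> 0\<close> by (intro mult_mono) (auto simp: \<delta>'_def)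
    also have "\<dots> = e / 2" using \<open>k \<ge> 0\<close> by (simp add: field_simps)
    finally show "k * \<delta>' \<le> e / 2" .
  qed
  show "\<exists>\<delta>>0. \<forall>(n::nat) u v. (\<forall>i<n. a \<le> u i \<and> u i \<le> v i \<and> v i \<le> b) \<longrightarrow>
        (\<forall>i<n. \<forall>j<n. i \<noteq> j \<longrightarrow> {u i<..<v i} \<inter> {u j<..<v j} = {}) \<longrightarrow>
        (\<Sum>i<n. v i - u i) < \<delta> \<longrightarrow> (\<Sum>i<n. norm (h (v i) - h (u i))) < e"
  proof (rule exI[of _ \<delta>'], intro conjI allI impI)
    fix n :: nat and u v :: "nat \<Rightarrow> real"
    assume 1: "\<forall>i<n. a \<le> u i \<and> u i \<le> v i \<and> v i \<le> b"
      and 2: "\<forall>i<n. \<forall>j<n. i \<noteq> j \<longrightarrow> {u i<..<v i} \<inter> {u j<..<v j} = {}"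
      and 3: "(\<Sum>i<n. v i - u i) < \<delta>'"
    have "(\<Sum>i<n. norm (h (v i) - h (u i))) \<le> (\<Sum>i<n. norm (g (v i) - g (u i))) + k * (\<Sum>i<n. v i - u i)"
      unfolding sum_distrib_left sum.distrib[symmetric] using 1 by (intro sum_mono le) auto
    also have "(\<Sum>i<n. norm (g (v i) - g (u i))) < e / 2"
      using A[THEN spec, THEN spec, THEN spec, THEN mp, THEN mp, THEN mp, OF 1 2] 3 d'(2) by simp
    also have "k * (\<Sum>i<n. v i - u i) \<le> k * \<delta>'" using 3 \<open>k \<ge> 0\<close> by (intro mult_left_mono) auto
    finally show "(\<Sum>i<n. norm (h (v i) - h (u i))) < e" using d'(3) by simp
  qed (rule d'(1))
qed

lemma abs_continuous_add_linear:
  assumes ac: "abs_continuous_on_interval a b (\<lambda>x. complex_of_real (\<phi> x))"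
  shows "abs_continuous_on_interval a b (\<lambda>x. complex_of_real (\<phi> x - k * x))"
proof (rule abs_continuous_comparison[OF ac, of "\<bar>k\<bar>"])
  fix x y :: real assume "x \<le> y"
  have "\<bar>(\<phi> y - \<phi> x) - k * (y - x)\<bar> \<le> \<bar>\<phi> y - \<phi> x\<bar> + \<bar>k\<bar> * (y - x)"
    using abs_triangle_ineq4[of "\<phi> y - \<phi> x" "k * (y - x)"] \<open>x \<le> y\<close> by (simp add: abs_mult)
  moreover have "(\<phi> y - k * y) - (\<phi> x - k * x) = (\<phi> y - \<phi> x) - k * (y - x)" by (simp add: algebra_simps)
  ultimately show "norm (complex_of_real (\<phi> y - k * y) - complex_of_real (\<phi> x - k * x))
      \<le> norm (complex_of_real (\<phi> y) - complex_of_real (\<phi> x)) + \<bar>k\<bar> * (y - x)"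
    by (simp only: of_real_diff[symmetric] norm_of_real)
qed simp

text \<open>Off the null sets of infinite and of oscillating slopes, the difference quotient is bounded and
  cannot cross any rational gap \<open>p < q\<close> infinitely often, hence converges.  Subtracting a linear
  function makes the gap symmetric about \<open>0\<close>.\<close>

lemma abs_continuous_differentiable_ae_real:
  fixes \<phi> :: "real \<Rightarrow> real"
  assumes ac: "abs_continuous_on_interval a b (\<lambda>x. complex_of_real (\<phi> x))"
  obtains N where "negligible N" "\<And>x. x \<in> {a<..<b} - N \<Longrightarrow> \<exists>D. (\<phi> has_field_derivative D) (at x)"
proof -
  define Q where "Q x y = (\<phi> y - \<phi> x) / (y - x)" for x y
  define E where "E p q = {x \<in> {a<..<b}. (\<forall>d>0. \<exists>y. y \<noteq> x \<and> \<bar>y - x\<bar> < d \<and> Q x y < p) \<and>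
       (\<forall>d>0. \<exists>y. y \<noteq> x \<and> \<bar>y - x\<bar> < d \<and> q < Q x y)}" for p q :: real
  define E0 where "E0 = {x \<in> {a<..<b}. \<forall>M. \<forall>d>0. \<exists>y. y \<noteq> x \<and> \<bar>y - x\<bar> < d \<and> M < \<bar>Q x y\<bar>}"
  define P where "P = {(p, q). p \<in> \<rat> \<and> q \<in> \<rat> \<and> p < (q::real)}"
  define N where "N = E0 \<union> (\<Union>(p,q)\<in>P. E p q)"
  have 1: "negligible E0"
    by (rule negligible_infinite_slopes[OF ac]) (auto simp: E0_def Q_def)
  have 2: "negligible (E p q)" if "p < q" for p q
  proof (rule negligible_two_sided_slopes[OF abs_continuous_add_linear[OF ac, of "(p + q) / 2"], of _ "(q - p) / 2"])
    show "0 < (q - p) / 2" using that by simp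
    have shift: "(\<phi> y - (p + q) / 2 * y - (\<phi> x - (p + q) / 2 * x)) / (y - x) = Q x y - (p + q) / 2" if "y \<noteq> x" for x y
      using that by (simp add: Q_def field_simps)
    fix x d :: real assume x: "x \<in> E p q" "0 < d"
    then obtain y where y: "y \<noteq> x" "\<bar>y - x\<bar> < d" "Q x y < p" by (auto simp: E_def)
    have "Q x y - (p + q) / 2 < - ((q - p) / 2)" using y(3) by (simp add: field_simps)
    then show "\<exists>y. y \<noteq> x \<and> \<bar>y - x\<bar> < d \<and> (\<phi> y - (p + q) / 2 * y - (\<phi> x - (p + q) / 2 * x)) / (y - x) < - ((q - p) / 2)"
      using y shift[OF y(1)] by (intro exI[of _ y]) simp
    obtain y where y: "y \<noteq> x" "\<bar>y - x\<bar> < d" "q < Q x y" using x by (auto simp: E_def)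
    have "(q - p) / 2 < Q x y - (p + q) / 2" using y(3) by (simp add: field_simps)
    then show "\<exists>y. y \<noteq> x \<and> \<bar>y - x\<bar> < d \<and> (q - p) / 2 < (\<phi> y - (p + q) / 2 * y - (\<phi> x - (p + q) / 2 * x)) / (y - x)"
      using y shift[OF y(1)] by (intro exI[of _ y]) simp
  qed (auto simp: E_def)
  have "countable P"
    by (rule countable_subset[of _ "\<rat> \<times> \<rat>"]) (auto simp: P_def countable_rat)
  then have "negligible (\<Union>(p,q)\<in>P. E p q)"
    using 2 by (intro negligible_countable_Union) (auto simp: P_def)
  with 1 have N: "negligible N" by (simp add: N_def)
  have "\<exists>D. (\<phi> has_field_derivative D) (at x)" if x: "x \<in> {a<..<b} - N" for x
  proof -
    have "x \<notin> E0" using x by (auto simp: N_def)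
    then have "\<exists>M d. d > 0 \<and> (\<forall>y. y \<noteq> x \<longrightarrow> \<bar>y - x\<bar> < d \<longrightarrow> \<bar>Q x y\<bar> \<le> M)"
      using x unfolding E0_def by (simp add: not_less) (metis not_less)
    then obtain M d where "d > 0" and d: "\<And>y. y \<noteq> x \<Longrightarrow> \<bar>y - x\<bar> < d \<Longrightarrow> \<bar>Q x y\<bar> \<le> M"
      by blast
    have evM: "\<forall>\<^sub>F y in at x. \<bar>Q x y\<bar> \<le> M"
      unfolding eventually_at using \<open>d > 0\<close> d by (auto simp: dist_real_def)
    have alt: "(\<forall>\<^sub>F y in at x. p \<le> Q x y) \<or> (\<forall>\<^sub>F y in at x. Q x y \<le> q)" if "p \<in> \<rat>" "q \<in> \<rat>" "p < q" for p q
    proof -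
      have "x \<notin> E p q" using x that by (auto simp: N_def P_def)
      then have "(\<exists>d>0. \<forall>y. y \<noteq> x \<and> \<bar>y - x\<bar> < d \<longrightarrow> p \<le> Q x y) \<or> (\<exists>d>0. \<forall>y. y \<noteq> x \<and> \<bar>y - x\<bar> < d \<longrightarrow> Q x y \<le> q)"
        using x unfolding E_def by (simp add: not_less) (metis not_less)
      then show ?thesis by (simp add: eventually_at dist_real_def)
    qed
    define A where "A = {p. \<forall>\<^sub>F y in at x. p \<le> Q x y}"
    have A1: "- M \<in> A" unfolding A_def using evM by (auto elim!: eventually_mono)
    have A2: "p \<le> M" if "p \<in> A" for p
    proof -
      have "\<forall>\<^sub>F y in at x. p \<le> M"
        using that[unfolded A_def mem_Collect_eq] evM by eventually_elim auto
      then show ?thesis by simp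
    qed
    define l where "l = Sup A"
    have bdd: "bdd_above A" using A2 by (rule bdd_aboveI)
    have "(Q x \<longlongrightarrow> l) (at x)"
    proof (rule order_tendstoI)
      fix c assume "c < l"
      then obtain p where "p \<in> A" "c < p" unfolding l_def using less_cSup_iff[of A c] A1 bdd by auto
      then show "\<forall>\<^sub>F y in at x. c < Q x y" unfolding A_def by (auto elim!: eventually_mono)
    next
      fix c assume "l < c"
      obtain q where q: "l < q" "q < c" "q \<in> \<rat>" using Rats_dense_in_real[OF \<open>l < c\<close>] by blast
      obtain p where p: "l < p" "p < q" "p \<in> \<rat>" using Rats_dense_in_real[OF q(1)] by blast
      have "p \<notin> A" using p(1) cSup_upper[OF _ bdd, of p] by (auto simp: l_def)
      then have "\<forall>\<^sub>F y in at x. Q x y \<le> q" using alt[OF p(3) q(3) p(2)] by (auto simp: A_def)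
      then show "\<forall>\<^sub>F y in at x. Q x y < c" using q(2) by (auto elim!: eventually_mono)
    qed
    then have "(\<phi> has_field_derivative l) (at x)"
      unfolding has_field_derivative_iff Q_def .
    then show ?thesis by blast
  qed
  with N show ?thesis by (rule that)
qed

lemma abs_continuous_differentiable_ae:
  assumes ac: "abs_continuous_on_interval a b g"
  obtains N where "negligible N" "\<And>x. x \<in> {a<..<b} - N \<Longrightarrow> g differentiable (at x)"
proof -
  have "abs_continuous_on_interval a b (\<lambda>x. complex_of_real (Re (g x)))"
    by (rule abs_continuous_comparison[OF ac order_refl])
      (simp, metis abs_Re_le_cmod minus_complex.simps(1) norm_of_real of_real_diff)
  then obtain N1 where N1: "negligible N1" "\<And>x. x \<in> {a<..<b} - N1 \<Longrightarrow> \<exists>D. ((\<lambda>x. Re (g x)) has_field_derivative D) (at x)"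
    by (rule abs_continuous_differentiable_ae_real) blast
  have "abs_continuous_on_interval a b (\<lambda>x. complex_of_real (Im (g x)))"
    by (rule abs_continuous_comparison[OF ac order_refl])
      (simp, metis abs_Im_le_cmod minus_complex.simps(2) norm_of_real of_real_diff)
  then obtain N2 where N2: "negligible N2" "\<And>x. x \<in> {a<..<b} - N2 \<Longrightarrow> \<exists>D. ((\<lambda>x. Im (g x)) has_field_derivative D) (at x)"
    by (rule abs_continuous_differentiable_ae_real) blast
  show ?thesis
  proof (rule that[of "N1 \<union> N2"])
    fix x assume x: "x \<in> {a<..<b} - (N1 \<union> N2)"
    then obtain D1 D2 where "((\<lambda>x. Re (g x)) has_field_derivative D1) (at x)"
      "((\<lambda>x. Im (g x)) has_field_derivative D2) (at x)" using N1(2) N2(2) by blast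
    then have "(g has_vector_derivative Complex D1 D2) (at x)"
      by (simp add: has_vector_derivative_complex_iff)
    then show "g differentiable (at x)" by (rule differentiableI_vector)
  qed (use N1 N2 in simp)
qed

text \<open>The exceptional points are tags of intervals inside an open set of small measure, over which the
  total increment of \<open>g\<close> is small by absolute continuity; at the other tags the usual straddle
  estimate applies.  The Henstock integral thus yields the theorem without any domination of \<open>g'\<close>.\<close>

lemma abs_continuous_FTC:
  assumes "a \<le> b" and ac: "abs_continuous_on_interval a b g" and N: "negligible N"
    and der: "\<And>x. x \<in> {a<..<b} - N \<Longrightarrow> (g has_vector_derivative g' x) (at x)"
  shows "(g' has_integral (g b - g a)) {a..b}"
proof -
  define N' where "N' = N \<union> {a, b}"
  define h where "h x = (if x \<in> N' then 0 else g' x)" for x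
  have N': "negligible N'" using N by (simp add: N'_def)
  have "(h has_integral (g b - g a)) {a..b}"
    unfolding has_integral_real
  proof (intro allI impI)
    fix e :: real assume "e > 0"
    then have "e / 2 > 0" by simp
    define e1 where "e1 = e / (2 * (b - a + 1))"
    have "e1 > 0" using \<open>e > 0\<close> \<open>a \<le> b\<close> by (simp add: e1_def)
    have e1: "e1 * (b - a) < e / 2"
    proof -
      have "e1 * (b - a) < e1 * (b - a + 1)" using \<open>e1 > 0\<close> by simp
      also have "\<dots> = e / 2" using \<open>a \<le> b\<close> by (simp add: e1_def field_simps)
      finally show ?thesis .
    qed
    from abs_continuous_finite_family[OF ac \<open>e / 2 > 0\<close>] obtain \<delta> where "\<delta> > 0" and
      AC: "\<And>S. \<lbrakk>finite S; \<And>p. p \<in> S \<Longrightarrow> a \<le> fst p \<and> fst p \<le> snd p \<and> snd p \<le> b;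
         nonoverlapping S; (\<Sum>p\<in>S. snd p - fst p) < \<delta>\<rbrakk> \<Longrightarrow> (\<Sum>p\<in>S. norm (increment g p)) < e / 2" by blast
    obtain U where U: "open U" "N' \<subseteq> U" "U - N' \<in> lmeasurable" "emeasure lebesgue (U - N') < ennreal \<delta>"
      using sets_lebesgue_outer_open[of N' \<delta>] negligible_imp_sets[OF N'] \<open>\<delta> > 0\<close> by blast
    have "measure lebesgue (U - N') < \<delta>"
      using U(3,4) \<open>\<delta> > 0\<close> by (simp add: emeasure_eq_measure2 ennreal_less_iff)
    moreover have "U = N' \<union> (U - N')" using U(2) by blast
    moreover have "measure lebesgue (N' \<union> (U - N')) \<le> measure lebesgue N' + measure lebesgue (U - N')"
      using U(3) N' by (intro measure_Un_le) (auto simp: negligible_imp_sets)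
    ultimately have mU: "U \<in> lmeasurable" "measure lebesgue U < \<delta>"
      using U(3) N' by (metis fmeasurable.Un negligible_imp_measurable) (use N' \<open>measure lebesgue (U - N') < \<delta>\<close>
         \<open>U = N' \<union> (U - N')\<close> \<open>measure lebesgue (N' \<union> (U - N')) \<le> measure lebesgue N' + measure lebesgue (U - N')\<close> in \<open>simp add: negligible_imp_measure0\<close>)
    have "\<exists>d>0. x \<in> {a..b} - N' \<longrightarrow> (\<forall>y. \<bar>y - x\<bar> < d \<longrightarrow> norm (g y - g x - (y - x) *\<^sub>R h x) \<le> e1 * \<bar>y - x\<bar>)" for x
    proof (cases "x \<in> {a..b} - N'")
      case True
      then have "(g has_vector_derivative h x) (at x)"
        using der[of x] by (force simp: N'_def h_def)
      then show ?thesis using \<open>e1 > 0\<close>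
        unfolding has_vector_derivative_def has_derivative_within_alt by auto
    qed (auto intro: exI[of _ 1])
    then obtain d where d: "\<And>x. d x > 0"
      "\<And>x y. x \<in> {a..b} - N' \<Longrightarrow> \<bar>y - x\<bar> < d x \<Longrightarrow> norm (g y - g x - (y - x) *\<^sub>R h x) \<le> e1 * \<bar>y - x\<bar>"
      by metis
    define \<gamma> where "\<gamma> x = (if x \<in> N' then U else ball x (d x))" for x
    show "\<exists>\<gamma>. gauge \<gamma> \<and> (\<forall>\<D>. \<D> tagged_division_of {a..b} \<and> \<gamma> fine \<D> \<longrightarrow>
        norm ((\<Sum>(x, k)\<in>\<D>. measure lborel k *\<^sub>R h x) - (g b - g a)) < e)"
    proof (rule exI[of _ \<gamma>], intro conjI allI impI)
      show "gauge \<gamma>" using d(1) U(1,2) by (auto simp: gauge_def \<gamma>_def)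
      fix p assume "p tagged_division_of {a..b} \<and> \<gamma> fine p"
      then have p: "p tagged_division_of {a..b}" "\<gamma> fine p" by auto
      note pD = tagged_division_ofD[OF p(1)]
      have K: "\<exists>u v. K = {u..v} \<and> a \<le> u \<and> u \<le> x \<and> x \<le> v \<and> v \<le> b" if "(x, K) \<in> p" for x K
      proof -
        from pD(4)[OF that] obtain u v where "K = {u..v}" by auto
        then show ?thesis using pD(2,3)[OF that] by auto
      qed
      define p1 where "p1 = {(x, K) \<in> p. x \<notin> N'}"
      define p2 where "p2 = {(x, K) \<in> p. x \<in> N'}"
      have p12: "p = p1 \<union> p2" "p1 \<inter> p2 = {}" "finite p1" "finite p2"
        using pD(1) by (auto simp: p1_def p2_def intro: rev_finite_subset)
      define r where "r = (\<lambda>(x, K). measure lborel K *\<^sub>R h x - (g (Sup K) - g (Inf K)))"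
      have tot: "(\<Sum>(x, k)\<in>p. measure lborel k *\<^sub>R h x) - (g b - g a) = sum r p1 + sum r p2"
      proof -
        have "g b - g a = (\<Sum>(x,K)\<in>p. g (Sup K) - g (Inf K))"
          using additive_tagged_division_1[OF \<open>a \<le> b\<close> p(1), of g] by simp
        then have "(\<Sum>(x, k)\<in>p. measure lborel k *\<^sub>R h x) - (g b - g a) = sum r p"
          by (simp add: r_def sum_subtractf case_prod_beta)
        also have "\<dots> = sum r p1 + sum r p2" using p12 by (simp add: sum.union_disjoint)
        finally show ?thesis .
      qed
      have "norm (sum r p1) \<le> (\<Sum>(x,K)\<in>p1. e1 * (Sup K - Inf K))"
        unfolding case_prod_beta
      proof (rule sum_norm_le)
        fix q assume "q \<in> p1"
        then obtain x K where q: "q = (x, K)" "(x, K) \<in> p" "x \<notin> N'" by (auto simp: p1_def)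
        obtain u v where uv: "K = {u..v}" "a \<le> u" "u \<le> x" "x \<le> v" "v \<le> b" using K[OF q(2)] by blast
        have "K \<subseteq> ball x (d x)" using fineD[OF p(2) q(2)] q(3) by (simp add: \<gamma>_def)
        moreover have "u \<in> K" "v \<in> K" using uv by auto
        ultimately have uvd: "\<bar>u - x\<bar> < d x" "\<bar>v - x\<bar> < d x"
          by (auto simp: dist_real_def abs_minus_commute)
        have x: "x \<in> {a..b} - N'" using q uv by auto
        have "r q = (g u - g x - (u - x) *\<^sub>R h x) - (g v - g x - (v - x) *\<^sub>R h x)"
          using uv by (simp add: r_def q algebra_simps)
        also have "norm \<dots> \<le> e1 * \<bar>u - x\<bar> + e1 * \<bar>v - x\<bar>"
          by (intro order_trans[OF norm_triangle_ineq4] add_mono d(2)[OF x] uvd)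
        also have "\<dots> = e1 * (v - u)" using uv by (simp add: algebra_simps)
        finally show "norm (r q) \<le> e1 * (Sup (snd q) - Inf (snd q))" using uv by (simp add: q)
      qed
      also have "\<dots> \<le> (\<Sum>(x,K)\<in>p. e1 * (Sup K - Inf K))"
      proof (rule sum_mono2)
        show "finite p" "p1 \<subseteq> p" using pD(1) p12 by auto
        fix q assume "q \<in> p - p1"
        then obtain x k where q: "q = (x, k)" "(x, k) \<in> p" by (cases q) auto
        show "0 \<le> (case q of (x, K) \<Rightarrow> e1 * (Sup K - Inf K))"
          using K[OF q(2)] \<open>e1 > 0\<close> by (auto simp: q)
      qed
      also have "\<dots> = e1 * (b - a)"
        using additive_tagged_division_1[OF \<open>a \<le> b\<close> p(1), of "\<lambda>x. x"]
        by (simp add: case_prod_beta flip: sum_distrib_left)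
      finally have n1: "norm (sum r p1) < e / 2" using e1 by simp
      define p3 where "p3 = {(x, K) \<in> p2. Inf K < Sup K}"
      define J where "J = (\<lambda>(x::real, K::real set). (Inf K, Sup K))"
      have p3: "p3 \<subseteq> p2" "finite p3" using p12(4) by (auto simp: p3_def intro: rev_finite_subset)
      have dj: "oivl (J q) \<inter> oivl (J q') = {}"
        if q: "q \<in> p3" "q' \<in> p3" "q \<noteq> q'" for q q'
      proof -
        obtain x k x' k' where q': "q = (x, k)" "(x, k) \<in> p" "q' = (x', k')" "(x', k') \<in> p"
          using q by (cases q; cases q') (auto simp: p3_def p2_def)
        have "interior k \<inter> interior k' = {}" using pD(5) q' q(3) by blast
        then show ?thesis using K[OF q'(2)] K[OF q'(4)] unfolding q' J_def
          by (auto simp: interior_atLeastAtMost_real)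
      qed
      have inj: "inj_on J p3"
      proof (rule inj_onI, rule ccontr)
        fix q q' assume q: "q \<in> p3" "q' \<in> p3" "J q = J q'" "q \<noteq> q'"
        have "oivl (J q) = {}" using dj[OF q(1,2,4)] q(3) by simp
        then show False using q(1) by (auto simp: p3_def J_def)
      qed
      have "norm (sum r p2) \<le> (\<Sum>q\<in>p2. norm (increment g (J q)))"
      proof (rule sum_norm_le)
        fix q assume "q \<in> p2"
        then show "norm (r q) \<le> norm (increment g (J q))"
          by (auto simp: p2_def r_def h_def increment_def J_def norm_minus_commute)
      qed
      also have "\<dots> = (\<Sum>q\<in>p3. norm (increment g (J q)))"
      proof (rule sum.mono_neutral_right[OF p12(4) p3(1)], rule ballI)
        fix q assume q: "q \<in> p2 - p3"
        then obtain x k where q': "q = (x, k)" "(x, k) \<in> p" by (cases q) (auto simp: p2_def)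
        obtain u v where uv: "k = {u..v}" "u \<le> v" using K[OF q'(2)] by force
        have "\<not> u < v" using q uv by (auto simp: p3_def q')
        then have "u = v" using uv(2) by simp
        then show "norm (increment g (J q)) = 0" by (simp add: q' increment_def J_def uv)
      qed
      also have "\<dots> = (\<Sum>q\<in>J ` p3. norm (increment g q))"
        using sum.reindex[OF inj, of "\<lambda>q. norm (increment g q)"] by simp
      also have "\<dots> < e / 2"
      proof (rule AC)
        show "finite (J ` p3)" using p3 by simp
        show "a \<le> fst q \<and> fst q \<le> snd q \<and> snd q \<le> b" if "q \<in> J ` p3" for q
        proof -
          obtain x k where q: "q = J (x, k)" "(x, k) \<in> p" using \<open>q \<in> J ` p3\<close> by (auto simp: p3_def p2_def)
          show ?thesis using K[OF q(2)] by (auto simp: q J_def)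
        qed
        show "nonoverlapping (J ` p3)"
          unfolding nonoverlapping_def pairwise_image
        proof (rule pairwiseI, rule impI)
          fix q q' assume "q \<in> p3" "q' \<in> p3" "q \<noteq> q'"
          then show "oivl (J q) \<inter> oivl (J q') = {}" by (rule dj)
        qed
        have "(\<Sum>q\<in>J ` p3. snd q - fst q) = (\<Sum>q\<in>p3. measure lebesgue (oivl (J q)))"
          using sum.reindex[OF inj, of "\<lambda>q. snd q - fst q"] by (auto simp: p3_def J_def intro!: sum.cong)
        also have "\<dots> = measure lebesgue (\<Union>q\<in>p3. oivl (J q))"
          using p3(2) dj by (intro measure_UNION'[symmetric]) (auto simp: pairwise_def disjnt_def)
        also have "\<dots> \<le> measure lebesgue U"
        proof (rule measure_mono_fmeasurable)
          show "(\<Union>q\<in>p3. oivl (J q)) \<subseteq> U"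
          proof
            fix y assume "y \<in> (\<Union>q\<in>p3. oivl (J q))"
            then obtain x k where q: "(x, k) \<in> p" "x \<in> N'" "y \<in> {Inf k<..<Sup k}"
              by (auto simp: p3_def p2_def J_def)
            have "k \<subseteq> U" using fineD[OF p(2) q(1)] q(2) by (simp add: \<gamma>_def)
            then show "y \<in> U" using K[OF q(1)] q(3) by auto
          qed
          show "(\<Union>q\<in>p3. oivl (J q)) \<in> sets lebesgue" using p3(2) by (intro sets.finite_UN) auto
        qed (rule mU(1))
        finally show "(\<Sum>q\<in>J ` p3. snd q - fst q) < \<delta>" using mU(2) by simp
      qed
      finally show "norm ((\<Sum>(x, k)\<in>p. measure lborel k *\<^sub>R h x) - (g b - g a)) < e"
        unfolding tot using n1 norm_triangle_ineq[of "sum r p1" "sum r p2"] by linarith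
    qed
  qed
  then show ?thesis
    by (rule has_integral_spike[OF N', rotated]) (auto simp: h_def)
qed

section \<open>Chebyshev polynomials\<close>

fun cheb :: "nat \<Rightarrow> real poly" where
  "cheb 0 = 1"
| "cheb (Suc 0) = [:0, 1:]"
| "cheb (Suc (Suc n)) = [:0, 2:] * cheb (Suc n) - cheb n"

text \<open>The Chebyshev polynomials of the second kind.  The unusual recursion, by steps of two through
  \<open>U\<^sub>n\<^sub>+\<^sub>2 - U\<^sub>n = 2 T\<^sub>n\<^sub>+\<^sub>2\<close>, is the one that can be differentiated to bound \<open>U\<^sub>n'\<close>.\<close>

fun cheb_U :: "nat \<Rightarrow> real poly" where
  "cheb_U 0 = 1"
| "cheb_U (Suc 0) = [:0, 2:]"
| "cheb_U (Suc (Suc n)) = cheb_U n + smult 2 (cheb (Suc (Suc n)))"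

lemma poly_cheb_cos: "poly (cheb n) (cos t) = cos (real n * t)"
proof (induction n rule: cheb.induct)
  case (3 n)
  have "cos (real (Suc (Suc n)) * t) + cos (real n * t) = 2 * cos t * cos (real (Suc n) * t)"
    using cos_add[of "real (Suc n) * t" t] cos_diff[of "real (Suc n) * t" t]
    by (simp add: algebra_simps)
  then show ?case using 3 by (simp add: algebra_simps)
qed auto

lemma sin_poly_cheb_U_cos: "sin t * poly (cheb_U n) (cos t) = sin (real (Suc n) * t)"
proof (induction n rule: cheb_U.induct)
  case 2
  then show ?case using sin_double[of t] by simp
next
  case (3 n)
  have "sin (real (Suc (Suc (Suc n))) * t) - sin (real (Suc n) * t) = 2 * sin t * cos (real (Suc (Suc n)) * t)"
    using sin_add[of "real (Suc (Suc n)) * t" t] sin_diff[of "real (Suc (Suc n)) * t" t]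
    by (simp add: algebra_simps)
  then show ?case using 3 poly_cheb_cos[of "Suc (Suc n)" t]
    by (simp add: algebra_simps del: cheb.simps)
qed auto

lemma poly_eq_on_cos:
  fixes p q :: "real poly"
  assumes "\<And>t. 0 < t \<Longrightarrow> t < pi \<Longrightarrow> poly p (cos t) = poly q (cos t)"
  shows "p = q"
proof (rule ccontr)
  assume "p \<noteq> q"
  then have "finite {x. poly (p - q) x = 0}" by (intro poly_roots_finite) simp
  moreover have "{-1<..<1} \<subseteq> {x. poly (p - q) x = 0}"
  proof
    fix x :: real assume x: "x \<in> {-1<..<1}"
    then have "0 < arccos x" "arccos x < pi" "cos (arccos x) = x"
      using arccos_lt_bounded[of x] by auto
    then show "x \<in> {x. poly (p - q) x = 0}" using assms[of "arccos x"] by simp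
  qed
  ultimately have "finite {-1<..<1::real}" by (rule finite_subset[rotated])
  then show False by (simp add: infinite_Ioo)
qed

lemma poly_cos_DERIV:
  "((\<lambda>t. poly p (cos t)) has_real_derivative (- sin t * poly (pderiv p) (cos t))) (at t within S)"
  by (auto intro!: derivative_eq_intros DERIV_subset[OF DERIV_chain2[OF poly_DERIV DERIV_cos]])

lemma sin_pderiv_cheb_cos: "sin t * poly (pderiv (cheb n)) (cos t) = real n * sin (real n * t)"
proof -
  have "((\<lambda>t. poly (cheb n) (cos t)) has_real_derivative (- sin t * poly (pderiv (cheb n)) (cos t))) (at t)"
    by (rule poly_cos_DERIV)
  moreover have "((\<lambda>t. cos (real n * t)) has_real_derivative (- real n * sin (real n * t))) (at t)"
    by (auto intro!: derivative_eq_intros)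
  ultimately have "- sin t * poly (pderiv (cheb n)) (cos t) = - real n * sin (real n * t)"
    unfolding poly_cheb_cos by (rule DERIV_unique)
  then show ?thesis by simp
qed

lemma pderiv_cheb_Suc: "pderiv (cheb (Suc n)) = smult (real (Suc n)) (cheb_U n)"
proof (rule poly_eq_on_cos)
  fix t :: real assume t: "0 < t" "t < pi"
  then have "sin t \<noteq> 0" using sin_gt_zero by force
  moreover have "sin t * poly (pderiv (cheb (Suc n))) (cos t) = sin t * poly (smult (real (Suc n)) (cheb_U n)) (cos t)"
    using sin_pderiv_cheb_cos[of t "Suc n"] sin_poly_cheb_U_cos[of t n] by simp
  ultimately show "poly (pderiv (cheb (Suc n))) (cos t) = poly (smult (real (Suc n)) (cheb_U n)) (cos t)"
    by simp
qed

lemma cheb_ODE: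
  "[:1, 0, -1:] * pderiv (pderiv (cheb n)) - [:0, 1:] * pderiv (cheb n) + smult ((real n)\<^sup>2) (cheb n) = 0"
proof (rule poly_eq_on_cos)
  fix t :: real
  have "((\<lambda>t. sin t * poly (pderiv (cheb n)) (cos t)) has_real_derivative
      (cos t * poly (pderiv (cheb n)) (cos t) + (- sin t * poly (pderiv (pderiv (cheb n))) (cos t)) * sin t)) (at t)"
    by (rule DERIV_mult[OF DERIV_sin poly_cos_DERIV])
  moreover have "((\<lambda>t. real n * sin (real n * t)) has_real_derivative (real n)\<^sup>2 * cos (real n * t)) (at t)"
    by (auto intro!: derivative_eq_intros simp: power2_eq_square)
  ultimately have "cos t * poly (pderiv (cheb n)) (cos t) + (- sin t * poly (pderiv (pderiv (cheb n))) (cos t)) * sin t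
    = (real n)\<^sup>2 * cos (real n * t)"
    unfolding sin_pderiv_cheb_cos by (rule DERIV_unique)
  then have "cos t * poly (pderiv (cheb n)) (cos t) - (sin t)\<^sup>2 * poly (pderiv (pderiv (cheb n))) (cos t)
    = (real n)\<^sup>2 * cos (real n * t)"
    by (simp add: power2_eq_square algebra_simps)
  then show "poly ([:1, 0, -1:] * pderiv (pderiv (cheb n)) - [:0, 1:] * pderiv (cheb n) + smult ((real n)\<^sup>2) (cheb n)) (cos t)
    = poly 0 (cos t)"
    unfolding sin_squared_eq by (simp add: poly_cheb_cos algebra_simps power2_eq_square)
qed

text \<open>The Chebyshev differential equation, differentiated \<open>k\<close> times.\<close>

lemma cheb_ODE_higher:
  fixes n :: nat
  defines "D \<equiv> \<lambda>k. (pderiv ^^ k) (cheb n)"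
  shows "[:1, 0, -1:] * D (Suc (Suc k)) - smult (2 * real k + 1) ([:0, 1:] * D (Suc k))
    + smult ((real n)\<^sup>2 - (real k)\<^sup>2) (D k) = 0"
proof (induction k)
  case 0
  then show ?case using cheb_ODE[of n] by (simp add: D_def)
next
  case (Suc k)
  have D: "pderiv (D j) = D (Suc j)" for j by (simp add: D_def)
  have p1: "pderiv ([:1, 0, -1:] * X) = [:1, 0, -1:] * pderiv X + [:0, -2:] * X" for X :: "real poly"
    unfolding pderiv_mult by (simp add: pderiv_pCons)
  have p2: "pderiv ([:0, 1:] * X) = [:0, 1:] * pderiv X + X" for X :: "real poly"
    unfolding pderiv_mult by (simp add: pderiv_pCons)
  have "0 = pderiv ([:1, 0, -1:] * D (Suc (Suc k)) - smult (2 * real k + 1) ([:0, 1:] * D (Suc k))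
    + smult ((real n)\<^sup>2 - (real k)\<^sup>2) (D k))" using Suc.IH by simp
  also have "\<dots> = [:1, 0, -1:] * D (Suc (Suc (Suc k))) + [:0, -2:] * D (Suc (Suc k))
      - smult (2 * real k + 1) ([:0, 1:] * D (Suc (Suc k)) + D (Suc k))
    + smult ((real n)\<^sup>2 - (real k)\<^sup>2) (D (Suc k))"
    by (simp only: pderiv_add pderiv_diff pderiv_smult p1 p2 D)
  finally have "poly ([:1, 0, -1:] * D (Suc (Suc (Suc k))) + [:0, -2:] * D (Suc (Suc k))
      - smult (2 * real k + 1) ([:0, 1:] * D (Suc (Suc k)) + D (Suc k))
    + smult ((real n)\<^sup>2 - (real k)\<^sup>2) (D (Suc k))) x = 0" for x
    by (metis poly_0)
  then have "poly ([:1, 0, -1:] * D (Suc (Suc (Suc k))) - smult (2 * real (Suc k) + 1) ([:0, 1:] * D (Suc (Suc k)))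
    + smult ((real n)\<^sup>2 - (real (Suc k))\<^sup>2) (D (Suc k))) x = 0" for x
    by (simp add: algebra_simps power2_eq_square)
  then show ?case using poly_all_0_iff_0 by blast
qed

text \<open>At \<open>x = 1\<close> and \<open>x = -1\<close> the second-order term of the differential equation vanishes.\<close>

lemma abs_pderiv_cheb_endpoint:
  assumes "x = 1 \<or> x = -1"
  shows "\<bar>poly (pderiv (cheb n)) x\<bar> = (real n)\<^sup>2"
proof -
  have "\<bar>poly (cheb n) x\<bar> = 1"
  proof (cases "x = 1")
    case True
    then show ?thesis using poly_cheb_cos[of n 0] by simp
  next
    case False
    then have "x = cos pi" using assms by simp
    then show ?thesis using poly_cheb_cos[of n pi] by (simp add: cos_npi)
  qed
  moreover have "x * poly (pderiv (cheb n)) x = (real n)\<^sup>2 * poly (cheb n) x"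
    using arg_cong[OF cheb_ODE[of n], of "\<lambda>p. poly p x"] assms by auto
  then have "\<bar>x\<bar> * \<bar>poly (pderiv (cheb n)) x\<bar> = (real n)\<^sup>2 * \<bar>poly (cheb n) x\<bar>"
    by (metis abs_mult abs_power2)
  moreover have "\<bar>x\<bar> = 1" using assms by auto
  ultimately show ?thesis by simp
qed

text \<open>The derivative \<open>T\<^sub>n'\<close> has size \<open>n\<^sup>2\<close> near the endpoints, but \<open>sin t * T\<^sub>n' (cos t) = n sin (n t)\<close>
  is only of size \<open>n\<close>.  Summing this over the recursion gives the bound.\<close>

lemma abs_sin_pderiv_cheb_U: "\<bar>sin t * poly (pderiv (cheb_U n)) (cos t)\<bar> \<le> (real n + 1)\<^sup>2"
proof (induction n rule: cheb_U.induct)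
  case 2
  have "\<bar>sin t\<bar> \<le> 1" by simp
  then have "\<bar>sin t\<bar> \<le> 2" by linarith
  then show ?case by (simp add: pderiv_pCons abs_mult)
next
  case (3 n)
  have "sin t * poly (pderiv (cheb_U (Suc (Suc n)))) (cos t)
    = sin t * poly (pderiv (cheb_U n)) (cos t) + 2 * (real (Suc (Suc n)) * sin (real (Suc (Suc n)) * t))"
    unfolding sin_pderiv_cheb_cos[symmetric] by (simp add: pderiv_add pderiv_smult algebra_simps del: cheb.simps)
  also have "\<bar>\<dots>\<bar> \<le> (real n + 1)\<^sup>2 + 2 * real (Suc (Suc n))"
  proof -
    have "real (Suc (Suc n)) * \<bar>sin (real (Suc (Suc n)) * t)\<bar> \<le> real (Suc (Suc n)) * 1"
      by (rule mult_left_mono) (rule abs_sin_le_one, simp)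
    then have "\<bar>2 * (real (Suc (Suc n)) * sin (real (Suc (Suc n)) * t))\<bar> \<le> 2 * real (Suc (Suc n))"
      by (simp add: abs_mult del: of_nat_Suc)
    then show ?thesis using 3 by linarith
  qed
  also have "\<dots> \<le> (real (Suc (Suc n)) + 1)\<^sup>2" by (simp add: power2_eq_square algebra_simps)
  finally show ?case .
qed auto

text \<open>The factor \<open>sin t\<close> saves one power of \<open>n\<close> compared with the size \<open>n\<^sup>4\<close> of \<open>T\<^sub>n''\<close> at the endpoints.
  This is what lets the second integration by parts end with \<open>n\<^sup>3\<close>.\<close>

lemma abs_sin_pderiv2_cheb: "\<bar>sin t * poly (pderiv (pderiv (cheb n))) (cos t)\<bar> \<le> real n ^ 3"
proof (cases n)
  case (Suc k)
  have "\<bar>sin t * poly (pderiv (pderiv (cheb n))) (cos t)\<bar> = real n * \<bar>sin t * poly (pderiv (cheb_U k)) (cos t)\<bar>"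
    by (simp add: Suc pderiv_cheb_Suc pderiv_smult abs_mult del: cheb.simps)
  also have "\<dots> \<le> real n * (real k + 1)\<^sup>2" by (intro mult_left_mono abs_sin_pderiv_cheb_U) auto
  finally show ?thesis by (simp add: Suc power2_eq_square power3_eq_cube algebra_simps)
qed simp

lemma degree_leading_coeff_cheb: "degree (cheb n) \<le> n \<and> coeff (cheb n) n > 0"
proof (induction n rule: cheb.induct)
  case (3 n)
  have "degree ([:0, 2:] * cheb (Suc n)) \<le> Suc (Suc n)"
    using degree_mult_le[of "[:0, 2:]" "cheb (Suc n)"] 3 by simp
  moreover have "degree (cheb n) \<le> Suc (Suc n)" using 3 by simp
  ultimately have "degree (cheb (Suc (Suc n))) \<le> Suc (Suc n)" by (simp add: degree_diff_le)
  moreover have "coeff (cheb n) (Suc (Suc n)) = 0" using 3 by (intro coeff_eq_0) simp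
  ultimately show ?case using 3 by simp
qed auto

lemma degree_cheb_le: "degree (cheb n) \<le> n"
  using degree_leading_coeff_cheb by blast

lemma cheb_span:
  "degree q \<le> M \<Longrightarrow> \<exists>b. q = (\<Sum>n\<le>M. smult (b n) (cheb n))"
proof (induction M arbitrary: q)
  case 0
  then obtain c where "q = [:c:]" by (metis degree_eq_zeroE le_0_eq)
  then show ?case by (intro exI[of _ "\<lambda>_. c"]) simp
next
  case (Suc M)
  define c where "c = coeff q (Suc M) / coeff (cheb (Suc M)) (Suc M)"
  define q' where "q' = q - smult c (cheb (Suc M))"
  have "coeff q' k = 0" if "k > M" for k
  proof (cases "k = Suc M")
    case True
    then show ?thesis using degree_leading_coeff_cheb[of "Suc M"] by (simp add: q'_def c_def)
  next
    case False
    then have "k > Suc M" using that by simp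
    then have "coeff q k = 0" "coeff (cheb (Suc M)) k = 0"
      using Suc.prems degree_cheb_le[of "Suc M"] by (auto intro!: coeff_eq_0)
    then show ?thesis by (simp add: q'_def)
  qed
  then have "degree q' \<le> M" by (intro degree_le) auto
  then obtain b where b: "q' = (\<Sum>n\<le>M. smult (b n) (cheb n))" using Suc.IH by blast
  have "q = (\<Sum>n\<le>Suc M. smult ((b(Suc M := c)) n) (cheb n))"
    using b by (simp add: q'_def algebra_simps)
  then show ?case by blast
qed

section \<open>Orthogonality of the derivatives and the weighted norm\<close>

text \<open>The quadratic polynomial \<open>\<integral> (f - t g)\<^sup>2\<close> in \<open>t\<close> is nonnegative.\<close>

lemma integral_Cauchy_Schwarz:
  fixes f g :: "real \<Rightarrow> real"
  assumes "((\<lambda>x. (f x)\<^sup>2) has_integral A) S" "((\<lambda>x. f x * g x) has_integral B) S"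
    "((\<lambda>x. (g x)\<^sup>2) has_integral C) S"
  shows "B \<le> sqrt A * sqrt C"
proof -
  have quad: "0 \<le> A - 2 * t * B + t\<^sup>2 * C" for t
  proof -
    have "((\<lambda>x. (f x)\<^sup>2 - (2 * t) * (f x * g x) + t\<^sup>2 * (g x)\<^sup>2) has_integral (A - 2 * t * B + t\<^sup>2 * C)) S"
      by (intro has_integral_add has_integral_diff has_integral_mult_right assms)
    moreover have "(f x)\<^sup>2 - (2 * t) * (f x * g x) + t\<^sup>2 * (g x)\<^sup>2 = (f x - t * g x)\<^sup>2" for x
      by (simp add: power2_eq_square algebra_simps)
    ultimately have "((\<lambda>x. (f x - t * g x)\<^sup>2) has_integral (A - 2 * t * B + t\<^sup>2 * C)) S" by simp
    then show ?thesis by (rule has_integral_nonneg) simp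
  qed
  have "0 \<le> A" using quad[of 0] by simp
  have "0 \<le> C" using assms(3) by (rule has_integral_nonneg) simp
  have "B\<^sup>2 \<le> A * C"
  proof (cases "C = 0")
    case True
    have "B = 0"
    proof (rule ccontr)
      assume "B \<noteq> 0"
      then show False using quad[of "(A + 1) / (2 * B)"] True by simp
    qed
    then show ?thesis using True by simp
  next
    case False
    then have "C > 0" using \<open>0 \<le> C\<close> by simp
    have "0 \<le> C * (A - 2 * (B / C) * B + (B / C)\<^sup>2 * C)" using quad[of "B / C"] \<open>C > 0\<close> by simp
    also have "\<dots> = A * C - B\<^sup>2" using \<open>C > 0\<close> by (simp add: field_simps power2_eq_square)
    finally show ?thesis by simp
  qed
  then have "\<bar>B\<bar> \<le> sqrt (A * C)" by (simp add: real_le_rsqrt)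
  then show ?thesis by (simp add: real_sqrt_mult)
qed

lemma has_integral_norm_sq_orthogonal_sum:
  fixes \<phi> :: "'i \<Rightarrow> real \<Rightarrow> real" and a :: "'i \<Rightarrow> complex"
  assumes "finite I"
    and orth: "\<And>i j. i \<in> I \<Longrightarrow> j \<in> I \<Longrightarrow> ((\<lambda>t. \<phi> i t * \<phi> j t * w t) has_integral (if i = j then g i else 0)) S"
  shows "((\<lambda>t. (norm (\<Sum>i\<in>I. a i * of_real (\<phi> i t)))\<^sup>2 * w t) has_integral (\<Sum>i\<in>I. g i * (norm (a i))\<^sup>2)) S"
proof -
  have real_case: "((\<lambda>t. (\<Sum>i\<in>I. c i * \<phi> i t)\<^sup>2 * w t) has_integral (\<Sum>i\<in>I. g i * (c i)\<^sup>2)) S" for c :: "'i \<Rightarrow> real"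
  proof -
    have "((\<lambda>t. \<Sum>i\<in>I. \<Sum>j\<in>I. (c i * c j) * (\<phi> i t * \<phi> j t * w t)) has_integral
        (\<Sum>i\<in>I. \<Sum>j\<in>I. (c i * c j) * (if i = j then g i else 0))) S"
      by (intro has_integral_sum assms has_integral_mult_right)
    moreover have "(\<Sum>i\<in>I. \<Sum>j\<in>I. (c i * c j) * (\<phi> i t * \<phi> j t * w t)) = (\<Sum>i\<in>I. c i * \<phi> i t)\<^sup>2 * w t" for t
      by (simp add: power2_eq_square sum_product sum_distrib_right sum_distrib_left mult_ac)
    moreover have "(\<Sum>i\<in>I. \<Sum>j\<in>I. (c i * c j) * (if i = j then g i else 0)) = (\<Sum>i\<in>I. g i * (c i)\<^sup>2)"
      using \<open>finite I\<close> by (intro sum.cong) (simp_all add: if_distrib[of "\<lambda>x. _ * x"] sum.delta' power2_eq_square mult_ac cong: if_cong)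
    ultimately show ?thesis by simp
  qed
  have "((\<lambda>t. (\<Sum>i\<in>I. Re (a i) * \<phi> i t)\<^sup>2 * w t + (\<Sum>i\<in>I. Im (a i) * \<phi> i t)\<^sup>2 * w t) has_integral
     ((\<Sum>i\<in>I. g i * (Re (a i))\<^sup>2) + (\<Sum>i\<in>I. g i * (Im (a i))\<^sup>2))) S"
    by (intro has_integral_add real_case)
  then show ?thesis
    by (simp add: cmod_power2 distrib_left distrib_right sum.distrib)
qed

lemma has_integral_cos_multiple:
  "((\<lambda>t. cos (of_int m * t)) has_integral (if m = 0 then pi else 0)) {0..pi}"
proof (cases "m = 0")
  case True
  then show ?thesis using has_integral_const_real[of "1::real" 0 pi] by simp
next
  case False
  have "((\<lambda>t. cos (of_int m * t)) has_integral (sin (of_int m * pi) / of_int m - sin (of_int m * 0) / of_int m)) {0..pi}"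
    by (rule fundamental_theorem_of_calculus)
      (use False in \<open>auto intro!: derivative_eq_intros simp flip: has_real_derivative_iff_has_vector_derivative\<close>)
  then show ?thesis using False sin_integer_2pi by (simp add: mult.commute[of _ pi])
qed

lemma cos_orthogonal:
  "((\<lambda>t. cos (real n * t) * cos (real j * t)) has_integral
     (if n = j then if n = 0 then pi else pi / 2 else 0)) {0..pi}"
proof -
  have "((\<lambda>t. (cos (of_int (int n - int j) * t) + cos (of_int (int n + int j) * t)) / 2) has_integral
     ((if int n - int j = 0 then pi else 0) + (if int n + int j = 0 then pi else 0)) / 2) {0..pi}"
    by (intro has_integral_divide has_integral_add has_integral_cos_multiple)
  moreover have "(cos (of_int (int n - int j) * t) + cos (of_int (int n + int j) * t)) / 2 = cos (real n * t) * cos (real j * t)" for t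
    by (simp add: cos_times_cos left_diff_distrib distrib_right)
  ultimately have "((\<lambda>t. cos (real n * t) * cos (real j * t)) has_integral
     ((if int n - int j = 0 then pi else 0) + (if int n + int j = 0 then pi else 0)) / 2) {0..pi}"
    by (simp only:)
  then show ?thesis by (rule has_integral_eq_rhs) auto
qed

lemma sin_orthogonal:
  "((\<lambda>t. sin (real n * t) * sin (real j * t)) has_integral
     (if n = j then if n = 0 then 0 else pi / 2 else 0)) {0..pi}"
proof -
  have "((\<lambda>t. (cos (of_int (int n - int j) * t) - cos (of_int (int n + int j) * t)) / 2) has_integral
     ((if int n - int j = 0 then pi else 0) - (if int n + int j = 0 then pi else 0)) / 2) {0..pi}"
    by (intro has_integral_divide has_integral_diff has_integral_cos_multiple)
  moreover have "(cos (of_int (int n - int j) * t) - cos (of_int (int n + int j) * t)) / 2 = sin (real n * t) * sin (real j * t)" for t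
    by (simp add: sin_times_sin left_diff_distrib distrib_right)
  ultimately have "((\<lambda>t. sin (real n * t) * sin (real j * t)) has_integral
     ((if int n - int j = 0 then pi else 0) - (if int n + int j = 0 then pi else 0)) / 2) {0..pi}"
    by (simp only:)
  then show ?thesis by (rule has_integral_eq_rhs) auto
qed

text \<open>The squared norm of \<open>T\<^sub>n\<^sup>(\<^sup>k\<^sup>)\<close>, a multiple of a Gegenbauer polynomial, for the weight \<open>rho k\<close>.\<close>

definition gegen_norm_sq :: "nat \<Rightarrow> nat \<Rightarrow> real" where
  "gegen_norm_sq k n = (\<Prod>i<k. (real n)\<^sup>2 - (real i)\<^sup>2) * (if n = 0 then pi else pi / 2)"

text \<open>By induction on \<open>k\<close>.  The differential equation says that \<open>(n\<^sup>2 - k\<^sup>2) sin\<^sup>2\<^sup>k t T\<^sub>n\<^sup>(\<^sup>k\<^sup>) (cos t)\<close> is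
  the derivative in \<open>t\<close> of \<open>sin\<^sup>2\<^sup>k\<^sup>+\<^sup>1 t T\<^sub>n\<^sup>(\<^sup>k\<^sup>+\<^sup>1\<^sup>) (cos t)\<close>, so one integration by parts multiplies the
  inner product by \<open>n\<^sup>2 - k\<^sup>2\<close>.  The boundary terms carry a power of \<open>sin t\<close> and vanish.\<close>

lemma cheb_derivatives_orthogonal:
  "((\<lambda>t. poly ((pderiv ^^ k) (cheb n)) (cos t) * poly ((pderiv ^^ k) (cheb j)) (cos t) * sin t ^ (2 * k))
     has_integral (if n = j then gegen_norm_sq k n else 0)) {0..pi}"
proof (induction k)
  case 0
  have "(if n = j then gegen_norm_sq 0 n else 0) = (if n = j then if n = 0 then pi else pi / 2 else 0)"
    by (simp add: gegen_norm_sq_def)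
  then show ?case using cos_orthogonal[of n j]
    by (simp only: poly_cheb_cos funpow.simps id_apply mult_0_right power_0 mult_1_right)
next
  case (Suc k)
  define P where "P i t = poly ((pderiv ^^ i) (cheb n)) (cos t)" for i t
  define Q where "Q i t = poly ((pderiv ^^ i) (cheb j)) (cos t)" for i t
  define c where "c = (real n)\<^sup>2 - (real k)\<^sup>2"
  define F where "F t = sin t ^ (2 * k + 1) * (P (Suc k) t * Q k t)" for t
  define F' where "F' t = c * (P k t * Q k t * sin t ^ (2 * k)) - P (Suc k) t * Q (Suc k) t * sin t ^ (2 * Suc k)" for t
  have ode: "(sin t)\<^sup>2 * P (Suc (Suc k)) t = (2 * real k + 1) * (cos t * P (Suc k) t) - c * P k t" for t
  proof -
    have "(1 - (cos t)\<^sup>2) * P (Suc (Suc k)) t - (2 * real k + 1) * (cos t * P (Suc k) t) + c * P k t = 0"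
      using arg_cong[OF cheb_ODE_higher[of k n], of "\<lambda>p. poly p (cos t)"]
      by (simp add: P_def c_def power2_eq_square algebra_simps del: funpow.simps)
    then show ?thesis unfolding sin_squared_eq by simp
  qed
  have dP: "(P i has_real_derivative (- sin t * P (Suc i) t)) (at t within S)" for i t S
    using poly_cos_DERIV[of "(pderiv ^^ i) (cheb n)"] by (simp add: P_def[abs_def])
  have dQ: "(Q i has_real_derivative (- sin t * Q (Suc i) t)) (at t within S)" for i t S
    using poly_cos_DERIV[of "(pderiv ^^ i) (cheb j)"] by (simp add: Q_def[abs_def])
  have "(F has_real_derivative F' t) (at t within S)" for t S
  proof -
    have "(F has_real_derivative (real (2 * k + 1) * sin t ^ (2 * k) * cos t * (P (Suc k) t * Q k t)
        + (- sin t * P (Suc (Suc k)) t * Q k t + - sin t * Q (Suc k) t * P (Suc k) t) * sin t ^ (2 * k + 1))) (at t within S)"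
      unfolding F_def
    proof (rule DERIV_mult[OF _ DERIV_mult[OF dP dQ]])
      show "((\<lambda>t. sin t ^ (2 * k + 1)) has_real_derivative (real (2 * k + 1) * sin t ^ (2 * k) * cos t)) (at t within S)"
        using DERIV_power_Suc[OF has_field_derivative_at_within[OF DERIV_sin], of "2 * k" t S]
        by (simp add: algebra_simps)
    qed
    moreover have "(real (2 * k + 1) * sin t ^ (2 * k) * cos t * (P (Suc k) t * Q k t)
        + (- sin t * P (Suc (Suc k)) t * Q k t + - sin t * Q (Suc k) t * P (Suc k) t) * sin t ^ (2 * k + 1)) = F' t"
    proof -
      have "(real (2 * k + 1) * sin t ^ (2 * k) * cos t * (P (Suc k) t * Q k t)
        + (- sin t * P (Suc (Suc k)) t * Q k t + - sin t * Q (Suc k) t * P (Suc k) t) * sin t ^ (2 * k + 1))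
        = sin t ^ (2 * k) * Q k t * ((2 * real k + 1) * (cos t * P (Suc k) t) - (sin t)\<^sup>2 * P (Suc (Suc k)) t)
          - P (Suc k) t * Q (Suc k) t * sin t ^ (2 * Suc k)"
        by (simp add: algebra_simps power2_eq_square)
      also have "\<dots> = F' t" unfolding ode F'_def by (simp add: algebra_simps)
      finally show ?thesis .
    qed
    ultimately show ?thesis by simp
  qed
  then have "(F' has_integral (F pi - F 0)) {0..pi}"
    by (intro fundamental_theorem_of_calculus) (auto simp flip: has_real_derivative_iff_has_vector_derivative)
  then have F0: "(F' has_integral 0) {0..pi}" by (simp add: F_def)
  have "((\<lambda>t. c * (P k t * Q k t * sin t ^ (2 * k)) - F' t) has_integral
      (c * (if n = j then gegen_norm_sq k n else 0) - 0)) {0..pi}"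
    using Suc.IH unfolding P_def[symmetric] Q_def[symmetric]
    by (intro has_integral_diff has_integral_mult_right F0)
  then show ?case
    unfolding P_def[symmetric] Q_def[symmetric]
    by (rule has_integral_eq_rhs[OF has_integral_eq[rotated]])
      (auto simp: F'_def gegen_norm_sq_def c_def)
qed

text \<open>The \<open>k\<close>-th derivative of the Chebyshev expansion with coefficients \<open>a\<close>, in the variable \<open>s = x + 1\<close>.\<close>

definition cheb_sum :: "(nat \<Rightarrow> complex) \<Rightarrow> nat \<Rightarrow> nat \<Rightarrow> real \<Rightarrow> complex" where
  "cheb_sum a M k s = (\<Sum>n\<le>M. a n * of_real (poly ((pderiv ^^ k) (cheb n)) (s - 1)))"

abbreviation (input) cheb_energy :: "(nat \<Rightarrow> complex) \<Rightarrow> nat \<Rightarrow> nat \<Rightarrow> real" where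
  "cheb_energy a M m \<equiv> integral {0..2} (\<lambda>s. (norm (cheb_sum a M m s))\<^sup>2 * rho m s)"

lemma continuous_on_cheb_sum [continuous_intros]: "continuous_on S (cheb_sum a M k)"
  unfolding cheb_sum_def by (intro continuous_intros)

lemma has_integral_cos_substitution:
  fixes f :: "real \<Rightarrow> 'a::euclidean_space"
  assumes "continuous_on {0..2} f"
  shows "((\<lambda>t. sin t *\<^sub>R f (1 + cos t)) has_integral (integral {0..2} f)) {0..pi}"
proof -
  have cos_nonneg: "0 \<le> 1 + cos x" for x :: real using cos_ge_minus_one[of x] by linarith
  have "((\<lambda>t. (- sin t) *\<^sub>R f (1 + cos t)) has_integral (integral {1 + cos 0..1 + cos pi} f - integral {1 + cos pi..1 + cos 0} f)) {0..pi}"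
    by (rule has_integral_substitution_general[where s = "{}" and c = 0 and d = 2])
      (use assms cos_nonneg in \<open>auto intro!: derivative_eq_intros continuous_intros\<close>)
  then have "((\<lambda>t. - (sin t *\<^sub>R f (1 + cos t))) has_integral (- integral {0..2} f)) {0..pi}" by simp
  from has_integral_neg[OF this] show ?thesis by simp
qed

lemma rho_continuous: "m \<ge> 1 \<Longrightarrow> continuous_on {0..2} (rho m)"
  unfolding rho_def by (intro continuous_on_powr' continuous_intros) auto

lemma rho_cos:
  assumes "m \<ge> 1" "t \<in> {0..pi}"
  shows "sin t * rho m (1 + cos t) = sin t ^ (2 * m)"
proof (cases "sin t = 0")
  case False
  then have s: "sin t > 0" using assms(2) sin_ge_zero[of t] by auto
  have "(1 + cos t) * (2 - (1 + cos t)) = (sin t)\<^sup>2"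
    unfolding sin_squared_eq by (simp add: power2_eq_square algebra_simps)
  then have "rho m (1 + cos t) = (sin t powr 2) powr (real m - 1/2)"
    using s by (simp add: rho_def)
  also have "\<dots> = sin t powr (2 * real m - 1)" by (simp add: powr_powr algebra_simps)
  finally have "sin t * rho m (1 + cos t) = sin t powr 1 * sin t powr (2 * real m - 1)" using s by simp
  also have "\<dots> = sin t powr (1 + (2 * real m - 1))" by (simp only: powr_add)
  also have "1 + (2 * real m - 1) = real (2 * m)" by simp
  finally show ?thesis using powr_realpow[OF s, of "2 * m"] by simp
qed (use assms in simp)

lemma rho_norm_cheb_sum:
  assumes "m \<ge> 1"
  shows "((\<lambda>s. (norm (cheb_sum a M m s))\<^sup>2 * rho m s) has_integral
    (\<Sum>n\<le>M. gegen_norm_sq m n * (norm (a n))\<^sup>2)) {0..2}"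
proof -
  let ?f = "\<lambda>s. (norm (cheb_sum a M m s))\<^sup>2 * rho m s"
  have cont: "continuous_on {0..2} ?f"
    by (intro continuous_intros rho_continuous assms)
  have "((\<lambda>t. (norm (\<Sum>n\<le>M. a n * of_real (poly ((pderiv ^^ m) (cheb n)) (cos t))))\<^sup>2 * sin t ^ (2 * m)) has_integral
    (\<Sum>n\<le>M. gegen_norm_sq m n * (norm (a n))\<^sup>2)) {0..pi}"
    by (rule has_integral_norm_sq_orthogonal_sum) (use cheb_derivatives_orthogonal in auto)
  moreover have "((\<lambda>t. (norm (\<Sum>n\<le>M. a n * of_real (poly ((pderiv ^^ m) (cheb n)) (cos t))))\<^sup>2 * sin t ^ (2 * m)) has_integral
    integral {0..2} ?f) {0..pi}"
  proof (rule has_integral_eq[OF _ has_integral_cos_substitution[OF cont]])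
    fix t assume t: "t \<in> {0..pi}"
    have "sin t *\<^sub>R ?f (1 + cos t) = (norm (cheb_sum a M m (1 + cos t)))\<^sup>2 * (sin t * rho m (1 + cos t))"
      by (simp add: mult_ac)
    then show "sin t *\<^sub>R ?f (1 + cos t) = (norm (\<Sum>n\<le>M. a n * of_real (poly ((pderiv ^^ m) (cheb n)) (cos t))))\<^sup>2 * sin t ^ (2 * m)"
      unfolding rho_cos[OF assms t] by (simp add: cheb_sum_def)
  qed
  ultimately have "integral {0..2} ?f = (\<Sum>n\<le>M. gegen_norm_sq m n * (norm (a n))\<^sup>2)"
    by (rule has_integral_unique[rotated])
  then show ?thesis using integrable_continuous_real[OF cont] by (metis integrable_integral)
qed

text \<open>Each factor satisfies \<open>n\<^sup>2 - i\<^sup>2 \<ge> n\<^sup>2 / m\<^sup>2\<close> because \<open>i < m \<le> n\<close>.\<close>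

lemma gegen_norm_sq_lower:
  assumes "m \<ge> 1" "n \<ge> m"
  shows "real n ^ (2 * m) \<le> real m ^ (2 * m) * gegen_norm_sq m n"
proof -
  have "(real n)\<^sup>2 \<le> (real m)\<^sup>2 * ((real n)\<^sup>2 - (real i)\<^sup>2)" if "i < m" for i
  proof -
    have "(real i)\<^sup>2 * (real m)\<^sup>2 \<le> (real i)\<^sup>2 * (real n)\<^sup>2" using assms by (intro mult_left_mono power_mono) auto
    moreover have "((real i)\<^sup>2 + 1) * (real n)\<^sup>2 \<le> (real m)\<^sup>2 * (real n)\<^sup>2"
    proof (rule mult_right_mono)
      have "(real i)\<^sup>2 + 1 \<le> (real i + 1)\<^sup>2" by (simp add: power2_eq_square algebra_simps)
      also have "\<dots> \<le> (real m)\<^sup>2" using that by (intro power_mono) auto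
      finally show "(real i)\<^sup>2 + 1 \<le> (real m)\<^sup>2" .
    qed simp
    ultimately show ?thesis by (simp add: algebra_simps)
  qed
  then have "(\<Prod>i<m. (real n)\<^sup>2) \<le> (\<Prod>i<m. (real m)\<^sup>2 * ((real n)\<^sup>2 - (real i)\<^sup>2))"
    by (intro prod_mono) auto
  then have le: "real n ^ (2 * m) \<le> real m ^ (2 * m) * (\<Prod>i<m. (real n)\<^sup>2 - (real i)\<^sup>2)"
    by (simp add: prod.distrib power_mult)
  define A where "A = real m ^ (2 * m) * (\<Prod>i<m. (real n)\<^sup>2 - (real i)\<^sup>2)"
  have "0 \<le> A" using le by (simp add: A_def order_trans[OF _ le])
  then have "A \<le> A * (pi / 2)" using mult_left_mono[OF pi_ge_two, of A] by simp
  moreover have "real m ^ (2 * m) * gegen_norm_sq m n = A * (pi / 2)"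
    using assms by (simp add: gegen_norm_sq_def A_def)
  ultimately show ?thesis using le[folded A_def] by linarith
qed

lemma gegen_norm_sq_nonneg: "gegen_norm_sq m n \<ge> 0"
proof (cases "n < m")
  case True
  then have "(\<Prod>i<m. (real n)\<^sup>2 - (real i)\<^sup>2) = 0" by (intro prod_zero) (auto intro: bexI[of _ n])
  then show ?thesis unfolding gegen_norm_sq_def by (simp only: mult_zero_left order_refl)
next
  case False
  then show ?thesis unfolding gegen_norm_sq_def
    by (intro mult_nonneg_nonneg prod_nonneg) (auto intro!: power_mono)
qed

lemma weighted_coefficients_le:
  assumes "m \<ge> 1"
  shows "(\<Sum>n\<in>{m..M}. real n ^ (2 * m) * (norm (a n))\<^sup>2)
    \<le> real m ^ (2 * m) * cheb_energy a M m"
proof -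
  have "(\<Sum>n\<in>{m..M}. real n ^ (2 * m) * (norm (a n))\<^sup>2)
    \<le> (\<Sum>n\<in>{m..M}. real m ^ (2 * m) * gegen_norm_sq m n * (norm (a n))\<^sup>2)"
    using assms by (intro sum_mono mult_right_mono gegen_norm_sq_lower) auto
  also have "\<dots> \<le> (\<Sum>n\<le>M. real m ^ (2 * m) * gegen_norm_sq m n * (norm (a n))\<^sup>2)"
    by (intro sum_mono2) (auto intro!: mult_nonneg_nonneg gegen_norm_sq_nonneg)
  also have "\<dots> = real m ^ (2 * m) * cheb_energy a M m"
    using rho_norm_cheb_sum[OF assms, of a M] by (simp add: integral_unique sum_distrib_left mult_ac)
  finally show ?thesis .
qed

section \<open>Interpolation at the Clenshaw-Curtis nodes and aliasing\<close>

abbreviation (input) quad_error :: "nat \<Rightarrow> complex \<Rightarrow> (real \<Rightarrow> complex) \<Rightarrow> complex" where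
  "quad_error L z f \<equiv> fcc_rule L z f - osc_integral z f"

lemma inj_on_cc_node: "L \<ge> 1 \<Longrightarrow> inj_on (cc_node L) {0..L}"
proof (rule inj_onI)
  fix i j assume L: "L \<ge> 1" and ij: "i \<in> {0..L}" "j \<in> {0..L}" "cc_node L i = cc_node L j"
  have "real i * pi / real L = real j * pi / real L"
    by (rule cos_inj_pi) (use L ij in \<open>auto simp: cc_node_def field_simps\<close>)
  then show "i = j" using L by (simp add: field_simps)
qed

lemma cc_interp_unique:
  assumes "L \<ge> 1" "degree p \<le> L" "degree q \<le> L"
    and "\<And>l. l \<in> {0..L} \<Longrightarrow> poly p (of_real (cc_node L l)) = poly q (of_real (cc_node L l))"
  shows "p = (q :: complex poly)"
proof (rule poly_eqI_degree)
  let ?A = "(\<lambda>l. complex_of_real (cc_node L l)) ` {0..L}"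
  have "inj_on (\<lambda>l. complex_of_real (cc_node L l)) {0..L}"
    using inj_on_cc_node[OF assms(1)] by (auto simp: inj_on_def)
  then have "card ?A = Suc L" by (simp add: card_image)
  then show "card ?A > degree p" "card ?A > degree q" using assms by auto
  show "poly p x = poly q x" if "x \<in> ?A" for x using assms(4) that by auto
qed

lemma cc_interp_eqI:
  assumes "L \<ge> 1" "degree p \<le> L"
    and "\<And>l. l \<in> {0..L} \<Longrightarrow> poly p (of_real (cc_node L l)) = f (cc_node L l)"
  shows "cc_interp L f = p"
  unfolding cc_interp_def
  by (rule the_equality) (use assms in \<open>auto intro: cc_interp_unique\<close>)

definition lagrange_basis :: "nat \<Rightarrow> nat \<Rightarrow> complex poly" where
  "lagrange_basis L l = (\<Prod>j\<in>{0..L} - {l}.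
     smult (inverse (of_real (cc_node L l) - of_real (cc_node L j))) [:- of_real (cc_node L j), 1:])"

lemma lagrange_interpolates:
  fixes f :: "real \<Rightarrow> complex"
  assumes L1: "L \<ge> 1"
  defines "p \<equiv> (\<Sum>l\<in>{0..L}. smult (f (cc_node L l)) (lagrange_basis L l))"
  shows "degree p \<le> L" and "\<And>k. k \<in> {0..L} \<Longrightarrow> poly p (of_real (cc_node L k)) = f (cc_node L k)"
  unfolding p_def
proof -
  have ne: "complex_of_real (cc_node L i) - of_real (cc_node L j) \<noteq> 0"
    if "i \<in> {0..L}" "j \<in> {0..L}" "i \<noteq> j" for i j
    using inj_on_cc_node[OF L1] that by (auto simp: inj_on_def)
  have "degree (lagrange_basis L l) \<le> L" if "l \<in> {0..L}" for l
  proof -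
    have "degree (lagrange_basis L l) \<le> (\<Sum>j\<in>{0..L} - {l}. 1)"
      unfolding lagrange_basis_def
      by (rule order_trans[OF degree_prod_sum_le sum_mono]) auto
    then show ?thesis using that by simp
  qed
  then show "degree (\<Sum>l\<in>{0..L}. smult (f (cc_node L l)) (lagrange_basis L l)) \<le> L"
    by (intro degree_sum_le) (auto intro: order_trans[OF degree_smult_le])
  fix k assume k: "k \<in> {0..L}"
  have "poly (lagrange_basis L l) (of_real (cc_node L k)) = (if l = k then 1 else 0)" if l: "l \<in> {0..L}" for l
  proof (cases "l = k")
    case True
    have "poly (smult (inverse (of_real (cc_node L k) - of_real (cc_node L j))) [:- of_real (cc_node L j), 1:])
        (complex_of_real (cc_node L k)) = 1" if "j \<in> {0..L} - {k}" for j
    proof -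
      have "poly [:- of_real (cc_node L j), 1:] (complex_of_real (cc_node L k))
        = of_real (cc_node L k) - of_real (cc_node L j)" by simp
      then show ?thesis using ne[OF k, of j] that by (simp only: poly_smult) simp
    qed
    then show ?thesis unfolding True lagrange_basis_def poly_prod
      by (subst if_P[OF refl], intro prod.neutral) blast
  next
    case False
    then have "poly (lagrange_basis L l) (of_real (cc_node L k)) = 0"
      unfolding lagrange_basis_def poly_prod using k by (intro prod_zero) (auto intro!: bexI[of _ k])
    then show ?thesis using False by simp
  qed
  then have "poly (\<Sum>l\<in>{0..L}. smult (f (cc_node L l)) (lagrange_basis L l)) (of_real (cc_node L k))
    = (\<Sum>l\<in>{0..L}. f (cc_node L l) * (if l = k then 1 else 0))"
    by (simp add: poly_sum)
  also have "\<dots> = f (cc_node L k)" using k by (simp add: if_distrib[of "\<lambda>x. _ * x"] cong: if_cong)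
  finally show "poly (\<Sum>l\<in>{0..L}. smult (f (cc_node L l)) (lagrange_basis L l)) (of_real (cc_node L k)) = f (cc_node L k)" .
qed

lemma cc_interp_lagrange:
  assumes "L \<ge> 1"
  shows "cc_interp L f = (\<Sum>l\<in>{0..L}. smult (f (cc_node L l)) (lagrange_basis L l))"
  by (rule cc_interp_eqI[OF assms lagrange_interpolates[OF assms]])

lemma poly_cc_interp_node:
  "L \<ge> 1 \<Longrightarrow> l \<in> {0..L} \<Longrightarrow> poly (cc_interp L f) (of_real (cc_node L l)) = f (cc_node L l)"
  unfolding cc_interp_lagrange by (rule lagrange_interpolates)

lemma cc_node_range: "cc_node L l \<in> {0..2}"
  unfolding cc_node_def atLeastAtMost_iff
  using cos_ge_minus_one[of "real l * pi / real L"] cos_le_one[of "real l * pi / real L"] by linarith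

text \<open>The norm of the error functional on continuous functions is at most this.  It grows with \<open>L\<close> and
  \<open>|z|\<close>, but it only serves to pass to a limit for fixed \<open>L\<close> and \<open>z\<close>.\<close>

definition error_lipschitz :: "nat \<Rightarrow> complex \<Rightarrow> real" where
  "error_lipschitz L z = (\<Sum>l\<in>{0..L}. norm (osc_integral z (\<lambda>s. poly (lagrange_basis L l) (of_real s)))) + exp (2 * norm z) * 2"

lemma cc_quadrature_error_lipschitz:
  assumes "L \<ge> 1" and f: "continuous_on {0..2} f" and g: "continuous_on {0..2} g"
    and fg: "\<And>s. s \<in> {0..2} \<Longrightarrow> norm (f s - g s) \<le> e"
  shows "norm ((quad_error L z f) - (quad_error L z g)) \<le> error_lipschitz L z * e"
proof -
  define w where "w l = osc_integral z (\<lambda>s. poly (lagrange_basis L l) (of_real s))" for l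
  have rule: "fcc_rule L z f = (\<Sum>l\<in>{0..L}. f (cc_node L l) * w l)" for f
  proof -
    have "fcc_rule L z f = integral {0..2} (\<lambda>s. \<Sum>l\<in>{0..L}. f (cc_node L l) * (poly (lagrange_basis L l) (of_real s) * exp (of_real s * z)))"
      unfolding fcc_rule_def osc_integral_def cc_interp_lagrange[OF assms(1)]
      by (simp add: poly_sum sum_distrib_right sum_distrib_left mult_ac)
    also have "\<dots> = (\<Sum>l\<in>{0..L}. integral {0..2} (\<lambda>s. f (cc_node L l) * (poly (lagrange_basis L l) (of_real s) * exp (of_real s * z))))"
      by (intro integral_sum) (auto intro!: integrable_continuous_real continuous_intros)
    also have "\<dots> = (\<Sum>l\<in>{0..L}. f (cc_node L l) * w l)"
      by (simp add: w_def osc_integral_def)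
    finally show ?thesis .
  qed
  have "e \<ge> 0" using order_trans[OF norm_ge_zero fg[of 0]] by simp
  have 1: "norm (fcc_rule L z f - fcc_rule L z g) \<le> (\<Sum>l\<in>{0..L}. norm (w l)) * e"
  proof -
    have "fcc_rule L z f - fcc_rule L z g = (\<Sum>l\<in>{0..L}. (f (cc_node L l) - g (cc_node L l)) * w l)"
      by (simp add: rule sum_subtractf algebra_simps)
    also have "norm \<dots> \<le> (\<Sum>l\<in>{0..L}. e * norm (w l))"
      by (intro sum_norm_le) (auto simp: norm_mult intro!: mult_right_mono fg cc_node_range)
    finally show ?thesis by (simp add: sum_distrib_left mult.commute)
  qed
  have 2: "norm (osc_integral z f - osc_integral z g) \<le> exp (2 * norm z) * 2 * e"
  proof -
    have fi: "(\<lambda>s. f s * exp (of_real s * z)) integrable_on {0..2}" "(\<lambda>s. g s * exp (of_real s * z)) integrable_on {0..2}"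
      by (auto intro!: integrable_continuous_real continuous_intros f g)
    have "osc_integral z f - osc_integral z g = integral {0..2} (\<lambda>s. f s * exp (of_real s * z) - g s * exp (of_real s * z))"
      unfolding osc_integral_def using fi by (simp add: integral_diff)
    also have "norm \<dots> \<le> (e * exp (2 * norm z)) * (2 - 0)"
    proof (rule integral_bound)
      show "continuous_on {0..2} (\<lambda>s. f s * exp (of_real s * z) - g s * exp (of_real s * z))"
        by (intro continuous_intros f g)
      fix s :: real assume s: "s \<in> {0..2}"
      have "f s * exp (of_real s * z) - g s * exp (of_real s * z) = (f s - g s) * exp (of_real s * z)"
        by (simp add: algebra_simps)
      moreover have "norm (exp (of_real s * z)) \<le> exp (2 * norm z)"
      proof -
        have "Re (of_real s * z) \<le> norm (of_real s * z)" by (rule complex_Re_le_cmod)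
        also have "\<dots> \<le> 2 * norm z" using s by (simp add: norm_mult mult_right_mono)
        finally show ?thesis by (simp add: norm_exp_eq_Re)
      qed
      ultimately show "norm (f s * exp (of_real s * z) - g s * exp (of_real s * z)) \<le> e * exp (2 * norm z)"
        using fg[OF s] \<open>e \<ge> 0\<close> by (simp add: norm_mult mult_mono)
    qed simp
    finally show ?thesis by (simp add: mult_ac)
  qed
  have "norm ((quad_error L z f) - (quad_error L z g))
    = norm ((fcc_rule L z f - fcc_rule L z g) - (osc_integral z f - osc_integral z g))" by (simp add: algebra_simps)
  also have "\<dots> \<le> norm (fcc_rule L z f - fcc_rule L z g) + norm (osc_integral z f - osc_integral z g)"
    by (rule norm_triangle_ineq4)
  also have "\<dots> \<le> error_lipschitz L z * e" using 1 2 by (simp add: error_lipschitz_def w_def algebra_simps)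
  finally show ?thesis .
qed

text \<open>The index \<open>n\<close> folded into \<open>{0..L}\<close> by reflection at the multiples of \<open>L\<close>.\<close>

definition cheb_alias :: "nat \<Rightarrow> nat \<Rightarrow> nat" where
  "cheb_alias L n = (if even (n div L) then n mod L else L - n mod L)"

lemma cheb_alias_le: "L \<ge> 1 \<Longrightarrow> cheb_alias L n \<le> L"
  by (auto simp: cheb_alias_def intro: less_imp_le)

lemma cheb_alias_low:
  assumes "L \<ge> 1" "n \<le> L"
  shows "cheb_alias L n = n"
proof (cases "n = L")
  case False
  then show ?thesis using assms by (simp add: cheb_alias_def)
qed (use assms in \<open>simp add: cheb_alias_def\<close>)

lemma cos_cheb_alias:
  assumes "L \<ge> 1"
  shows "cos (real (cheb_alias L n) * (real l * pi / real L)) = cos (real n * (real l * pi / real L))"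
proof -
  define q where "q = n div L"
  define r where "r = n mod L"
  have n: "real n = real q * real L + real r" unfolding q_def r_def
    by (metis div_mult_mod_eq of_nat_add of_nat_mult)
  have "r \<le> L" using assms by (simp add: r_def less_imp_le)
  have eq: "real n * (real l * pi / real L) = real q * real l * pi + real r * (real l * pi / real L)"
    unfolding n using assms by (simp add: field_simps)
  show ?thesis
  proof (cases "even q")
    case True
    then obtain p where "q = 2 * p" by blast
    then have "real q * real l * pi = 2 * pi * of_int (int (p * l))" by simp
    then have "cos (real n * (real l * pi / real L)) = cos (real r * (real l * pi / real L))"
      unfolding eq by (simp only: cos_add sin_int_2pin cos_int_2pin) simp?
    then show ?thesis using True by (simp add: cheb_alias_def q_def r_def)
  next
    case False
    then obtain p where "q = 2 * p + 1" using oddE by blast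
    then have "real q * real l * pi + real r * (real l * pi / real L)
      = 2 * pi * of_int (int ((p + 1) * l)) - real (L - r) * (real l * pi / real L)"
      using assms \<open>r \<le> L\<close> by (simp add: field_simps of_nat_diff)
    then have "cos (real n * (real l * pi / real L)) = cos (real (L - r) * (real l * pi / real L))"
      unfolding eq by (simp only: cos_diff sin_int_2pin cos_int_2pin) simp?
    then show ?thesis using False by (simp add: cheb_alias_def q_def r_def)
  qed
qed

text \<open>Within a block of length \<open>L\<close> the folding is either the identity or a reflection.\<close>

lemma inj_on_alias_class: "L \<ge> 1 \<Longrightarrow> inj_on (\<lambda>n. n div L) {n. cheb_alias L n = k}"
proof (rule inj_onI)
  fix n n' assume L: "L \<ge> 1" and n: "n \<in> {n. cheb_alias L n = k}" "n' \<in> {n. cheb_alias L n = k}" "n div L = n' div L"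
  have "n mod L < L" "n' mod L < L" using L by auto
  then have "n mod L = n' mod L" using n by (cases "even (n div L)") (auto simp: cheb_alias_def)
  then show "n = n'" using n(3) by (metis div_mult_mod_eq)
qed

text \<open>The sum telescopes through \<open>1 / n\<^sup>2 \<le> 1 / (n - 1) - 1 / n\<close>.\<close>

lemma sum_inverse_squares_tail:
  assumes "L \<ge> 1"
  shows "(\<Sum>n\<in>{L<..M}. 1 / (real n)\<^sup>2) \<le> 1 / real L"
proof -
  have "(\<Sum>n\<in>{L<..M}. 1 / (real n)\<^sup>2) \<le> 1 / real L - 1 / real M" if "L \<le> M"
    using that
  proof (induction M rule: dec_induct)
    case (step M)
    have "{L<..Suc M} = insert (Suc M) {L<..M}" using step by auto
    then have "(\<Sum>n\<in>{L<..Suc M}. 1 / (real n)\<^sup>2) = 1 / (real (Suc M))\<^sup>2 + (\<Sum>n\<in>{L<..M}. 1 / (real n)\<^sup>2)" by simp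
    also have "1 / (real (Suc M))\<^sup>2 \<le> 1 / real M - 1 / real (Suc M)"
    proof -
      have M: "real M > 0" using step assms by simp
      have "1 / (real (Suc M))\<^sup>2 \<le> 1 / (real M * real (Suc M))"
        using M by (intro divide_left_mono) (auto simp: power2_eq_square)
      also have "\<dots> = 1 / real M - 1 / real (Suc M)" using M by (simp add: field_simps)
      finally show ?thesis .
    qed
    finally show ?case using step.IH by simp
  qed simp
  moreover have "1 / real M \<ge> 0" "1 / real L \<ge> 0" by simp_all
  moreover have "(\<Sum>n\<in>{L<..M}. 1 / (real n)\<^sup>2) = 0" if "\<not> L \<le> M" using that by simp
  ultimately show ?thesis by linarith
qed

lemma sum_inverse_squares_alias_class:
  assumes "L \<ge> 1"
  shows "(\<Sum>n\<in>{n\<in>{L<..M}. cheb_alias L n = k}. 1 / (real n)\<^sup>2) \<le> 2 / (real L)\<^sup>2"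
proof -
  let ?S = "{n\<in>{L<..M}. cheb_alias L n = k}"
  have inj: "inj_on (\<lambda>n. n div L) ?S"
    by (rule inj_on_subset[OF inj_on_alias_class[OF assms, of k]]) auto
  have q: "1 \<le> n div L \<and> n div L \<le> M" if "n \<in> ?S" for n
    using that assms by (auto simp: Suc_le_eq div_greater_zero_iff intro: order_trans[OF div_le_dividend])
  have "(\<Sum>n\<in>?S. 1 / (real n)\<^sup>2) \<le> (\<Sum>n\<in>?S. 1 / (real L)\<^sup>2 * (1 / (real (n div L))\<^sup>2))"
  proof (rule sum_mono)
    fix n assume n: "n \<in> ?S"
    have "real (L * (n div L)) \<le> real n" by (intro of_nat_mono) simp
    then have "(real L * real (n div L))\<^sup>2 \<le> (real n)\<^sup>2" by (intro power_mono) auto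
    moreover have "real L * real (n div L) > 0" using q[OF n] assms by simp
    ultimately have "1 / (real n)\<^sup>2 \<le> 1 / (real L * real (n div L))\<^sup>2"
      by (intro divide_left_mono mult_pos_pos zero_less_power) (use n q[OF n] assms in auto)
    then show "1 / (real n)\<^sup>2 \<le> 1 / (real L)\<^sup>2 * (1 / (real (n div L))\<^sup>2)"
      by (simp add: power_mult_distrib)
  qed
  also have "\<dots> = 1 / (real L)\<^sup>2 * (\<Sum>q\<in>(\<lambda>n. n div L) ` ?S. 1 / (real q)\<^sup>2)"
    by (simp only: sum.reindex[OF inj] sum_distrib_left o_def)
  also have "(\<Sum>q\<in>(\<lambda>n. n div L) ` ?S. 1 / (real q)\<^sup>2) \<le> (\<Sum>q\<in>insert 1 {1<..M}. 1 / (real q)\<^sup>2)"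
    using q by (intro sum_mono2) force+
  also have "\<dots> \<le> 2" using sum_inverse_squares_tail[of 1 M] by simp
  finally show ?thesis by (simp add: divide_right_mono)
qed

text \<open>The Chebyshev coefficients of \<open>Q\<^sub>L f - f\<close>: up to \<open>L\<close> they collect the folded high coefficients of
  \<open>f\<close>, beyond \<open>L\<close> they are the negatives of these coefficients.  In this form the error is a single
  orthogonal expansion.\<close>

definition alias_error_coeff :: "nat \<Rightarrow> (nat \<Rightarrow> complex) \<Rightarrow> nat \<Rightarrow> nat \<Rightarrow> complex" where
  "alias_error_coeff L a M k =
     (if k \<le> L then (\<Sum>n\<in>{n\<in>{L<..M}. cheb_alias L n = k}. a n) else - a k)"

lemma sum_alias_classes:
  assumes "L \<ge> 1"
  shows "(\<Sum>k\<le>L. \<Sum>n\<in>{n\<in>{L<..M}. cheb_alias L n = k}. h n k) = (\<Sum>n\<in>{L<..M}. h n (cheb_alias L n) :: 'a::comm_monoid_add)"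
proof -
  have "(\<Sum>k\<le>L. \<Sum>n\<in>{n\<in>{L<..M}. cheb_alias L n = k}. h n k)
    = (\<Sum>k\<le>L. \<Sum>n\<in>{n\<in>{L<..M}. cheb_alias L n = k}. h n (cheb_alias L n))"
    by (intro sum.cong) auto
  also have "\<dots> = (\<Sum>n\<in>{L<..M}. h n (cheb_alias L n))"
    by (rule sum.group) (use cheb_alias_le[OF assms] in auto)
  finally show ?thesis .
qed

lemma poly_map_poly_of_real: "poly (map_poly complex_of_real p) (of_real x) = of_real (poly p x)"
  by (induction p) (auto simp: map_poly_pCons)

lemma cc_interp_cheb_sum:
  assumes "L \<ge> 1" "L \<le> M"
  shows "poly (cc_interp L (cheb_sum a M 0)) (of_real s) - cheb_sum a M 0 s = cheb_sum (alias_error_coeff L a M) M 0 s"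
proof -
  define T where "T n s = complex_of_real (poly (cheb n) (s - 1))" for n and s :: real
  define p where "p = (\<Sum>n\<le>M. smult (a n) (map_poly complex_of_real (pcompose (cheb (cheb_alias L n)) [:-1, 1:])))"
  have pe: "poly p (of_real s) = (\<Sum>n\<le>M. a n * T (cheb_alias L n) s)" for s
    by (simp add: p_def T_def poly_sum poly_map_poly_of_real poly_pcompose)
  have "degree p \<le> L"
    unfolding p_def
  proof (intro degree_sum_le order_trans[OF degree_smult_le])
    fix n
    have "degree (map_poly complex_of_real (pcompose (cheb (cheb_alias L n)) [:-1, 1:])) \<le> degree (cheb (cheb_alias L n))"
      by (simp add: degree_map_poly degree_pcompose)
    also have "\<dots> \<le> L" using degree_cheb_le cheb_alias_le[OF assms(1)] order_trans by blast
    finally show "degree (map_poly complex_of_real (pcompose (cheb (cheb_alias L n)) [:-1, 1:])) \<le> L" .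
  qed simp
  moreover have "poly p (of_real (cc_node L l)) = cheb_sum a M 0 (cc_node L l)" for l
  proof -
    have "poly (cheb j) (cc_node L l - 1) = cos (real j * (real l * pi / real L))" for j
      using poly_cheb_cos[of j "real l * pi / real L"] by (simp add: cc_node_def)
    then show ?thesis
      unfolding pe cheb_sum_def T_def funpow_0 id_apply by (simp only: cos_cheb_alias[OF assms(1)])
  qed
  ultimately have "cc_interp L (cheb_sum a M 0) = p" by (intro cc_interp_eqI assms)
  then have "poly (cc_interp L (cheb_sum a M 0)) (of_real s) - cheb_sum a M 0 s
    = (\<Sum>n\<le>M. a n * (T (cheb_alias L n) s - T n s))"
    by (simp add: pe cheb_sum_def T_def sum_subtractf right_diff_distrib)
  also have "\<dots> = (\<Sum>n\<in>{L<..M}. a n * (T (cheb_alias L n) s - T n s))"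
    by (rule sum.mono_neutral_right) (use cheb_alias_low[OF assms(1)] in \<open>auto simp: not_less\<close>)
  also have "\<dots> = (\<Sum>n\<in>{L<..M}. a n * T (cheb_alias L n) s) + (\<Sum>n\<in>{L<..M}. - a n * T n s)"
    by (simp add: sum_subtractf sum_negf right_diff_distrib)
  also have "(\<Sum>n\<in>{L<..M}. a n * T (cheb_alias L n) s) = (\<Sum>k\<le>L. alias_error_coeff L a M k * T k s)"
    by (subst sum_alias_classes[OF assms(1), where h = "\<lambda>n k. a n * T k s", symmetric])
      (simp add: alias_error_coeff_def sum_distrib_right)
  also have "(\<Sum>n\<in>{L<..M}. - a n * T n s) = (\<Sum>k\<in>{L<..M}. alias_error_coeff L a M k * T k s)"
    by (intro sum.cong) (auto simp: alias_error_coeff_def)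
  also have "(\<Sum>k\<le>L. alias_error_coeff L a M k * T k s) + (\<Sum>k\<in>{L<..M}. alias_error_coeff L a M k * T k s)
    = (\<Sum>k\<in>{..L} \<union> {L<..M}. alias_error_coeff L a M k * T k s)"
    by (rule sum.union_disjoint[symmetric]) auto
  also have "{..L} \<union> {L<..M} = {..M}" using assms by auto
  finally show ?thesis
    unfolding cheb_sum_def[of "alias_error_coeff L a M" M 0 s] T_def by (simp only: funpow_0 id_apply)
qed

section \<open>Size of the aliasing coefficients\<close>

definition coeff_energy :: "nat \<Rightarrow> (nat \<Rightarrow> complex) \<Rightarrow> nat \<Rightarrow> real" where
  "coeff_energy m a M = (\<Sum>n\<in>{m..M}. real n ^ (2 * m) * (norm (a n))\<^sup>2)"

lemma coeff_energy_tail: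
  assumes "m \<le> L + 1"
  shows "(\<Sum>n\<in>{L<..M}. real n ^ (2 * m) * (norm (a n))\<^sup>2) \<le> coeff_energy m a M"
  unfolding coeff_energy_def using assms by (intro sum_mono2) auto

lemma power_interchange:
  assumes "L \<le> n" "q \<le> m"
  shows "real n ^ (2 * q) * real L ^ (2 * m) \<le> real L ^ (2 * q) * real n ^ (2 * m)"
proof -
  have e: "2 * m = 2 * q + 2 * (m - q)" using assms(2) by simp
  have "real L ^ (2 * m) = real L ^ (2 * q) * real L ^ (2 * (m - q))"
    "real n ^ (2 * m) = real n ^ (2 * q) * real n ^ (2 * (m - q))"
    by (subst e, rule power_add)+
  moreover have "real L ^ (2 * (m - q)) \<le> real n ^ (2 * (m - q))"
    using assms(1) by (intro power_mono) auto
  ultimately show ?thesis by (simp add: mult_left_mono mult.left_commute)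
qed

lemma power_quotient_le:
  assumes "1 \<le> L" "L \<le> n" "p + 1 \<le> m"
  shows "real n ^ (2 * p) / real n ^ (2 * m) \<le> real L ^ (2 * p + 2) / real L ^ (2 * m) * (1 / (real n)\<^sup>2)"
proof -
  have "real n ^ (2 * (p + 1)) * real L ^ (2 * m) \<le> real L ^ (2 * (p + 1)) * real n ^ (2 * m)"
    using assms by (intro power_interchange) auto
  moreover have "real n > 0" "real L > 0" using assms by auto
  ultimately show ?thesis by (simp add: field_simps power2_eq_square)
qed

text \<open>Cauchy-Schwarz with the weights \<open>n\<^sup>-\<^sup>m\<close> and \<open>n\<^sup>m\<close>; over an alias class the sum of \<open>n\<^sup>-\<^sup>2\<^sup>m\<close> is at most
  \<open>L\<^sup>2\<^sup>-\<^sup>2\<^sup>m\<close> times the sum of \<open>n\<^sup>-\<^sup>2\<close>.\<close>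

lemma alias_coeff_sq_le:
  assumes "L \<ge> 1" "m \<ge> 1" "k \<le> L"
  shows "(norm (alias_error_coeff L a M k))\<^sup>2 * real L ^ (2 * m)
    \<le> 2 * (\<Sum>n\<in>{n\<in>{L<..M}. cheb_alias L n = k}. real n ^ (2 * m) * (norm (a n))\<^sup>2)"
proof -
  let ?S = "{n\<in>{L<..M}. cheb_alias L n = k}"
  let ?V = "\<Sum>n\<in>?S. real n ^ (2 * m) * (norm (a n))\<^sup>2"
  have V: "?V \<ge> 0" by (intro sum_nonneg) auto
  have "norm (alias_error_coeff L a M k) \<le> (\<Sum>n\<in>?S. norm (a n))"
    using assms(3) by (simp add: alias_error_coeff_def norm_sum)
  also have "\<dots> = (\<Sum>n\<in>?S. (1 / real n ^ m) * (real n ^ m * norm (a n)))"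
    by (intro sum.cong) auto
  finally have "(norm (alias_error_coeff L a M k))\<^sup>2 \<le> (\<Sum>n\<in>?S. (1 / real n ^ m) * (real n ^ m * norm (a n)))\<^sup>2"
    by (intro power_mono) auto
  also have "\<dots> \<le> (\<Sum>n\<in>?S. (1 / real n ^ m)\<^sup>2) * (\<Sum>n\<in>?S. (real n ^ m * norm (a n))\<^sup>2)"
    by (rule Cauchy_Schwarz_ineq_sum)
  also have "(\<Sum>n\<in>?S. (real n ^ m * norm (a n))\<^sup>2) = ?V"
    by (intro sum.cong) (auto simp: power_mult_distrib power_mult mult.commute simp flip: power_mult)
  also have "(\<Sum>n\<in>?S. (1 / real n ^ m)\<^sup>2) \<le> 2 / real L ^ (2 * m)"
  proof -
    have "(\<Sum>n\<in>?S. (1 / real n ^ m)\<^sup>2) \<le> (\<Sum>n\<in>?S. (real L)\<^sup>2 / real L ^ (2 * m) * (1 / (real n)\<^sup>2))"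
    proof (rule sum_mono)
      fix n assume "n \<in> ?S"
      then have "real n ^ (2 * 0) / real n ^ (2 * m) \<le> real L ^ (2 * 0 + 2) / real L ^ (2 * m) * (1 / (real n)\<^sup>2)"
        using assms by (intro power_quotient_le) auto
      then show "(1 / real n ^ m)\<^sup>2 \<le> (real L)\<^sup>2 / real L ^ (2 * m) * (1 / (real n)\<^sup>2)"
        by (simp add: power_divide mult.commute[of 2 m] power_mult power2_eq_square[of "real L"])
    qed
    also have "\<dots> = (real L)\<^sup>2 / real L ^ (2 * m) * (\<Sum>n\<in>?S. 1 / (real n)\<^sup>2)" by (simp only: sum_distrib_left)
    also have "\<dots> \<le> (real L)\<^sup>2 / real L ^ (2 * m) * (2 / (real L)\<^sup>2)"
      by (intro mult_left_mono sum_inverse_squares_alias_class assms) auto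
    also have "\<dots> = 2 / real L ^ (2 * m)" using assms by simp
    finally show ?thesis .
  qed
  finally have "(norm (alias_error_coeff L a M k))\<^sup>2 \<le> 2 / real L ^ (2 * m) * ?V"
    using V by (simp add: mult_right_mono)
  then show ?thesis using assms by (simp add: field_simps)
qed

lemma split_alias_sum:
  fixes h :: "nat \<Rightarrow> real"
  assumes "L \<le> M"
  shows "sum h {..M} = sum h {..L} + sum h {L<..M}"
proof -
  have "{..M} = {..L} \<union> {L<..M}" using assms by auto
  moreover have "{..L} \<inter> {L<..M} = {}" by auto
  ultimately show ?thesis by (simp only: sum.union_disjoint[OF finite_atMost finite_greaterThanAtMost])
qed

text \<open>The case \<open>q = 0\<close> concerns the error itself, the case \<open>q = 1\<close> its derivative in \<open>t\<close>.\<close>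

lemma alias_error_energy:
  assumes "L \<ge> 1" "L \<le> M" "m \<ge> 1" "m \<le> L + 1" "q \<le> 1"
  shows "(\<Sum>k\<le>M. real k ^ (2 * q) * (norm (alias_error_coeff L a M k))\<^sup>2) * real L ^ (2 * m)
    \<le> 3 * real L ^ (2 * q) * coeff_energy m a M"
proof -
  let ?c = "alias_error_coeff L a M"
  let ?h = "\<lambda>n. real n ^ (2 * m) * (norm (a n))\<^sup>2"
  have "(\<Sum>k\<le>L. real k ^ (2 * q) * (norm (?c k))\<^sup>2 * real L ^ (2 * m))
    \<le> (\<Sum>k\<le>L. real L ^ (2 * q) * (2 * (\<Sum>n\<in>{n\<in>{L<..M}. cheb_alias L n = k}. ?h n)))"
  proof (rule sum_mono)
    fix k assume k: "k \<in> {..L}"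
    have "real k ^ (2 * q) * ((norm (?c k))\<^sup>2 * real L ^ (2 * m)) \<le> real L ^ (2 * q) * (2 * (\<Sum>n\<in>{n\<in>{L<..M}. cheb_alias L n = k}. ?h n))"
      using k by (intro mult_mono alias_coeff_sq_le assms power_mono) auto
    then show "real k ^ (2 * q) * (norm (?c k))\<^sup>2 * real L ^ (2 * m) \<le> real L ^ (2 * q) * (2 * (\<Sum>n\<in>{n\<in>{L<..M}. cheb_alias L n = k}. ?h n))"
      by (simp add: mult.assoc)
  qed
  also have "\<dots> = 2 * real L ^ (2 * q) * (\<Sum>k\<le>L. \<Sum>n\<in>{n\<in>{L<..M}. cheb_alias L n = k}. ?h n)"
    by (simp add: sum_distrib_left mult_ac)
  also have "(\<Sum>k\<le>L. \<Sum>n\<in>{n\<in>{L<..M}. cheb_alias L n = k}. ?h n) = (\<Sum>n\<in>{L<..M}. ?h n)"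
    by (rule sum_alias_classes[OF assms(1)])
  finally have low: "(\<Sum>k\<le>L. real k ^ (2 * q) * (norm (?c k))\<^sup>2 * real L ^ (2 * m))
    \<le> 2 * real L ^ (2 * q) * (\<Sum>n\<in>{L<..M}. ?h n)" .
  have "(\<Sum>k\<in>{L<..M}. real k ^ (2 * q) * (norm (?c k))\<^sup>2 * real L ^ (2 * m))
    \<le> (\<Sum>k\<in>{L<..M}. real L ^ (2 * q) * ?h k)"
  proof (rule sum_mono)
    fix k assume k: "k \<in> {L<..M}"
    have "(real k ^ (2 * q) * real L ^ (2 * m)) * (norm (a k))\<^sup>2 \<le> (real L ^ (2 * q) * real k ^ (2 * m)) * (norm (a k))\<^sup>2"
      using k assms by (intro mult_right_mono power_interchange) auto
    then show "real k ^ (2 * q) * (norm (?c k))\<^sup>2 * real L ^ (2 * m) \<le> real L ^ (2 * q) * ?h k"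
      using k by (simp add: alias_error_coeff_def mult_ac)
  qed
  also have "\<dots> = real L ^ (2 * q) * (\<Sum>n\<in>{L<..M}. ?h n)" by (simp only: sum_distrib_left)
  finally have "(\<Sum>k\<le>M. real k ^ (2 * q) * (norm (?c k))\<^sup>2 * real L ^ (2 * m))
    \<le> 3 * real L ^ (2 * q) * (\<Sum>n\<in>{L<..M}. ?h n)"
    using low unfolding split_alias_sum[OF assms(2)] by linarith
  also have "\<dots> \<le> 3 * real L ^ (2 * q) * coeff_energy m a M"
    by (intro mult_left_mono coeff_energy_tail assms) auto
  finally show ?thesis by (simp add: sum_distrib_right)
qed

text \<open>Folding lowers the index, so the aliased part is dominated by the tail of \<open>f\<close>; to the latter
  Cauchy-Schwarz applies.  The condition \<open>p + 1 \<le> m\<close> makes the sum of \<open>n\<^sup>2\<^sup>p\<^sup>-\<^sup>2\<^sup>m\<close> converge.\<close>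

lemma alias_error_weighted_l1:
  assumes "L \<ge> 1" "L \<le> M" "m \<le> L + 1" "p + 1 \<le> m"
  shows "(\<Sum>k\<le>M. real k ^ p * norm (alias_error_coeff L a M k)) * real L ^ m
    \<le> 2 * sqrt (real L ^ (2 * p + 1) * coeff_energy m a M)"
proof -
  let ?c = "alias_error_coeff L a M"
  define X where "X = (\<Sum>n\<in>{L<..M}. real n ^ p * norm (a n))"
  have "X \<ge> 0" unfolding X_def by (intro sum_nonneg) auto
  have "(\<Sum>k\<le>L. real k ^ p * norm (?c k)) \<le> (\<Sum>k\<le>L. \<Sum>n\<in>{n\<in>{L<..M}. cheb_alias L n = k}. real n ^ p * norm (a n))"
  proof (rule sum_mono)
    fix k assume k: "k \<in> {..L}"
    have "real k ^ p * norm (?c k) \<le> real k ^ p * (\<Sum>n\<in>{n\<in>{L<..M}. cheb_alias L n = k}. norm (a n))"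
      using k by (intro mult_left_mono) (auto simp: alias_error_coeff_def norm_sum)
    also have "\<dots> \<le> (\<Sum>n\<in>{n\<in>{L<..M}. cheb_alias L n = k}. real n ^ p * norm (a n))"
      unfolding sum_distrib_left using k by (intro sum_mono mult_right_mono power_mono) auto
    finally show "real k ^ p * norm (?c k) \<le> (\<Sum>n\<in>{n\<in>{L<..M}. cheb_alias L n = k}. real n ^ p * norm (a n))" .
  qed
  also have "\<dots> = X" unfolding X_def by (rule sum_alias_classes[OF assms(1)])
  finally have "(\<Sum>k\<le>M. real k ^ p * norm (?c k)) \<le> X + (\<Sum>k\<in>{L<..M}. real k ^ p * norm (?c k))"
    unfolding split_alias_sum[OF assms(2)] by simp
  also have "(\<Sum>k\<in>{L<..M}. real k ^ p * norm (?c k)) = X"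
    unfolding X_def by (intro sum.cong) (auto simp: alias_error_coeff_def)
  finally have c2X: "(\<Sum>k\<le>M. real k ^ p * norm (?c k)) \<le> 2 * X" by simp
  have "X\<^sup>2 = (\<Sum>n\<in>{L<..M}. (real n ^ p / real n ^ m) * (real n ^ m * norm (a n)))\<^sup>2"
    unfolding X_def by (intro arg_cong[of _ _ "\<lambda>x. x\<^sup>2"] sum.cong) auto
  also have "\<dots> \<le> (\<Sum>n\<in>{L<..M}. (real n ^ p / real n ^ m)\<^sup>2) * (\<Sum>n\<in>{L<..M}. (real n ^ m * norm (a n))\<^sup>2)"
    by (rule Cauchy_Schwarz_ineq_sum)
  also have "\<dots> \<le> (real L ^ (2 * p + 1) / real L ^ (2 * m)) * coeff_energy m a M"
  proof (rule mult_mono)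
    have "(\<Sum>n\<in>{L<..M}. (real n ^ p / real n ^ m)\<^sup>2) \<le> (\<Sum>n\<in>{L<..M}. real L ^ (2 * p + 2) / real L ^ (2 * m) * (1 / (real n)\<^sup>2))"
    proof (rule sum_mono)
      fix n assume "n \<in> {L<..M}"
      then have "real n ^ (2 * p) / real n ^ (2 * m) \<le> real L ^ (2 * p + 2) / real L ^ (2 * m) * (1 / (real n)\<^sup>2)"
        using assms by (intro power_quotient_le) auto
      then show "(real n ^ p / real n ^ m)\<^sup>2 \<le> real L ^ (2 * p + 2) / real L ^ (2 * m) * (1 / (real n)\<^sup>2)"
        by (simp add: power_divide mult.commute[of 2 m] mult.commute[of 2 p] power_mult)
    qed
    also have "\<dots> = real L ^ (2 * p + 2) / real L ^ (2 * m) * (\<Sum>n\<in>{L<..M}. 1 / (real n)\<^sup>2)" by (simp only: sum_distrib_left)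
    also have "\<dots> \<le> real L ^ (2 * p + 2) / real L ^ (2 * m) * (1 / real L)"
      by (intro mult_left_mono sum_inverse_squares_tail assms) auto
    also have "\<dots> = real L ^ (2 * p + 1) / real L ^ (2 * m)" using assms by (simp add: field_simps)
    finally show "(\<Sum>n\<in>{L<..M}. (real n ^ p / real n ^ m)\<^sup>2) \<le> real L ^ (2 * p + 1) / real L ^ (2 * m)" .
    have "(\<Sum>n\<in>{L<..M}. (real n ^ m * norm (a n))\<^sup>2) = (\<Sum>n\<in>{L<..M}. real n ^ (2 * m) * (norm (a n))\<^sup>2)"
      by (intro sum.cong) (auto simp: power_mult_distrib power_mult mult.commute simp flip: power_mult)
    then show "(\<Sum>n\<in>{L<..M}. (real n ^ m * norm (a n))\<^sup>2) \<le> coeff_energy m a M"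
      using coeff_energy_tail[OF assms(3)] by simp
  qed (auto intro: sum_nonneg)
  finally have "X\<^sup>2 * real L ^ (2 * m) \<le> real L ^ (2 * p + 1) * coeff_energy m a M"
    using assms by (simp add: field_simps)
  then have "(X * real L ^ m)\<^sup>2 \<le> real L ^ (2 * p + 1) * coeff_energy m a M"
    by (simp add: power_mult_distrib mult.commute[of 2 m] power_mult)
  then have "X * real L ^ m \<le> sqrt (real L ^ (2 * p + 1) * coeff_energy m a M)"
    by (rule real_le_rsqrt)
  moreover have "(\<Sum>k\<le>M. real k ^ p * norm (?c k)) * real L ^ m \<le> 2 * X * real L ^ m"
    using c2X by (intro mult_right_mono) auto
  ultimately show ?thesis by linarith
qed

section \<open>Decay of the exponential kernel\<close>

lemma sin_ge_quarter:
  assumes "0 \<le> x" "x \<le> pi / 2"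
  shows "x / 4 \<le> sin x"
proof (cases "x \<le> pi / 3")
  case True
  have "(\<lambda>x. sin x - x / 4) 0 \<le> (\<lambda>x. sin x - x / 4) x"
  proof (rule DERIV_nonneg_imp_nondecreasing[OF assms(1)])
    fix y assume y: "0 \<le> y" "y \<le> x"
    have "cos (pi / 3) \<le> cos y" by (rule cos_monotone_0_pi_le) (use y True in auto)
    then have "0 \<le> cos y - 1 / 4" by (simp add: cos_60)
    moreover have "((\<lambda>x. sin x - x / 4) has_real_derivative (cos y - 1 / 4)) (at y)"
      by (auto intro!: derivative_eq_intros)
    ultimately show "\<exists>D. ((\<lambda>x. sin x - x / 4) has_real_derivative D) (at y) \<and> 0 \<le> D" by blast
  qed
  then show ?thesis by simp
next
  case False
  have "1 / 2 = sin (pi / 6)" by (simp add: sin_30)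
  also have "\<dots> \<le> sin x" by (rule sin_monotone_2pi_le) (use False assms pi_gt_zero in \<open>linarith+\<close>)
  finally show ?thesis using assms(2) pi_less_4 by linarith
qed

lemma one_plus_cos_ge:
  assumes "t \<in> {0..pi}"
  shows "(pi - t)\<^sup>2 / 36 \<le> 1 + cos t"
proof -
  have "((pi - t) / 2 / 4)\<^sup>2 \<le> (sin ((pi - t) / 2))\<^sup>2"
    using assms by (intro power_mono sin_ge_quarter) auto
  moreover have "1 + cos t = 2 * (sin ((pi - t) / 2))\<^sup>2"
  proof -
    have "cos (pi - t) = 1 - 2 * (sin ((pi - t) / 2))\<^sup>2"
    proof -
      have "2 * ((pi - t) / 2) = pi - t" by simp
      then show ?thesis using cos_double_sin[of "(pi - t) / 2"] by (simp only:)
    qed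
    then show ?thesis by simp
  qed
  moreover have "((pi - t) / 2 / 4)\<^sup>2 * 2 = (pi - t)\<^sup>2 / 32" by (simp add: power_divide)
  moreover have "(pi - t)\<^sup>2 / 36 \<le> (pi - t)\<^sup>2 / 32" by (simp add: divide_left_mono)
  ultimately show ?thesis by linarith
qed

text \<open>A rational majorant of the Gaussian profile of \<open>exp (- \<tau> (1 + cos t))\<close> at \<open>t = pi\<close>, chosen for its
  elementary antiderivative.\<close>

definition lorentz :: "real \<Rightarrow> real \<Rightarrow> real" where
  "lorentz \<tau> t = 1 / (1 + \<tau> * (pi - t)\<^sup>2 / 36)"

lemma continuous_on_lorentz: "\<tau> \<ge> 0 \<Longrightarrow> continuous_on S (lorentz \<tau>)"
proof -
  assume "\<tau> \<ge> 0"
  then have "0 \<le> \<tau> * (pi - t)\<^sup>2 / 36" for t by simp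
  then have "1 + \<tau> * (pi - t)\<^sup>2 / 36 \<noteq> 0" for t by (smt (verit, best))
  then show ?thesis unfolding lorentz_def by (intro continuous_intros) auto
qed

lemma integral_lorentz_le:
  assumes "\<tau> > 0"
  shows "integral {0..pi} (lorentz \<tau>) \<le> 3 * pi / sqrt \<tau>"
proof -
  define b where "b = sqrt \<tau> / 6"
  have b: "b > 0" "b\<^sup>2 = \<tau> / 36" using assms by (auto simp: b_def power_divide)
  have "(lorentz \<tau> has_integral (- arctan (b * (pi - pi)) / b - (- arctan (b * (pi - 0)) / b))) {0..pi}"
  proof (rule fundamental_theorem_of_calculus)
    fix t
    have eq: "1 + (b * (pi - t))\<^sup>2 = 1 + \<tau> * (pi - t)\<^sup>2 / 36" using b by (simp add: power_mult_distrib)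
    have "((\<lambda>t. - arctan (b * (pi - t)) / b) has_real_derivative (- (inverse (1 + (b * (pi - t))\<^sup>2) * (- b)) / b)) (at t within {0..pi})"
      using b(1) by (auto intro!: derivative_eq_intros)
    moreover have "- (inverse (1 + (b * (pi - t))\<^sup>2) * (- b)) / b = lorentz \<tau> t"
      using b(1) unfolding eq lorentz_def by (simp add: inverse_eq_divide)
    ultimately show "((\<lambda>t. - arctan (b * (pi - t)) / b) has_vector_derivative lorentz \<tau> t) (at t within {0..pi})"
      by (simp add: has_real_derivative_iff_has_vector_derivative)
  qed simp
  then have "integral {0..pi} (lorentz \<tau>) = arctan (b * pi) / b" by (simp add: integral_unique)
  also have "\<dots> \<le> (pi / 2) / b" using b(1) arctan_ubound[of "b * pi"] by (intro divide_right_mono) auto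
  also have "\<dots> = 3 * pi / sqrt \<tau>" using assms by (simp add: b_def field_simps)
  finally show ?thesis .
qed

text \<open>With \<open>y = \<tau> (pi - t)\<^sup>2 / 36\<close> the two bounds come from \<open>exp (-y) \<le> 1 / (1 + y)\<close> and
  \<open>y exp (-y) \<le> 2 / (1 + y)\<close>; the latter turns \<open>sin\<^sup>2 t \<le> (pi - t)\<^sup>2\<close> into the gain \<open>1 / \<tau>\<close>.\<close>

lemma exp_decay_lorentz:
  assumes "\<tau> > 0" "t \<in> {0..pi}"
  shows "exp (- \<tau> * (1 + cos t)) \<le> lorentz \<tau> t"
    "exp (- \<tau> * (1 + cos t)) * (sin t)\<^sup>2 \<le> 72 / \<tau> * lorentz \<tau> t"
proof -
  define y where "y = \<tau> * (pi - t)\<^sup>2 / 36"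
  have y: "y \<ge> 0" using assms by (simp add: y_def)
  have le: "exp (- \<tau> * (1 + cos t)) \<le> exp (- y)"
    using mult_left_mono[OF one_plus_cos_ge[OF assms(2)], of \<tau>] assms(1) by (simp add: y_def)
  have G: "lorentz \<tau> t = 1 / (1 + y)" by (simp add: lorentz_def y_def)
  have "exp (- y) \<le> 1 / (1 + y)"
    using exp_ge_add_one_self[of y] y by (simp add: exp_minus inverse_eq_divide divide_left_mono)
  then show "exp (- \<tau> * (1 + cos t)) \<le> lorentz \<tau> t" using le unfolding G by linarith
  have "sin t = sin (pi - t)" by simp
  then have "\<bar>sin t\<bar> \<le> \<bar>pi - t\<bar>" by (metis abs_sin_x_le_abs_x)
  then have s: "(sin t)\<^sup>2 \<le> (pi - t)\<^sup>2" by (simp only: abs_le_square_iff)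
  have "y * exp (- y) \<le> 2 / (1 + y)"
  proof -
    have "1 + y + y\<^sup>2 / 2 \<le> exp y" using exp_lower_Taylor_quadratic[OF y] by simp
    then have "y * (1 + y) \<le> 2 * exp y" using y by (simp add: power2_eq_square algebra_simps)
    then show ?thesis using y by (simp add: exp_minus field_simps)
  qed
  then have "36 / \<tau> * (y * exp (- y)) \<le> 36 / \<tau> * (2 / (1 + y))" using assms(1) by (intro mult_left_mono) auto
  moreover have "36 / \<tau> * (y * exp (- y)) = exp (- y) * (pi - t)\<^sup>2" using assms(1) by (simp add: y_def)
  moreover have "exp (- \<tau> * (1 + cos t)) * (sin t)\<^sup>2 \<le> exp (- y) * (pi - t)\<^sup>2" using le s by (intro mult_mono) auto
  ultimately show "exp (- \<tau> * (1 + cos t)) * (sin t)\<^sup>2 \<le> 72 / \<tau> * lorentz \<tau> t" by (simp add: G)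
qed

text \<open>For \<open>\<sigma> \<le> \<mu>\<close> the exponent \<open>\<sigma>\<close> exceeds \<open>- (1 + \<bar>\<sigma>\<bar>)\<close> by at most \<open>2 \<mu> + 1\<close>, so positive and
  negative real parts can be treated alike.\<close>

lemma exp_half_plane_le:
  fixes \<sigma> \<mu> u :: real
  assumes "\<sigma> \<le> \<mu>" "\<mu> > 0" "0 \<le> u" "u \<le> 2" "\<kappa> = 1 \<or> \<kappa> = 2"
  shows "exp (\<kappa> * \<sigma> * u) \<le> exp (8 * \<mu> + 4) * exp (- (1 + \<bar>\<sigma>\<bar>) * u)"
proof -
  have "\<sigma> \<le> 2 * \<mu> + 1 - (1 + \<bar>\<sigma>\<bar>)" using assms(1,2) by (auto simp: abs_if)
  then have "\<kappa> * \<sigma> * u \<le> \<kappa> * (2 * \<mu> + 1 - (1 + \<bar>\<sigma>\<bar>)) * u"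
    using assms by (intro mult_right_mono mult_left_mono) auto
  also have "\<dots> = (2 * \<mu> + 1) * (\<kappa> * u) - (1 + \<bar>\<sigma>\<bar>) * (\<kappa> * u)" by (simp add: algebra_simps)
  also have "\<dots> \<le> (2 * \<mu> + 1) * 4 - (1 + \<bar>\<sigma>\<bar>) * u"
    using assms by (intro diff_mono mult_left_mono) auto
  finally have "\<kappa> * \<sigma> * u \<le> 8 * \<mu> + 4 + - (1 + \<bar>\<sigma>\<bar>) * u" by (simp add: algebra_simps)
  then show ?thesis by (simp only: exp_add[symmetric] exp_le_cancel_iff)
qed

lemma integral_mono_continuous:
  fixes f g :: "real \<Rightarrow> real"
  assumes "continuous_on {a..b} f" "continuous_on {a..b} g" "\<And>t. t \<in> {a..b} \<Longrightarrow> f t \<le> g t"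
  shows "integral {a..b} f \<le> integral {a..b} g"
  by (rule integral_le) (use assms in \<open>auto intro: integrable_continuous_real\<close>)

lemma exp_cos_integrals:
  assumes "\<sigma> \<le> \<mu>" "\<mu> > 0"
  defines "\<tau> \<equiv> 1 + \<bar>\<sigma>\<bar>"
  shows "\<kappa> = 1 \<or> \<kappa> = 2 \<Longrightarrow> integral {0..pi} (\<lambda>t. exp (\<kappa> * \<sigma> * (1 + cos t))) \<le> exp (8 * \<mu> + 4) * (3 * pi / sqrt \<tau>)"
    "integral {0..pi} (\<lambda>t. exp (2 * \<sigma> * (1 + cos t)) * (sin t)\<^sup>2) \<le> exp (8 * \<mu> + 4) * (72 / \<tau> * (3 * pi / sqrt \<tau>))"
proof -
  have \<tau>: "\<tau> > 0" by (simp add: \<tau>_def add_pos_nonneg)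
  have u: "0 \<le> 1 + cos t" "1 + cos t \<le> 2" for t :: real
    using cos_ge_minus_one[of t] cos_le_one[of t] by linarith+
  have contL: "continuous_on {0..pi} (lorentz \<tau>)" using \<tau> by (intro continuous_on_lorentz) simp
  have intL: "integral {0..pi} (lorentz \<tau>) \<le> 3 * pi / sqrt \<tau>" using \<tau> by (rule integral_lorentz_le)
  show "integral {0..pi} (\<lambda>t. exp (\<kappa> * \<sigma> * (1 + cos t))) \<le> exp (8 * \<mu> + 4) * (3 * pi / sqrt \<tau>)" if \<kappa>: "\<kappa> = 1 \<or> \<kappa> = 2"
  proof -
    have "integral {0..pi} (\<lambda>t. exp (\<kappa> * \<sigma> * (1 + cos t))) \<le> integral {0..pi} (\<lambda>t. exp (8 * \<mu> + 4) * lorentz \<tau> t)"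
    proof (rule integral_mono_continuous)
      fix t assume t: "t \<in> {0..pi}"
      have "exp (\<kappa> * \<sigma> * (1 + cos t)) \<le> exp (8 * \<mu> + 4) * exp (- \<tau> * (1 + cos t))"
        unfolding \<tau>_def using u assms \<kappa> by (intro exp_half_plane_le) auto
      also have "\<dots> \<le> exp (8 * \<mu> + 4) * lorentz \<tau> t"
        using exp_decay_lorentz(1)[OF \<tau> t] by (intro mult_left_mono) auto
      finally show "exp (\<kappa> * \<sigma> * (1 + cos t)) \<le> exp (8 * \<mu> + 4) * lorentz \<tau> t" .
    qed (auto intro!: continuous_intros contL)
    also have "\<dots> = exp (8 * \<mu> + 4) * integral {0..pi} (lorentz \<tau>)" by simp
    also have "\<dots> \<le> exp (8 * \<mu> + 4) * (3 * pi / sqrt \<tau>)" using intL by (intro mult_left_mono) auto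
    finally show ?thesis .
  qed
  have "integral {0..pi} (\<lambda>t. exp (2 * \<sigma> * (1 + cos t)) * (sin t)\<^sup>2) \<le> integral {0..pi} (\<lambda>t. exp (8 * \<mu> + 4) * (72 / \<tau> * lorentz \<tau> t))"
  proof (rule integral_mono_continuous)
    fix t assume t: "t \<in> {0..pi}"
    have "exp (2 * \<sigma> * (1 + cos t)) * (sin t)\<^sup>2 \<le> exp (8 * \<mu> + 4) * exp (- \<tau> * (1 + cos t)) * (sin t)\<^sup>2"
      unfolding \<tau>_def using u assms by (intro mult_right_mono exp_half_plane_le) auto
    also have "\<dots> = exp (8 * \<mu> + 4) * (exp (- \<tau> * (1 + cos t)) * (sin t)\<^sup>2)" by simp
    also have "\<dots> \<le> exp (8 * \<mu> + 4) * (72 / \<tau> * lorentz \<tau> t)"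
      using exp_decay_lorentz(2)[OF \<tau> t] by (intro mult_left_mono) auto
    finally show "exp (2 * \<sigma> * (1 + cos t)) * (sin t)\<^sup>2 \<le> exp (8 * \<mu> + 4) * (72 / \<tau> * lorentz \<tau> t)" .
  qed (use \<tau> in \<open>auto intro!: continuous_intros contL\<close>)
  also have "\<dots> = exp (8 * \<mu> + 4) * (72 / \<tau> * integral {0..pi} (lorentz \<tau>))" by simp
  also have "\<dots> \<le> exp (8 * \<mu> + 4) * (72 / \<tau> * (3 * pi / sqrt \<tau>))" using intL \<tau> by (intro mult_left_mono) auto
  finally show "integral {0..pi} (\<lambda>t. exp (2 * \<sigma> * (1 + cos t)) * (sin t)\<^sup>2) \<le> exp (8 * \<mu> + 4) * (72 / \<tau> * (3 * pi / sqrt \<tau>))" .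
qed

text \<open>Cauchy-Schwarz, with the oscillating factor replaced by its modulus.\<close>

lemma norm_integral_product_le:
  fixes f :: "real \<Rightarrow> complex" and w :: "real \<Rightarrow> real"
  assumes f: "continuous_on {0..pi} f" and w: "continuous_on {0..pi} w" "\<And>t. t \<in> {0..pi} \<Longrightarrow> w t \<ge> 0"
    and I: "((\<lambda>t. f t * exp (of_real (1 + cos t) * z) * of_real (w t)) has_integral I) {0..pi}"
    and A: "((\<lambda>t. (norm (f t))\<^sup>2) has_integral A) {0..pi}"
    and B: "integral {0..pi} (\<lambda>t. exp (2 * Re z * (1 + cos t)) * (w t)\<^sup>2) \<le> B"
  shows "norm I \<le> sqrt A * sqrt B"
proof -
  define g where "g t = exp (Re z * (1 + cos t)) * w t" for t
  have g: "continuous_on {0..pi} g" unfolding g_def by (intro continuous_intros w)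
  have "norm I = norm (integral {0..pi} (\<lambda>t. f t * exp (of_real (1 + cos t) * z) * of_real (w t)))"
    using I by (simp add: integral_unique)
  also have "\<dots> \<le> integral {0..pi} (\<lambda>t. norm (f t) * g t)"
  proof (rule integral_norm_bound_integral)
    show "(\<lambda>t. f t * exp (of_real (1 + cos t) * z) * of_real (w t)) integrable_on {0..pi}" using I by blast
    show "(\<lambda>t. norm (f t) * g t) integrable_on {0..pi}"
      by (intro integrable_continuous_real continuous_intros f g)
    show "norm (f t * exp (of_real (1 + cos t) * z) * of_real (w t)) \<le> norm (f t) * g t" if "t \<in> {0..pi}" for t
      using w(2)[OF that] by (simp add: g_def norm_mult norm_exp_eq_Re mult_ac)
  qed
  also have "\<dots> \<le> sqrt A * sqrt (integral {0..pi} (\<lambda>t. (g t)\<^sup>2))"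
  proof (rule integral_Cauchy_Schwarz[OF A])
    show "((\<lambda>t. norm (f t) * g t) has_integral integral {0..pi} (\<lambda>t. norm (f t) * g t)) {0..pi}"
      by (intro integrable_integral integrable_continuous_real continuous_intros f g)
    show "((\<lambda>t. (g t)\<^sup>2) has_integral integral {0..pi} (\<lambda>t. (g t)\<^sup>2)) {0..pi}"
      by (intro integrable_integral integrable_continuous_real continuous_intros g)
  qed
  also have "(\<lambda>t. (g t)\<^sup>2) = (\<lambda>t. exp (2 * Re z * (1 + cos t)) * (w t)\<^sup>2)"
  proof
    fix t
    have "(exp (Re z * (1 + cos t)))\<^sup>2 = exp (2 * Re z * (1 + cos t))"
      by (simp add: mult.assoc flip: exp_double)
    then show "(g t)\<^sup>2 = exp (2 * Re z * (1 + cos t)) * (w t)\<^sup>2" by (simp add: g_def power_mult_distrib)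
  qed
  also have "sqrt A * sqrt (integral {0..pi} (\<lambda>t. exp (2 * Re z * (1 + cos t)) * (w t)\<^sup>2)) \<le> sqrt A * sqrt B"
    using B has_integral_nonneg[OF A] by (intro mult_left_mono) auto
  finally show ?thesis .
qed

section \<open>The oscillatory integral of the interpolation error\<close>

text \<open>The endpoints \<open>0\<close> and \<open>2\<close> are nodes.\<close>

lemma vanishing_at_endpoints:
  assumes "L \<ge> 1" "L \<le> M"
  shows "cheb_sum (alias_error_coeff L a M) M 0 0 = 0" "cheb_sum (alias_error_coeff L a M) M 0 2 = 0"
proof -
  have "cheb_sum (alias_error_coeff L a M) M 0 (cc_node L l) = 0" if "l \<in> {0..L}" for l
    using cc_interp_cheb_sum[OF assms, of a "cc_node L l"] poly_cc_interp_node[OF assms(1) that] by simp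
  from this[of L] this[of 0] show "cheb_sum (alias_error_coeff L a M) M 0 0 = 0" "cheb_sum (alias_error_coeff L a M) M 0 2 = 0"
    using assms(1) by (simp_all add: cc_node_def)
qed

lemma quadrature_error_cheb_sum:
  assumes "L \<ge> 1" "L \<le> M"
  shows "quad_error L z (cheb_sum a M 0) = osc_integral z (cheb_sum (alias_error_coeff L a M) M 0)"
proof -
  have "(\<lambda>s. poly (cc_interp L (cheb_sum a M 0)) (of_real s) * exp (of_real s * z)) integrable_on {0..2}"
    "(\<lambda>s. cheb_sum a M 0 s * exp (of_real s * z)) integrable_on {0..2}"
    by (auto intro!: integrable_continuous_real continuous_intros)
  then show ?thesis
    unfolding fcc_rule_def osc_integral_def
    by (simp add: cc_interp_cheb_sum[OF assms, symmetric] left_diff_distrib integral_diff)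
qed

context
  fixes c :: "nat \<Rightarrow> complex" and M :: nat and z :: complex and \<mu> :: real
  assumes ends: "cheb_sum c M 0 0 = 0" "cheb_sum c M 0 2 = 0"
    and z: "Re z \<le> \<mu>" "\<mu> > 0"
begin

text \<open>In the angle \<open>t\<close> with \<open>s = 1 + cos t\<close> a Chebyshev expansion is a cosine sum, and its \<open>t\<close>-derivative
  is a sine sum, orthogonal again.\<close>

definition "angular_error t = (\<Sum>k\<le>M. c k * of_real (cos (real k * t)))"
definition "angular_error_deriv t = (\<Sum>k\<le>M. (- c k * of_real (real k)) * of_real (sin (real k * t)))"
definition "angular_kernel t = exp (of_real (1 + cos t) * z)"

lemma cheb_sum_angular: "cheb_sum c M 0 (1 + cos t) = angular_error t"
  by (simp add: cheb_sum_def angular_error_def poly_cheb_cos)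

lemma continuous_angular: "continuous_on S angular_error" "continuous_on S angular_error_deriv" "continuous_on S angular_kernel"
  unfolding angular_error_def angular_error_deriv_def angular_kernel_def by (intro continuous_intros)+

lemma angular_error_has_deriv: "(angular_error has_vector_derivative angular_error_deriv t) (at t within S)"
proof -
  have "((\<lambda>t. c k * of_real (cos (real k * t))) has_vector_derivative ((- c k * of_real (real k)) * of_real (sin (real k * t)))) (at t within S)" for k
  proof -
    have "((\<lambda>t. cos (real k * t)) has_real_derivative (- real k * sin (real k * t))) (at t within S)"
      by (auto intro!: derivative_eq_intros)
    then have "((\<lambda>t. c k * of_real (cos (real k * t))) has_vector_derivative (c k * of_real (- real k * sin (real k * t)))) (at t within S)"
      by (intro has_vector_derivative_mult_right has_vector_derivative_of_real)
    then show ?thesis by (simp add: mult_ac)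
  qed
  then show ?thesis unfolding angular_error_def[abs_def] angular_error_deriv_def by (intro has_vector_derivative_sum)
qed

lemma angular_kernel_has_deriv: "(angular_kernel has_vector_derivative (- of_real (sin t) * z * angular_kernel t)) (at t within S)"
proof -
  have "((\<lambda>t. 1 + cos t) has_real_derivative (- sin t)) (at t within S)"
    by (auto intro!: derivative_eq_intros)
  then have "((\<lambda>t. of_real (1 + cos t) * z) has_vector_derivative (of_real (- sin t) * z)) (at t within S)"
    by (intro has_vector_derivative_mult_left has_vector_derivative_of_real)
  from field_vector_diff_chain_within[OF this, of exp "exp (of_real (1 + cos t) * z)"]
  have "(exp \<circ> (\<lambda>t. of_real (1 + cos t) * z) has_vector_derivative (of_real (- sin t) * z) * exp (of_real (1 + cos t) * z)) (at t within S)"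
    by (simp add: DERIV_exp has_field_derivative_at_within)
  then show ?thesis by (simp add: angular_kernel_def[abs_def] o_def)
qed

lemma error_angular: "((\<lambda>t. angular_error t * angular_kernel t * of_real (sin t)) has_integral osc_integral z (cheb_sum c M 0)) {0..pi}"
proof -
  have "((\<lambda>t. sin t *\<^sub>R (cheb_sum c M 0 (1 + cos t) * exp (of_real (1 + cos t) * z))) has_integral osc_integral z (cheb_sum c M 0)) {0..pi}"
    unfolding osc_integral_def by (rule has_integral_cos_substitution) (intro continuous_intros)
  then show ?thesis unfolding cheb_sum_angular angular_kernel_def by (simp add: scaleR_conv_of_real mult_ac)
qed

text \<open>The derivative of the kernel in \<open>t\<close> is \<open>- z sin t\<close> times the kernel, so integration by parts trades
  the factor \<open>sin t\<close> against one power of \<open>z\<close>.\<close>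

lemma error_angular_by_parts: "((\<lambda>t. angular_error_deriv t * angular_kernel t) has_integral z * osc_integral z (cheb_sum c M 0)) {0..pi}"
proof -
  have "((\<lambda>t. angular_error t * (- of_real (sin t) * z * angular_kernel t) + angular_error_deriv t * angular_kernel t) has_integral (angular_error pi * angular_kernel pi - angular_error 0 * angular_kernel 0)) {0..pi}"
    by (rule fundamental_theorem_of_calculus, simp, intro has_vector_derivative_mult angular_error_has_deriv angular_kernel_has_deriv)
  moreover have "angular_error pi = 0" "angular_error 0 = 0" using ends cheb_sum_angular[of pi] cheb_sum_angular[of 0] by auto
  ultimately have 1: "((\<lambda>t. angular_error t * (- of_real (sin t) * z * angular_kernel t) + angular_error_deriv t * angular_kernel t) has_integral 0) {0..pi}" by simp
  have "((\<lambda>t. (angular_error t * (- of_real (sin t) * z * angular_kernel t) + angular_error_deriv t * angular_kernel t) + z * (angular_error t * angular_kernel t * of_real (sin t)))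
     has_integral (0 + z * osc_integral z (cheb_sum c M 0))) {0..pi}"
    by (intro has_integral_add 1 has_integral_mult_right error_angular)
  then show ?thesis by (simp add: algebra_simps)
qed

lemma oscillatory_bound_direct:
  defines "\<tau> \<equiv> 1 + \<bar>Re z\<bar>"
  shows "norm (osc_integral z (cheb_sum c M 0))
    \<le> sqrt (pi * (\<Sum>k\<le>M. (norm (c k))\<^sup>2)) * sqrt (exp (8 * \<mu> + 4) * (72 / \<tau> * (3 * pi / sqrt \<tau>)))"
proof -
  have A: "((\<lambda>t. (norm (angular_error t))\<^sup>2) has_integral (\<Sum>k\<le>M. (if k = 0 then pi else pi / 2) * (norm (c k))\<^sup>2)) {0..pi}"
    unfolding angular_error_def
    using has_integral_norm_sq_orthogonal_sum[of "{..M}" "\<lambda>k t. cos (real k * t)" "\<lambda>_. 1" "\<lambda>k. if k = 0 then pi else pi / 2" "{0..pi}" c]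
      cos_orthogonal by simp
  have "norm (osc_integral z (cheb_sum c M 0)) \<le> sqrt (\<Sum>k\<le>M. (if k = 0 then pi else pi / 2) * (norm (c k))\<^sup>2)
      * sqrt (exp (8 * \<mu> + 4) * (72 / \<tau> * (3 * pi / sqrt \<tau>)))"
    unfolding \<tau>_def
    by (rule norm_integral_product_le[OF continuous_angular(1) _ _ error_angular[unfolded angular_kernel_def] A exp_cos_integrals(2)[OF z]])
      (auto intro!: continuous_intros sin_ge_zero)
  also have "\<dots> \<le> sqrt (pi * (\<Sum>k\<le>M. (norm (c k))\<^sup>2)) * sqrt (exp (8 * \<mu> + 4) * (72 / \<tau> * (3 * pi / sqrt \<tau>)))"
    unfolding sum_distrib_left
    by (intro mult_right_mono real_sqrt_le_mono sum_mono) (auto simp: \<tau>_def)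
  finally show ?thesis .
qed

lemma oscillatory_bound_one_parts:
  defines "\<tau> \<equiv> 1 + \<bar>Re z\<bar>"
  shows "norm z * norm (osc_integral z (cheb_sum c M 0))
    \<le> sqrt (pi * (\<Sum>k\<le>M. (real k)\<^sup>2 * (norm (c k))\<^sup>2)) * sqrt (exp (8 * \<mu> + 4) * (3 * pi / sqrt \<tau>))"
proof -
  have A: "((\<lambda>t. (norm (angular_error_deriv t))\<^sup>2) has_integral (\<Sum>k\<le>M. (if k = 0 then 0 else pi / 2) * (norm (- c k * of_real (real k)))\<^sup>2)) {0..pi}"
    unfolding angular_error_deriv_def
    using has_integral_norm_sq_orthogonal_sum[of "{..M}" "\<lambda>k t. sin (real k * t)" "\<lambda>_. 1" "\<lambda>k. if k = 0 then 0 else pi / 2" "{0..pi}" "\<lambda>k. - c k * of_real (real k)"]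
      sin_orthogonal by simp
  have "norm (z * osc_integral z (cheb_sum c M 0)) \<le> sqrt (\<Sum>k\<le>M. (if k = 0 then 0 else pi / 2) * (norm (- c k * of_real (real k)))\<^sup>2)
      * sqrt (exp (8 * \<mu> + 4) * (3 * pi / sqrt \<tau>))"
    unfolding \<tau>_def
  proof (rule norm_integral_product_le[OF continuous_angular(2) _ _ _ A, where w = "\<lambda>_. 1"])
    show "((\<lambda>t. angular_error_deriv t * exp (of_real (1 + cos t) * z) * of_real 1) has_integral z * osc_integral z (cheb_sum c M 0)) {0..pi}"
      using error_angular_by_parts by (simp add: angular_kernel_def)
    show "integral {0..pi} (\<lambda>t. exp (2 * Re z * (1 + cos t)) * 1\<^sup>2) \<le> exp (8 * \<mu> + 4) * (3 * pi / sqrt (1 + \<bar>Re z\<bar>))"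
      using exp_cos_integrals(1)[OF z, of 2] by simp
  qed (auto intro!: continuous_intros)
  also have "\<dots> \<le> sqrt (pi * (\<Sum>k\<le>M. (real k)\<^sup>2 * (norm (c k))\<^sup>2)) * sqrt (exp (8 * \<mu> + 4) * (3 * pi / sqrt \<tau>))"
    unfolding sum_distrib_left
    by (intro mult_right_mono real_sqrt_le_mono sum_mono)
      (auto simp: \<tau>_def norm_mult power_mult_distrib mult_ac)
  finally show ?thesis by (simp add: norm_mult)
qed

text \<open>The derivative of the error in \<open>t\<close> is \<open>- sin t * H\<close> with \<open>H\<close> the derivative in \<open>s\<close>, so the integral
  obtained from the first integration by parts again contains the derivative of the kernel.  Now the
  boundary terms survive, and \<open>H\<close> has size \<open>\<Sum>k\<^sup>2 |c\<^sub>k|\<close> there; its derivative in \<open>t\<close> is bounded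
  by \<open>\<Sum>k\<^sup>3 |c\<^sub>k|\<close>.\<close>

lemma oscillatory_bound_two_parts:
  defines "\<tau> \<equiv> 1 + \<bar>Re z\<bar>"
  shows "(norm z)\<^sup>2 * norm (osc_integral z (cheb_sum c M 0))
    \<le> exp (8 * \<mu> + 4) * (2 * (\<Sum>k\<le>M. real k ^ 2 * norm (c k)) + 3 * pi / sqrt \<tau> * (\<Sum>k\<le>M. real k ^ 3 * norm (c k)))"
proof -
  define H where "H t = (\<Sum>k\<le>M. c k * of_real (poly (pderiv (cheb k)) (cos t)))" for t
  define H' where "H' t = (\<Sum>k\<le>M. c k * of_real (- sin t * poly (pderiv (pderiv (cheb k))) (cos t)))" for t
  define K where "K = exp (8 * \<mu> + 4)"
  define X2 where "X2 = (\<Sum>k\<le>M. real k ^ 2 * norm (c k))"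
  define X3 where "X3 = (\<Sum>k\<le>M. real k ^ 3 * norm (c k))"
  have "X3 \<ge> 0" unfolding X3_def by (intro sum_nonneg) auto
  have contH': "continuous_on S H'" for S unfolding H'_def by (intro continuous_intros)
  have dH: "(H has_vector_derivative H' t) (at t within S)" for t S
    unfolding H_def[abs_def] H'_def
    by (intro has_vector_derivative_sum has_vector_derivative_mult_right has_vector_derivative_of_real poly_cos_DERIV)
  have deriv_H: "angular_error_deriv t = - of_real (sin t) * H t" for t
  proof -
    have "angular_error_deriv t = (\<Sum>k\<le>M. - c k * of_real (real k * sin (real k * t)))"
      by (simp add: angular_error_deriv_def mult_ac)
    also have "\<dots> = - of_real (sin t) * H t"
      unfolding sin_pderiv_cheb_cos[symmetric] H_def by (simp add: sum_distrib_left sum_negf mult_ac)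
    finally show ?thesis .
  qed
  have "((\<lambda>t. H t * (- of_real (sin t) * z * angular_kernel t) + H' t * angular_kernel t) has_integral (H pi * angular_kernel pi - H 0 * angular_kernel 0)) {0..pi}"
    by (rule fundamental_theorem_of_calculus, simp, intro has_vector_derivative_mult dH angular_kernel_has_deriv)
  then have 1: "((\<lambda>t. z * (angular_error_deriv t * angular_kernel t) + H' t * angular_kernel t) has_integral (H pi * angular_kernel pi - H 0 * angular_kernel 0)) {0..pi}"
    unfolding deriv_H by (simp add: mult_ac)
  have "((\<lambda>t. H' t * angular_kernel t) has_integral (H pi * angular_kernel pi - H 0 * angular_kernel 0 - z * (z * osc_integral z (cheb_sum c M 0)))) {0..pi}"
    using has_integral_diff[OF 1 has_integral_mult_right[OF error_angular_by_parts, of z]] by simp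
  then have parts: "z\<^sup>2 * osc_integral z (cheb_sum c M 0) = H pi * angular_kernel pi - H 0 * angular_kernel 0 - integral {0..pi} (\<lambda>t. H' t * angular_kernel t)"
    by (simp add: integral_unique power2_eq_square)
  have Hend: "norm (H t) \<le> X2" if "t = 0 \<or> t = pi" for t
    unfolding H_def X2_def
  proof (rule sum_norm_le)
    fix k
    have "\<bar>poly (pderiv (cheb k)) (cos t)\<bar> = (real k)\<^sup>2" using that by (intro abs_pderiv_cheb_endpoint) auto
    then show "norm (c k * of_real (poly (pderiv (cheb k)) (cos t))) \<le> real k ^ 2 * norm (c k)"
      by (simp add: norm_mult)
  qed
  have H'b: "norm (H' t) \<le> X3" for t
    unfolding H'_def X3_def
  proof (rule sum_norm_le)
    fix k
    show "norm (c k * of_real (- sin t * poly (pderiv (pderiv (cheb k))) (cos t))) \<le> real k ^ 3 * norm (c k)"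
      using mult_left_mono[OF abs_sin_pderiv2_cheb[of t k], of "norm (c k)"] by (simp add: norm_mult abs_mult mult_ac)
  qed
  have kernel_norm: "norm (angular_kernel t) = exp (1 * Re z * (1 + cos t))" for t
    by (simp add: angular_kernel_def norm_exp_eq_Re mult.commute)
  have kernel_end: "norm (angular_kernel t) \<le> K" if "t = 0 \<or> t = pi" for t
  proof -
    have "Re z * (1 + cos t) \<le> 8 * \<mu> + 4" using that z by auto
    then show ?thesis unfolding kernel_norm K_def by simp
  qed
  have "norm (integral {0..pi} (\<lambda>t. H' t * angular_kernel t)) \<le> integral {0..pi} (\<lambda>t. X3 * exp (1 * Re z * (1 + cos t)))"
  proof (rule integral_norm_bound_integral)
    show "(\<lambda>t. H' t * angular_kernel t) integrable_on {0..pi}"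
      by (intro integrable_continuous_real continuous_intros contH' continuous_angular)
    show "(\<lambda>t. X3 * exp (1 * Re z * (1 + cos t))) integrable_on {0..pi}"
      by (intro integrable_continuous_real continuous_intros)
    show "norm (H' t * angular_kernel t) \<le> X3 * exp (1 * Re z * (1 + cos t))" for t
      unfolding norm_mult kernel_norm by (intro mult_right_mono H'b) auto
  qed
  also have "\<dots> = X3 * integral {0..pi} (\<lambda>t. exp (1 * Re z * (1 + cos t)))" by (rule integral_mult_right)
  also have "\<dots> \<le> X3 * (K * (3 * pi / sqrt \<tau>))"
    unfolding K_def \<tau>_def using \<open>X3 \<ge> 0\<close> by (intro mult_left_mono exp_cos_integrals(1)[OF z]) auto
  finally have int: "norm (integral {0..pi} (\<lambda>t. H' t * angular_kernel t)) \<le> X3 * (K * (3 * pi / sqrt \<tau>))" .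
  have b1: "norm (H pi * angular_kernel pi) \<le> X2 * K" "norm (H 0 * angular_kernel 0) \<le> X2 * K"
    unfolding norm_mult by (intro mult_mono Hend kernel_end; auto intro: order_trans[OF norm_ge_zero Hend[of 0]])+
  have "(norm z)\<^sup>2 * norm (osc_integral z (cheb_sum c M 0)) = norm (H pi * angular_kernel pi - H 0 * angular_kernel 0 - integral {0..pi} (\<lambda>t. H' t * angular_kernel t))"
    unfolding parts[symmetric] by (simp add: norm_mult norm_power)
  also have "\<dots> \<le> norm (H pi * angular_kernel pi) + norm (H 0 * angular_kernel 0) + norm (integral {0..pi} (\<lambda>t. H' t * angular_kernel t))"
    by (intro order_trans[OF norm_triangle_ineq4] add_mono norm_triangle_ineq4 order_refl)
  also have "\<dots> \<le> X2 * K + X2 * K + X3 * (K * (3 * pi / sqrt \<tau>))"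
    by (intro add_mono b1 int)
  also have "\<dots> = K * (2 * X2 + 3 * pi / sqrt \<tau> * X3)" by (simp add: algebra_simps)
  finally show ?thesis by (simp add: K_def X2_def X3_def)
qed

end

lemma cheb_energy_nonneg: "m \<ge> 1 \<Longrightarrow> cheb_energy a M m \<ge> 0"
  using rho_norm_cheb_sum[of m a M]
  by (intro has_integral_nonneg[OF integrable_integral[OF has_integral_integrable]]) (auto simp: rho_def)

lemma sqrt_coeff_energy_le:
  assumes "m \<ge> 1" "x \<ge> 0"
  shows "sqrt (x * coeff_energy m a M) \<le> sqrt x * (real m ^ m * sqrt (cheb_energy a M m))"
proof -
  have "coeff_energy m a M \<le> (real m ^ m * sqrt (cheb_energy a M m))\<^sup>2"
    using weighted_coefficients_le[OF assms(1), of a M] cheb_energy_nonneg[OF assms(1), of a M]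
    by (simp add: coeff_energy_def power_mult_distrib mult.commute[of 2 m] power_mult)
  then have "sqrt (x * coeff_energy m a M) \<le> sqrt (x * (real m ^ m * sqrt (cheb_energy a M m))\<^sup>2)"
    using assms(2) by (intro real_sqrt_le_mono mult_left_mono) auto
  then show ?thesis using cheb_energy_nonneg[OF assms(1), of a M] by (simp add: real_sqrt_mult)
qed

lemma sqrt_alias_error_energy_le:
  assumes m: "m \<ge> 1" and h: "L \<ge> 1" "m \<le> L + 1" "L \<le> M" "q \<le> 1"
  shows "sqrt (pi * (\<Sum>k\<le>M. real k ^ (2 * q) * (norm (alias_error_coeff L a M k))\<^sup>2))
    \<le> sqrt (3 * pi) * (real m ^ m * sqrt (cheb_energy a M m)) * (real L ^ q * real L powr (- real m))"
proof -
  define X where "X = (\<Sum>k\<le>M. real k ^ (2 * q) * (norm (alias_error_coeff L a M k))\<^sup>2)"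
  define D where "D = real L powr (- real m)"
  have D: "D > 0" "D * real L ^ m = 1" using h by (simp_all add: D_def powr_minus powr_realpow field_simps)
  have "X * (real L ^ m)\<^sup>2 \<le> 3 * (real L ^ q)\<^sup>2 * coeff_energy m a M"
    using alias_error_energy[OF h(1,3) m h(2,4), of a]
    by (simp add: X_def mult.commute[of 2 m] mult.commute[of 2 q] power_mult)
  then have "X * (real L ^ m)\<^sup>2 * D\<^sup>2 \<le> 3 * (real L ^ q)\<^sup>2 * coeff_energy m a M * D\<^sup>2"
    by (intro mult_right_mono) auto
  moreover have "(real L ^ m)\<^sup>2 * D\<^sup>2 = 1" using D(2) by (metis mult.commute power_mult_distrib power_one)
  ultimately have "X \<le> 3 * coeff_energy m a M * (real L ^ q * D)\<^sup>2"
    by (simp add: mult.assoc power_mult_distrib) (simp add: mult_ac)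
  then have "pi * X \<le> (3 * pi) * coeff_energy m a M * (real L ^ q * D)\<^sup>2"
    using mult_left_mono[of X "3 * coeff_energy m a M * (real L ^ q * D)\<^sup>2" pi] by (simp add: mult_ac)
  then have "sqrt (pi * X) \<le> sqrt ((3 * pi) * coeff_energy m a M * (real L ^ q * D)\<^sup>2)"
    by (rule real_sqrt_le_mono)
  also have "\<dots> = sqrt ((3 * pi) * coeff_energy m a M) * (real L ^ q * D)" using D(1) by (simp add: real_sqrt_mult)
  also have "\<dots> \<le> sqrt (3 * pi) * (real m ^ m * sqrt (cheb_energy a M m)) * (real L ^ q * D)"
    using D(1) by (intro mult_right_mono sqrt_coeff_energy_le m) auto
  finally show ?thesis by (simp add: X_def D_def)
qed

text \<open>One constant for the three bounds below, each of which is a coefficient bound times a bound for the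
  kernel; the summands are the three products of constants.\<close>

definition error_const :: "nat \<Rightarrow> real \<Rightarrow> real" where
  "error_const m \<mu> = exp (8 * \<mu> + 4) * (6 * pi) * real m ^ m
     + sqrt (3 * pi) * real m ^ m * (sqrt (216 * pi * exp (8 * \<mu> + 4)) + sqrt (3 * pi * exp (8 * \<mu> + 4)))"

lemma error_const_ge:
  fixes m :: nat and \<mu> :: real
  defines "K \<equiv> exp (8 * \<mu> + 4)"
  shows "sqrt (3 * pi) * real m ^ m * sqrt (216 * pi * K) \<le> error_const m \<mu>"
    "sqrt (3 * pi) * real m ^ m * sqrt (3 * pi * K) \<le> error_const m \<mu>"
    "K * (6 * pi) * real m ^ m \<le> error_const m \<mu>"
  by (simp_all add: error_const_def K_def distrib_left)

lemma error_const_pos: "m \<ge> 1 \<Longrightarrow> error_const m \<mu> > 0"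
  by (simp add: error_const_def add_pos_nonneg)

lemma cheb_sum_error_direct:
  assumes m: "m \<ge> 1" and \<mu>: "\<mu> > 0" and h: "L \<ge> 1" "m \<le> L + 1" "L \<le> M" "Re z \<le> \<mu>"
  shows "norm (quad_error L z (cheb_sum a M 0))
    \<le> error_const m \<mu> * real L powr (- real m) * (1 + \<bar>Re z\<bar>) powr (-(3/4)) * sqrt (cheb_energy a M m)"
  (is "?E \<le> _")
proof -
  define K where "K = exp (8 * \<mu> + 4)"
  have "K > 0" by (simp add: K_def)
  define c where "c = alias_error_coeff L a M"
  define \<tau> where "\<tau> = 1 + \<bar>Re z\<bar>"
  define D where "D = real L powr (- real m)"
  have "\<tau> > 0" by (simp add: \<tau>_def add_pos_nonneg)
  have "?E \<le> sqrt (pi * (\<Sum>k\<le>M. (norm (c k))\<^sup>2)) * sqrt (K * (72 / \<tau> * (3 * pi / sqrt \<tau>)))"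
    unfolding quadrature_error_cheb_sum[OF h(1,3)] c_def \<tau>_def K_def
    by (rule oscillatory_bound_direct[OF vanishing_at_endpoints[OF h(1,3)] h(4) \<mu>])
  also have "sqrt (K * (72 / \<tau> * (3 * pi / sqrt \<tau>))) = sqrt (216 * pi * K) * \<tau> powr (-(3/4))"
  proof -
    have "K * (72 / \<tau> * (3 * pi / sqrt \<tau>)) = (216 * pi * K) * \<tau> powr (-(3/2))"
      using \<open>\<tau> > 0\<close> powr_add[of \<tau> 1 "1/2"] by (simp add: powr_minus powr_half_sqrt field_simps)
    also have "\<tau> powr (-(3/2)) = (\<tau> powr (-(3/4)))\<^sup>2"
      by (simp add: power2_eq_square flip: powr_add)
    finally show ?thesis by (simp add: real_sqrt_mult)
  qed
  also have "sqrt (pi * (\<Sum>k\<le>M. (norm (c k))\<^sup>2)) \<le> sqrt (3 * pi) * (real m ^ m * sqrt (cheb_energy a M m)) * D"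
    using sqrt_alias_error_energy_le[OF m h(1,2,3), of 0 a] by (simp add: c_def D_def)
  finally have "?E \<le> sqrt (3 * pi) * (real m ^ m * sqrt (cheb_energy a M m)) * D * (sqrt (216 * pi * K) * \<tau> powr (-(3/4)))"
    using \<open>K > 0\<close> by (simp add: mult_right_mono)
  also have "\<dots> = (sqrt (3 * pi) * real m ^ m * sqrt (216 * pi * K)) * (D * \<tau> powr (-(3/4)) * sqrt (cheb_energy a M m))"
    by (simp only: mult_ac)
  also have "\<dots> \<le> error_const m \<mu> * (D * \<tau> powr (-(3/4)) * sqrt (cheb_energy a M m))"
    unfolding K_def using cheb_energy_nonneg[OF m, of a M] by (intro mult_right_mono error_const_ge) (simp add: D_def)
  finally show ?thesis by (simp add: D_def \<tau>_def mult_ac)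
qed

lemma cheb_sum_error_one_parts:
  assumes m: "m \<ge> 1" and \<mu>: "\<mu> > 0" and h: "L \<ge> 1" "m \<le> L + 1" "L \<le> M" "Re z \<le> \<mu>"
  shows "norm z * norm (quad_error L z (cheb_sum a M 0))
    \<le> error_const m \<mu> * real L powr (1 - real m) * (1 + \<bar>Re z\<bar>) powr (-(1/4)) * sqrt (cheb_energy a M m)"
  (is "?E \<le> _")
proof -
  define K where "K = exp (8 * \<mu> + 4)"
  have "K > 0" by (simp add: K_def)
  define c where "c = alias_error_coeff L a M"
  define \<tau> where "\<tau> = 1 + \<bar>Re z\<bar>"
  define D where "D = real L powr (1 - real m)"
  have "\<tau> > 0" by (simp add: \<tau>_def add_pos_nonneg)
  have "?E \<le> sqrt (pi * (\<Sum>k\<le>M. (real k)\<^sup>2 * (norm (c k))\<^sup>2)) * sqrt (K * (3 * pi / sqrt \<tau>))"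
    unfolding quadrature_error_cheb_sum[OF h(1,3)] c_def \<tau>_def K_def
    by (rule oscillatory_bound_one_parts[OF vanishing_at_endpoints[OF h(1,3)] h(4) \<mu>])
  also have "sqrt (K * (3 * pi / sqrt \<tau>)) = sqrt (3 * pi * K) * \<tau> powr (-(1/4))"
  proof -
    have "K * (3 * pi / sqrt \<tau>) = (3 * pi * K) * \<tau> powr (-(1/2))"
      using \<open>\<tau> > 0\<close> by (simp add: powr_minus powr_half_sqrt field_simps)
    also have "\<tau> powr (-(1/2)) = (\<tau> powr (-(1/4)))\<^sup>2"
      by (simp add: power2_eq_square flip: powr_add)
    finally show ?thesis by (simp add: real_sqrt_mult)
  qed
  also have "sqrt (pi * (\<Sum>k\<le>M. (real k)\<^sup>2 * (norm (c k))\<^sup>2)) \<le> sqrt (3 * pi) * (real m ^ m * sqrt (cheb_energy a M m)) * D"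
  proof -
    have "real L ^ 1 * real L powr (- real m) = D"
      unfolding D_def using h(1) by (simp add: powr_diff powr_minus field_simps)
    then show ?thesis using sqrt_alias_error_energy_le[OF m h(1,2,3), of 1 a] by (simp add: c_def)
  qed
  finally have "?E \<le> sqrt (3 * pi) * (real m ^ m * sqrt (cheb_energy a M m)) * D * (sqrt (3 * pi * K) * \<tau> powr (-(1/4)))"
    using \<open>K > 0\<close> by (simp add: mult_right_mono)
  also have "\<dots> = (sqrt (3 * pi) * real m ^ m * sqrt (3 * pi * K)) * (D * \<tau> powr (-(1/4)) * sqrt (cheb_energy a M m))"
    by (simp only: mult_ac)
  also have "\<dots> \<le> error_const m \<mu> * (D * \<tau> powr (-(1/4)) * sqrt (cheb_energy a M m))"
    unfolding K_def using cheb_energy_nonneg[OF m, of a M] by (intro mult_right_mono error_const_ge) (simp add: D_def)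
  finally show ?thesis by (simp add: D_def \<tau>_def mult_ac)
qed

lemma cheb_sum_error_two_parts:
  assumes m: "m \<ge> 1" and \<mu>: "\<mu> > 0" and h: "L \<ge> 1" "m \<le> L + 1" "L \<le> M" "Re z \<le> \<mu>" "m \<ge> 4"
  shows "(norm z)\<^sup>2 * norm (quad_error L z (cheb_sum a M 0))
    \<le> error_const m \<mu> * real L powr (5/2 - real m) * (1 + (1 + \<bar>Re z\<bar>) powr (-(1/2)) * real L) * sqrt (cheb_energy a M m)"
  (is "?E \<le> _")
proof -
  define K where "K = exp (8 * \<mu> + 4)"
  have "K > 0" by (simp add: K_def)
  define c where "c = alias_error_coeff L a M"
  define \<tau> where "\<tau> = 1 + \<bar>Re z\<bar>"
  define D where "D = real L powr (- real m)"
  define w where "w = real m ^ m * sqrt (cheb_energy a M m)"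
  have "w \<ge> 0" using cheb_energy_nonneg[OF m, of a M] by (simp add: w_def)
  have "\<tau> > 0" by (simp add: \<tau>_def add_pos_nonneg)
  have D: "D > 0" "D * real L ^ m = 1" using h by (simp_all add: D_def powr_minus powr_realpow field_simps)
  have X: "(\<Sum>k\<le>M. real k ^ p * norm (c k)) \<le> 2 * real L powr (real p + 1/2 - real m) * w" if p: "p + 1 \<le> m" for p
  proof -
    have "(\<Sum>k\<le>M. real k ^ p * norm (c k)) * real L ^ m \<le> 2 * sqrt (real L ^ (2 * p + 1) * coeff_energy m a M)"
      unfolding c_def by (rule alias_error_weighted_l1[OF h(1,3,2) p])
    also have "\<dots> \<le> 2 * (sqrt (real L ^ (2 * p + 1)) * w)"
      unfolding w_def by (intro mult_left_mono sqrt_coeff_energy_le m) auto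
    also have "sqrt (real L ^ (2 * p + 1)) = real L powr (real p + 1/2)"
    proof -
      have "real L ^ (2 * p + 1) = real L powr (2 * real p + 1)" using h(1) powr_realpow[of "real L" "2 * p + 1"] by (simp add: add.commute)
      also have "\<dots> = (real L powr (real p + 1/2))\<^sup>2" by (simp add: power2_eq_square flip: powr_add)
      finally show ?thesis by simp
    qed
    finally have "(\<Sum>k\<le>M. real k ^ p * norm (c k)) * real L ^ m * D \<le> 2 * (real L powr (real p + 1/2) * w) * D"
      using D(1) by (intro mult_right_mono) auto
    also have "(\<Sum>k\<le>M. real k ^ p * norm (c k)) * real L ^ m * D = (\<Sum>k\<le>M. real k ^ p * norm (c k))"
      using D(2) by (simp add: mult.assoc mult.commute[of D])
    also have "2 * (real L powr (real p + 1/2) * w) * D = 2 * real L powr (real p + 1/2 - real m) * w"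
    proof -
      have "real L powr (real p + 1/2) * D = real L powr (real p + 1/2 - real m)"
        unfolding D_def by (simp flip: powr_add)
      moreover have "2 * (real L powr (real p + 1/2) * w) * D = 2 * (real L powr (real p + 1/2) * D) * w"
        by (simp only: mult_ac)
      ultimately show ?thesis by simp
    qed
    finally show ?thesis .
  qed
  have "?E \<le> K * (2 * (\<Sum>k\<le>M. real k ^ 2 * norm (c k)) + 3 * pi / sqrt \<tau> * (\<Sum>k\<le>M. real k ^ 3 * norm (c k)))"
    unfolding quadrature_error_cheb_sum[OF h(1,3)] c_def \<tau>_def K_def
    by (rule oscillatory_bound_two_parts[OF vanishing_at_endpoints[OF h(1,3)] h(4) \<mu>])
  also have "\<dots> \<le> K * (2 * (2 * real L powr (5/2 - real m) * w) + 3 * pi / sqrt \<tau> * (2 * real L powr (7/2 - real m) * w))"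
    using X[of 2] X[of 3] h(5) \<open>K > 0\<close> \<open>\<tau> > 0\<close> by (intro mult_left_mono add_mono) auto
  also have "real L powr (7/2 - real m) = real L powr (5/2 - real m) * real L"
  proof -
    have "real L powr (5/2 - real m) * real L powr 1 = real L powr (5/2 - real m + 1)"
      by (simp only: powr_add)
    then show ?thesis using h(1) by simp
  qed
  also have "K * (2 * (2 * real L powr (5/2 - real m) * w) + 3 * pi / sqrt \<tau> * (2 * (real L powr (5/2 - real m) * real L) * w))
    = K * real L powr (5/2 - real m) * w * (4 + 6 * pi * (1 / sqrt \<tau> * real L))" by (simp add: algebra_simps)
  also have "\<dots> \<le> K * real L powr (5/2 - real m) * w * (6 * pi * (1 + 1 / sqrt \<tau> * real L))"
    using \<open>K > 0\<close> \<open>w \<ge> 0\<close> pi_ge_two by (intro mult_left_mono) (auto simp: algebra_simps)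
  also have "1 / sqrt \<tau> = \<tau> powr (-(1/2))" using \<open>\<tau> > 0\<close> by (simp add: powr_minus powr_half_sqrt inverse_eq_divide)
  also have "K * real L powr (5/2 - real m) * w * (6 * pi * (1 + \<tau> powr (-(1/2)) * real L))
    = (K * (6 * pi) * real m ^ m) * (real L powr (5/2 - real m) * (1 + \<tau> powr (-(1/2)) * real L) * sqrt (cheb_energy a M m))"
    by (simp only: w_def mult_ac)
  also have "\<dots> \<le> error_const m \<mu> * (real L powr (5/2 - real m) * (1 + \<tau> powr (-(1/2)) * real L) * sqrt (cheb_energy a M m))"
    unfolding K_def using cheb_energy_nonneg[OF m, of a M] by (intro mult_right_mono error_const_ge) simp
  finally show ?thesis by (simp only: \<tau>_def mult_ac)
qed

section \<open>Approximation of admissible functions by polynomials\<close>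

lemma nth_vderiv_0 [simp]: "nth_vderiv 0 f = f"
  by (simp add: nth_vderiv_def)

lemma nth_vderiv_Suc: "nth_vderiv (Suc k) f x = vector_derivative (nth_vderiv k f) (at x)"
  by (simp add: nth_vderiv_def)

lemma admissible_derivative:
  assumes "admissible m f" "k < m - 1" "x \<in> {0<..<2}"
  shows "(nth_vderiv k f has_vector_derivative nth_vderiv (Suc k) f x) (at x)"
  using assms unfolding admissible_def nth_vderiv_Suc vector_derivative_works by blast

lemma admissible_FTC:
  assumes "admissible m f" "m \<ge> 1" "0 < a" "a \<le> b" "b < 2"
  shows "(nth_vderiv m f has_integral (nth_vderiv (m - 1) f b - nth_vderiv (m - 1) f a)) {a..b}"
proof -
  have ac: "abs_continuous_on_interval a b (nth_vderiv (m - 1) f)"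
    using assms unfolding admissible_def loc_abs_continuous_def by blast
  obtain N where N: "negligible N" "\<And>x. x \<in> {a<..<b} - N \<Longrightarrow> nth_vderiv (m - 1) f differentiable (at x)"
    using abs_continuous_differentiable_ae[OF ac] by blast
  have "nth_vderiv m f x = vector_derivative (nth_vderiv (m - 1) f) (at x)" for x
    using nth_vderiv_Suc[of "m - 1" f x] assms(2) by simp
  then show ?thesis
    using N(2) by (intro abs_continuous_FTC[OF assms(4) ac N(1)]) (simp add: vector_derivative_works)
qed

lemma dilation_derivative:
  assumes "admissible m f" "k < m - 1" "s \<in> {0..2}" "0 < r" "r < 1"
  shows "((\<lambda>s. of_real (r ^ k) * nth_vderiv k f (1 + r * (s - 1))) has_vector_derivative
     of_real (r ^ Suc k) * nth_vderiv (Suc k) f (1 + r * (s - 1))) (at s)"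
proof -
  have "r * (s - 1) \<le> r * 1" "r * (- 1) \<le> r * (s - 1)" by (rule mult_left_mono; use assms in simp)+
  then have in02: "1 + r * (s - 1) \<in> {0<..<2}"
    unfolding greaterThanLessThan_iff using assms(4,5) by (intro conjI; linarith)
  have "((\<lambda>s. 1 + r * (s - 1)) has_vector_derivative r) (at s)"
    by (auto intro!: derivative_eq_intros simp flip: has_real_derivative_iff_has_vector_derivative)
  from vector_diff_chain_at[OF this admissible_derivative[OF assms(1,2) in02]]
  have "((\<lambda>s. nth_vderiv k f (1 + r * (s - 1))) has_vector_derivative r *\<^sub>R nth_vderiv (Suc k) f (1 + r * (s - 1))) (at s)"
    by (simp add: o_def)
  from has_vector_derivative_mult_right[OF this, of "of_real (r ^ k)"]
  show ?thesis by (simp add: scaleR_conv_of_real mult_ac)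
qed

lemma has_integral_dilation:
  fixes g :: "real \<Rightarrow> 'a::real_normed_vector"
  assumes "(g has_integral i) {1 + r * (a - 1)..1 + r * (b - 1)}" "r > 0" "a \<le> b"
  shows "((\<lambda>s. g (1 + r * (s - 1))) has_integral (1 / r) *\<^sub>R i) {a..b}"
proof -
  have "((\<lambda>s. g (r *\<^sub>R s + (1 - r))) has_integral (1 / \<bar>r\<bar> ^ DIM(real)) *\<^sub>R i)
     ((\<lambda>s. (1 / r) *\<^sub>R s + - ((1 / r) *\<^sub>R (1 - r))) ` cbox (1 + r * (a - 1)) (1 + r * (b - 1)))"
    using assms by (intro has_integral_affinity) auto
  moreover have "(\<lambda>s. (1 / r) *\<^sub>R s + - ((1 / r) *\<^sub>R (1 - r))) ` cbox (1 + r * (a - 1)) (1 + r * (b - 1)) = {a..b}"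
  proof -
    have "(\<lambda>s. (1 / r) *\<^sub>R s + - ((1 / r) *\<^sub>R (1 - r))) = (\<lambda>s. (1 / r) * s + (1 - 1 / r))"
      using assms by (auto simp: field_simps)
    moreover have "(\<lambda>s. (1 / r) * s + (1 - 1 / r)) ` {1 + r * (a - 1)..1 + r * (b - 1)}
      = {(1 / r) * (1 + r * (a - 1)) + (1 - 1 / r)..(1 / r) * (1 + r * (b - 1)) + (1 - 1 / r)}"
      using assms by (subst image_affinity_atLeastAtMost) auto
    ultimately show ?thesis using assms by (simp add: field_simps)
  qed
  moreover have "g (r *\<^sub>R s + (1 - r)) = g (1 + r * (s - 1))" for s by (simp add: algebra_simps)
  ultimately show ?thesis using assms by simp
qed

lemma dilation_FTC:
  assumes "admissible m f" "m \<ge> 1" "0 < r" "r < 1" "0 \<le> a" "a \<le> b" "b \<le> 2"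
  shows "((\<lambda>s. of_real (r ^ m) * nth_vderiv m f (1 + r * (s - 1))) has_integral
     (of_real (r ^ (m - 1)) * nth_vderiv (m - 1) f (1 + r * (b - 1)) - of_real (r ^ (m - 1)) * nth_vderiv (m - 1) f (1 + r * (a - 1)))) {a..b}"
proof -
  have "r * (- 1) \<le> r * (a - 1)" "r * (a - 1) \<le> r * (b - 1)" "r * (b - 1) \<le> r * 1"
    by (rule mult_left_mono; use assms in simp)+
  then have "(nth_vderiv m f has_integral (nth_vderiv (m - 1) f (1 + r * (b - 1)) - nth_vderiv (m - 1) f (1 + r * (a - 1)))) {1 + r * (a - 1)..1 + r * (b - 1)}"
    using assms(3,4) by (intro admissible_FTC assms(1,2); linarith)
  from has_integral_mult_right[OF has_integral_dilation[OF this assms(3,6)], of "of_real (r ^ m)"]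
  have "((\<lambda>s. of_real (r ^ m) * nth_vderiv m f (1 + r * (s - 1))) has_integral
     of_real (r ^ m) * ((1 / r) *\<^sub>R (nth_vderiv (m - 1) f (1 + r * (b - 1)) - nth_vderiv (m - 1) f (1 + r * (a - 1))))) {a..b}" .
  moreover have "of_real (r ^ m) * ((1 / r) *\<^sub>R w) = of_real (r ^ (m - 1)) * w" for w :: complex
  proof -
    have "r ^ m = r ^ (m - 1) * r" using assms(2) by (cases m) auto
    then show ?thesis using assms(3) by (simp add: scaleR_conv_of_real)
  qed
  ultimately show ?thesis by (simp only: right_diff_distrib[symmetric])
qed

lemma rho_nonneg: "rho m s \<ge> 0"
  by (simp add: rho_def)

lemma rho_le_1: "s \<in> {0..2} \<Longrightarrow> m \<ge> 1 \<Longrightarrow> rho m s \<le> 1"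
proof -
  assume s: "s \<in> {0..2}" and m: "m \<ge> 1"
  have "s * (2 - s) = 1 - (s - 1)\<^sup>2" by (simp add: power2_eq_square algebra_simps)
  then have "s * (2 - s) \<le> 1" by simp
  moreover have "0 \<le> s * (2 - s)" using s by simp
  ultimately show ?thesis unfolding rho_def using m by (intro powr_le1) auto
qed

text \<open>Moving towards the centre \<open>1\<close> increases the weight.\<close>

lemma rho_dilation_le:
  assumes "m \<ge> 1" "0 < r" "r < 1" "s \<in> {0..2}"
  shows "rho m s \<le> rho m (1 + r * (s - 1))"
proof -
  have "(r * (s - 1))\<^sup>2 \<le> (s - 1)\<^sup>2"
    using assms by (simp add: power_mult_distrib mult_left_le_one_le power_le_one)
  moreover have "s * (2 - s) = 1 - (s - 1)\<^sup>2" "(1 + r * (s - 1)) * (2 - (1 + r * (s - 1))) = 1 - (r * (s - 1))\<^sup>2"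
    by (simp_all add: power2_eq_square algebra_simps)
  ultimately have "s * (2 - s) \<le> (1 + r * (s - 1)) * (2 - (1 + r * (s - 1)))" by linarith
  moreover have "0 \<le> s * (2 - s)" using assms by simp
  ultimately show ?thesis unfolding rho_def using assms by (intro powr_mono2) auto
qed

lemma rho_norm_squared:
  assumes "rho_norm_finite m g"
  shows "(\<lambda>s. (norm (g s))\<^sup>2 * rho m s) absolutely_integrable_on {0..2}"
    "(rho_norm m g)\<^sup>2 = integral {0..2} (\<lambda>s. (norm (g s))\<^sup>2 * rho m s)"
proof -
  show ai: "(\<lambda>s. (norm (g s))\<^sup>2 * rho m s) absolutely_integrable_on {0..2}"
    using assms by (simp add: rho_norm_finite_def)
  have "integral {0..2} (\<lambda>s. (norm (g s))\<^sup>2 * rho m s) \<ge> 0"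
    by (rule integral_nonneg) (use ai in \<open>auto simp: rho_nonneg intro: set_lebesgue_integral_eq_integral(1)\<close>)
  then show "(rho_norm m g)\<^sup>2 = integral {0..2} (\<lambda>s. (norm (g s))\<^sup>2 * rho m s)"
    using set_lebesgue_integral_eq_integral(2)[OF ai] by (simp add: rho_norm_def)
qed

text \<open>After the substitution \<open>y = 1 + r (s - 1)\<close> the weight \<open>rho m s\<close> is at most \<open>rho m y\<close>, and the Jacobian
  together with the chain rule contributes \<open>r\<^sup>2\<^sup>m\<^sup>-\<^sup>1 \<le> 1\<close>.  The range of \<open>y\<close> stays away from \<open>0\<close> and
  \<open>2\<close>, where the weight degenerates, which gives integrability without weight.\<close>

lemma dilation_square_integrable:
  assumes adm: "admissible m f" and m: "m \<ge> 1" and r: "0 < r" "r < 1"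
    and fin: "rho_norm_finite m (nth_vderiv m f)"
  defines "U \<equiv> \<lambda>s. of_real (r ^ m) * nth_vderiv m f (1 + r * (s - 1))"
  shows "U \<in> borel_measurable (lebesgue_on {0..2})"
    "integrable (lebesgue_on {0..2}) (\<lambda>s. (norm (U s))\<^sup>2)"
    "integral {0..2} (\<lambda>s. (norm (U s))\<^sup>2 * rho m s) \<le> (rho_norm m (nth_vderiv m f))\<^sup>2"
    "(\<lambda>s. (norm (U s))\<^sup>2 * rho m s) integrable_on {0..2}"
proof -
  let ?g = "nth_vderiv m f"
  let ?J = "{1 - r..1 + r}"
  have J: "?J = {1 + r * (0 - 1)..1 + r * (2 - 1)}" by simp
  have JS: "?J \<in> sets lebesgue" by simp
  define F where "F y = (norm (?g y))\<^sup>2 * rho m y" for y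
  have gi: "?g integrable_on ?J" using admissible_FTC[OF adm m, of "1 - r" "1 + r"] r by auto
  then have gm: "?g \<in> borel_measurable (lebesgue_on ?J)" by (rule integrable_imp_measurable)
  then have g2m: "(\<lambda>y. (norm (?g y))\<^sup>2) \<in> borel_measurable (lebesgue_on ?J)" by measurable
  have Ui: "U integrable_on {0..2}" using dilation_FTC[OF adm m r, of 0 2] by (auto simp: U_def)
  show Um: "U \<in> borel_measurable (lebesgue_on {0..2})" by (rule integrable_imp_measurable[OF Ui])
  have F02: "F absolutely_integrable_on {0..2}" using rho_norm_squared(1)[OF fin] by (simp add: F_def[abs_def])
  have FJ: "F integrable_on ?J"
    by (rule integrable_on_subinterval[OF set_lebesgue_integral_eq_integral(1)[OF F02]]) (use r in auto)
  have F_nonneg: "F y \<ge> 0" for y by (simp add: F_def rho_nonneg)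
  have intFJ: "integral ?J F \<le> (rho_norm m ?g)\<^sup>2"
    unfolding rho_norm_squared(2)[OF fin] F_def[symmetric]
    by (rule integral_subset_le) (use FJ set_lebesgue_integral_eq_integral(1)[OF F02] F_nonneg r in auto)
  define F1 where "F1 y = (norm (?g y))\<^sup>2 * rho m (1 + (y - 1) / r)" for y
  have rho_comp: "continuous_on ?J (\<lambda>y. rho m (1 + (y - 1) / r))"
    by (rule continuous_on_compose2[OF rho_continuous[OF m]])
      (use r in \<open>auto intro!: continuous_intros simp: field_simps\<close>)
  have F1F: "F1 y \<le> F y" if "y \<in> ?J" for y
  proof -
    have s: "1 + (y - 1) / r \<in> {0..2}" using that r by (auto simp: field_simps)
    have "1 + r * (1 + (y - 1) / r - 1) = y" using r by simp
    then have "rho m (1 + (y - 1) / r) \<le> rho m y" using rho_dilation_le[OF m r s] by simp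
    then show ?thesis by (simp add: F1_def F_def mult_left_mono)
  qed
  have F1i: "F1 integrable_on ?J"
  proof (rule measurable_bounded_by_integrable_imp_integrable[OF _ FJ _ JS])
    show "F1 \<in> borel_measurable (lebesgue_on ?J)" unfolding F1_def
      by (intro borel_measurable_times g2m continuous_imp_measurable_on_sets_lebesgue[OF rho_comp JS])
    show "norm (F1 y) \<le> F y" if "y \<in> ?J" for y
      using F1F[OF that] by (simp add: F1_def rho_nonneg)
  qed
  have "((\<lambda>s. F1 (1 + r * (s - 1))) has_integral (1 / r) *\<^sub>R integral ?J F1) {0..2}"
    using integrable_integral[OF F1i] unfolding J by (rule has_integral_dilation) (use r in auto)
  from has_integral_mult_right[OF this, of "r ^ (2 * m)"]
  have U1: "((\<lambda>s. (norm (U s))\<^sup>2 * rho m s) has_integral r ^ (2 * m) * ((1 / r) *\<^sub>R integral ?J F1)) {0..2}"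
    using r by (simp add: U_def F1_def norm_mult norm_power power_mult_distrib mult.assoc mult.commute[of 2 m] power_mult)
  then show "(\<lambda>s. (norm (U s))\<^sup>2 * rho m s) integrable_on {0..2}" by blast
  have "r ^ (2 * m) * ((1 / r) *\<^sub>R integral ?J F1) = r ^ (2 * m - 1) * integral ?J F1"
    using r m by (cases m) (auto simp: field_simps)
  also have "\<dots> \<le> 1 * integral ?J F1"
    using r integral_nonneg[OF F1i] by (intro mult_right_mono power_le_one) (auto simp: F1_def rho_nonneg)
  also have "\<dots> \<le> integral ?J F" using integral_le[OF F1i FJ F1F] by simp
  finally show "integral {0..2} (\<lambda>s. (norm (U s))\<^sup>2 * rho m s) \<le> (rho_norm m ?g)\<^sup>2"
    using intFJ U1 by (simp add: integral_unique)
  define \<kappa> where "\<kappa> = (1 - r\<^sup>2) powr (real m - 1/2)"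
  have r2: "r\<^sup>2 < 1" using r by (simp add: power_less_one_iff abs_square_less_1)
  then have "\<kappa> > 0" by (simp add: \<kappa>_def)
  have \<kappa>: "\<kappa> \<le> rho m y" if "y \<in> ?J" for y
  proof -
    have "(y - 1)\<^sup>2 \<le> r\<^sup>2" using that r by (auto simp: abs_le_square_iff[symmetric])
    then have "1 - r\<^sup>2 \<le> y * (2 - y)" by (simp add: power2_eq_square algebra_simps)
    then show ?thesis unfolding \<kappa>_def rho_def using r2 m by (intro powr_mono2) auto
  qed
  have "(\<lambda>y. (norm (?g y))\<^sup>2) integrable_on ?J"
  proof (rule measurable_bounded_by_integrable_imp_integrable[OF g2m _ _ JS])
    show "(\<lambda>y. (1 / \<kappa>) * F y) integrable_on ?J" using FJ by (rule integrable_on_mult_right)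
    show "norm ((norm (?g y))\<^sup>2) \<le> (1 / \<kappa>) * F y" if "y \<in> ?J" for y
      using mult_left_mono[OF \<kappa>[OF that], of "(norm (?g y))\<^sup>2"] \<open>\<kappa> > 0\<close> by (simp add: F_def field_simps)
  qed
  then have "((\<lambda>s. (norm (?g (1 + r * (s - 1))))\<^sup>2) has_integral (1 / r) *\<^sub>R integral ?J (\<lambda>y. (norm (?g y))\<^sup>2)) {0..2}"
    using integrable_integral unfolding J by (intro has_integral_dilation) (use r in auto)
  from has_integral_mult_right[OF this, of "r ^ (2 * m)"]
  have "(\<lambda>s. (norm (U s))\<^sup>2) integrable_on {0..2}"
    using r by (auto simp: U_def norm_mult norm_power power_mult_distrib mult.commute[of 2 m] power_mult)
  then have "(\<lambda>s. (norm (U s))\<^sup>2) absolutely_integrable_on {0..2}"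
    by (intro nonnegative_absolutely_integrable_1) auto
  then show "integrable (lebesgue_on {0..2}) (\<lambda>s. (norm (U s))\<^sup>2)"
    by (rule absolutely_integrable_imp_integrable) simp
qed

text \<open>The retraction onto the closed disc of radius \<open>b\<close>, in a form whose continuity is evident.\<close>

definition radial_clip :: "real \<Rightarrow> complex \<Rightarrow> complex" where
  "radial_clip b w = (b / max b (norm w)) *\<^sub>R w"

lemma radial_clip_props:
  assumes "b > 0"
  shows "continuous_on S (radial_clip b)" "norm (radial_clip b w) \<le> b" "norm w \<le> b \<Longrightarrow> radial_clip b w = w" "norm (w - radial_clip b w) \<le> norm w"
proof -
  have pos: "max b (norm w) > 0" for w :: complex using assms by auto
  then have "max b (norm w) \<noteq> 0" for w :: complex by (metis less_irrefl)
  then show "continuous_on S (radial_clip b)" unfolding radial_clip_def by (intro continuous_intros) auto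
  show "norm (radial_clip b w) \<le> b"
    using pos[of w] assms by (simp add: radial_clip_def divide_le_eq mult_left_mono)
  show "norm w \<le> b \<Longrightarrow> radial_clip b w = w" using assms by (simp add: radial_clip_def max_absorb1)
  have "w - radial_clip b w = (1 - b / max b (norm w)) *\<^sub>R w" by (simp add: radial_clip_def algebra_simps)
  moreover have "0 \<le> 1 - b / max b (norm w)" "1 - b / max b (norm w) \<le> 1" using pos[of w] assms by (auto simp: divide_le_eq)
  ultimately show "norm (w - radial_clip b w) \<le> norm w" by (simp add: mult_left_le_one_le)
qed

text \<open>A free parameter \<open>\<kappa>\<close> keeps the factor of the main part close to \<open>1\<close>; this stands in for the
  triangle inequality of the weighted norm.\<close>

lemma norm_add_squared_le:
  fixes x y :: complex
  assumes "\<kappa> > 0"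
  shows "(norm (x + y))\<^sup>2 \<le> (1 + \<kappa>) * (norm x)\<^sup>2 + (1 + 1 / \<kappa>) * (norm y)\<^sup>2"
proof -
  have "(norm (x + y))\<^sup>2 \<le> (norm x + norm y)\<^sup>2" by (intro power_mono norm_triangle_ineq) auto
  also have "\<dots> = (norm x)\<^sup>2 + (norm y)\<^sup>2 + 2 * (norm x * norm y)" by (simp add: power2_eq_square algebra_simps)
  also have "2 * (norm x * norm y) \<le> \<kappa> * (norm x)\<^sup>2 + 1 / \<kappa> * (norm y)\<^sup>2"
  proof -
    have "0 \<le> (\<kappa> * norm x - norm y)\<^sup>2 / \<kappa>" using assms by simp
    also have "\<dots> = \<kappa> * (norm x)\<^sup>2 + 1 / \<kappa> * (norm y)\<^sup>2 - 2 * (norm x * norm y)"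
      using assms by (simp add: power2_eq_square field_simps)
    finally show ?thesis by simp
  qed
  finally show ?thesis by (simp add: algebra_simps)
qed

text \<open>Truncate \<open>U\<close> to be bounded, then replace it by truncated members of a sequence of continuous
  functions that converges to it almost everywhere; dominated convergence applies to both steps.\<close>

lemma continuous_dense_L2:
  fixes U :: "real \<Rightarrow> complex"
  defines "\<Omega> \<equiv> lebesgue_on {0..2}"
  assumes U: "U \<in> borel_measurable \<Omega>" and U2: "integrable \<Omega> (\<lambda>s. (norm (U s))\<^sup>2)" and "\<delta> > 0"
  obtains h where "continuous_on UNIV h" "integrable \<Omega> (\<lambda>s. (norm (U s - h s))\<^sup>2)"
    "integral\<^sup>L \<Omega> (\<lambda>s. (norm (U s - h s))\<^sup>2) < \<delta>"
proof -
  have \<Omega>fin: "finite_measure \<Omega>" unfolding \<Omega>_def by (rule finite_measure_lebesgue_on) auto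
  have clipm: "(\<lambda>s. radial_clip b (f s)) \<in> borel_measurable \<Omega>" if "b > 0" "f \<in> borel_measurable \<Omega>" for b f
    using measurable_compose[OF that(2) borel_measurable_continuous_onI[OF radial_clip_props(1)[OF that(1)]]] .
  define E where "E j s = (norm (U s - radial_clip (real (Suc j)) (U s)))\<^sup>2" for j s
  have Em: "E j \<in> borel_measurable \<Omega>" for j
    unfolding E_def using clipm[of "real (Suc j)" U] U by measurable
  have Eb: "E j s \<le> (norm (U s))\<^sup>2" for j s
    unfolding E_def by (intro power_mono radial_clip_props) auto
  have "(\<lambda>j. integral\<^sup>L \<Omega> (E j)) \<longlonglongrightarrow> integral\<^sup>L \<Omega> (\<lambda>s. 0)"
  proof (rule integral_dominated_convergence[OF _ Em U2])
    show "AE s in \<Omega>. (\<lambda>j. E j s) \<longlonglongrightarrow> 0"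
    proof (rule AE_I2)
      fix s
      obtain j0 where "norm (U s) < real j0" using reals_Archimedean2 by blast
      then have "\<forall>j\<ge>j0. E j s = 0" by (auto simp: E_def radial_clip_props(3))
      then show "(\<lambda>j. E j s) \<longlonglongrightarrow> 0" by (intro tendsto_eventually) (auto simp: eventually_sequentially)
    qed
    show "AE s in \<Omega>. norm (E j s) \<le> (norm (U s))\<^sup>2" for j
      using Eb by (intro AE_I2) (simp add: E_def)
  qed simp
  then have "(\<lambda>j. integral\<^sup>L \<Omega> (E j)) \<longlonglongrightarrow> 0" by simp
  then have "eventually (\<lambda>j. integral\<^sup>L \<Omega> (E j) < \<delta> / 4) sequentially"
    by (rule order_tendstoD(2)) (use \<open>\<delta> > 0\<close> in simp)
  then obtain j where j: "integral\<^sup>L \<Omega> (E j) < \<delta> / 4" by (auto simp: eventually_sequentially)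
  have Ei: "integrable \<Omega> (E j)"
    by (rule Bochner_Integration.integrable_bound[OF U2 Em]) (use Eb in \<open>auto simp: E_def\<close>)
  define b where "b = real (Suc j)"
  have "b > 0" by (simp add: b_def)
  have "U measurable_on {0..2}"
    using U unfolding \<Omega>_def by (subst measurable_on_iff_borel_measurable) auto
  then obtain N G where N: "negligible N" and Gc: "\<And>n. continuous_on UNIV (G n)"
    and G: "\<And>s. s \<notin> N \<Longrightarrow> (\<lambda>n. G n s) \<longlonglongrightarrow> (if s \<in> {0..2} then U s else 0)"
    unfolding measurable_on_def by blast
  have Gm: "G n \<in> borel_measurable \<Omega>" for n
    unfolding \<Omega>_def by (rule continuous_imp_measurable_on_sets_lebesgue[OF continuous_on_subset[OF Gc]]) auto
  define R where "R n s = (norm (radial_clip b (U s) - radial_clip b (G n s)))\<^sup>2" for n s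
  have Rm: "R n \<in> borel_measurable \<Omega>" for n
    unfolding R_def using clipm[OF \<open>b > 0\<close> U] clipm[OF \<open>b > 0\<close> Gm[of n]] by measurable
  have Rb: "R n s \<le> (2 * b)\<^sup>2" for n s
    unfolding R_def
    using norm_triangle_ineq4[of "radial_clip b (U s)" "radial_clip b (G n s)"] radial_clip_props(2)[OF \<open>b > 0\<close>, of "U s"] radial_clip_props(2)[OF \<open>b > 0\<close>, of "G n s"]
    by (intro power_mono) (linarith, simp)
  have const: "integrable \<Omega> (\<lambda>s. (2 * b)\<^sup>2)" using \<Omega>fin by (rule finite_measure.integrable_const)
  have "(\<lambda>n. integral\<^sup>L \<Omega> (R n)) \<longlonglongrightarrow> integral\<^sup>L \<Omega> (\<lambda>s. 0)"
  proof (rule integral_dominated_convergence[OF _ Rm const])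
    have "AE s in \<Omega>. s \<notin> N"
    proof (rule AE_I'[of "N \<inter> {0..2}"])
      show "N \<inter> {0..2} \<in> null_sets \<Omega>"
        unfolding \<Omega>_def using N negligible_Int[of N "{0..2}"]
        by (auto simp: null_sets_restrict_space negligible_iff_null_sets)
    qed (auto simp: \<Omega>_def)
    moreover have "AE s in \<Omega>. s \<in> {0..2}" unfolding \<Omega>_def by (rule AE_I2) simp
    ultimately show "AE s in \<Omega>. (\<lambda>n. R n s) \<longlonglongrightarrow> 0"
    proof eventually_elim
      case (elim s)
      then have "(\<lambda>n. G n s) \<longlonglongrightarrow> U s" using G[of s] by simp
      then have "(\<lambda>n. radial_clip b (G n s)) \<longlonglongrightarrow> radial_clip b (U s)"
        by (rule continuous_on_tendsto_compose[OF radial_clip_props(1)[OF \<open>b > 0\<close>, of UNIV]]) auto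
      then have "(\<lambda>n. R n s) \<longlonglongrightarrow> (norm (radial_clip b (U s) - radial_clip b (U s)))\<^sup>2"
        unfolding R_def by (intro tendsto_intros)
      then show ?case by simp
    qed
    show "AE s in \<Omega>. norm (R n s) \<le> (2 * b)\<^sup>2" for n using Rb by (intro AE_I2) (simp add: R_def)
  qed simp
  then have "(\<lambda>n. integral\<^sup>L \<Omega> (R n)) \<longlonglongrightarrow> 0" by simp
  then have "eventually (\<lambda>n. integral\<^sup>L \<Omega> (R n) < \<delta> / 4) sequentially"
    by (rule order_tendstoD(2)) (use \<open>\<delta> > 0\<close> in simp)
  then obtain n where n: "integral\<^sup>L \<Omega> (R n) < \<delta> / 4" by (auto simp: eventually_sequentially)
  have Ri: "integrable \<Omega> (R n)"
    by (rule Bochner_Integration.integrable_bound[OF const Rm]) (use Rb in \<open>auto simp: R_def\<close>)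
  define h where "h s = radial_clip b (G n s)" for s
  have hc: "continuous_on UNIV h" unfolding h_def
    by (rule continuous_on_compose2[OF radial_clip_props(1)[OF \<open>b > 0\<close>] Gc]) auto
  have hm: "(\<lambda>s. (norm (U s - h s))\<^sup>2) \<in> borel_measurable \<Omega>"
    unfolding h_def using U clipm[OF \<open>b > 0\<close> Gm[of n]] by measurable
  have le: "(norm (U s - h s))\<^sup>2 \<le> 2 * E j s + 2 * R n s" for s
    using norm_add_squared_le[of 1 "U s - radial_clip b (U s)" "radial_clip b (U s) - h s"]
    by (simp add: E_def R_def h_def b_def)
  have sumi: "integrable \<Omega> (\<lambda>s. 2 * E j s + 2 * R n s)" using Ei Ri by simp
  have hi: "integrable \<Omega> (\<lambda>s. (norm (U s - h s))\<^sup>2)"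
    by (rule Bochner_Integration.integrable_bound[OF sumi hm]) (use le in \<open>auto intro!: AE_I2 order_trans[OF le]\<close>)
  have "integral\<^sup>L \<Omega> (\<lambda>s. (norm (U s - h s))\<^sup>2) \<le> integral\<^sup>L \<Omega> (\<lambda>s. 2 * E j s + 2 * R n s)"
    by (rule integral_mono[OF hi sumi]) (rule le)
  also have "\<dots> < \<delta>" using j n Ei Ri by simp
  finally show ?thesis by (intro that[OF hc hi])
qed

lemma real_polynomial_dense:
  fixes h :: "real \<Rightarrow> real"
  assumes "continuous_on {0..2} h" "\<delta> > 0"
  obtains q :: "real poly" where "\<And>s. s \<in> {0..2} \<Longrightarrow> \<bar>h s - poly q (s - 1)\<bar> < \<delta>"
proof -
  obtain g where g: "real_polynomial_function g" "\<And>s. s \<in> {0..2} \<Longrightarrow> \<bar>h s - g s\<bar> < \<delta>"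
    using Stone_Weierstrass_real_polynomial_function[OF compact_Icc assms] by blast
  then obtain a n where "g = (\<lambda>x. \<Sum>i\<le>n. a i * x ^ i)" by (auto simp: real_polynomial_function_iff_sum)
  then have "g s = poly (pcompose (\<Sum>i\<le>n. monom (a i) i) [:1, 1:]) (s - 1)" for s
    by (simp add: poly_pcompose poly_sum poly_monom)
  then show ?thesis using g(2) by (intro that) auto
qed

lemma pderiv_sum: "pderiv (sum p A) = (\<Sum>i\<in>A. pderiv (p i :: real poly))"
  by (induction A rule: infinite_finite_induct) (simp_all add: pderiv_add)

lemma poly_antiderivative: "\<exists>Q. pderiv Q = (q :: real poly) \<and> poly Q 0 = v"
proof -
  define R where "R = (\<Sum>i\<le>degree q. monom (coeff q i / real (Suc i)) (Suc i))"
  have "pderiv R = (\<Sum>i\<le>degree q. monom (coeff q i) i)"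
    by (simp add: R_def pderiv_sum pderiv_monom del: of_nat_Suc)
  then have "pderiv R = q" by (simp add: poly_as_sum_of_monoms)
  then show ?thesis by (intro exI[of _ "R + [:v - poly R 0:]"]) (simp add: pderiv_add pderiv_pCons)
qed

lemma poly_iterated_antiderivative:
  "\<exists>Q. (pderiv ^^ m) Q = (q :: real poly) \<and> (\<forall>k<m. poly ((pderiv ^^ k) Q) 0 = v k)"
proof (induction m arbitrary: v)
  case (Suc m)
  obtain Q1 where Q1: "(pderiv ^^ m) Q1 = q" "\<forall>k<m. poly ((pderiv ^^ k) Q1) 0 = v (Suc k)"
    using Suc.IH[of "\<lambda>k. v (Suc k)"] by blast
  obtain Q where Q: "pderiv Q = Q1" "poly Q 0 = v 0" using poly_antiderivative by blast
  have "(pderiv ^^ Suc k) Q = (pderiv ^^ k) Q1" for k by (simp add: funpow_Suc_right Q del: funpow.simps)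
  moreover have "poly ((pderiv ^^ k) Q) 0 = v k" if "k < Suc m" for k
    using that Q1(2) Q(2) calculation by (cases k) auto
  ultimately show ?case using Q1(1) by blast
qed simp

lemma funpow_pderiv_sum_smult:
  "(pderiv ^^ k) (\<Sum>n\<in>A. smult (b n) (p n)) = (\<Sum>n\<in>A. smult (b n) ((pderiv ^^ k) (p n :: real poly)))"
  by (induction k) (simp_all add: pderiv_sum pderiv_smult)

text \<open>Real and imaginary parts are approximated separately; together they are one Chebyshev expansion
  with complex coefficients.\<close>

lemma cheb_sum_of_polys:
  fixes P Q :: "real poly"
  obtains a M where "M \<ge> L" "\<And>k s. cheb_sum a M k s = of_real (poly ((pderiv ^^ k) P) (s - 1)) + \<i> * of_real (poly ((pderiv ^^ k) Q) (s - 1))"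
proof -
  define M where "M = max L (max (degree P) (degree Q))"
  have deg: "degree P \<le> M" "degree Q \<le> M" by (simp_all add: M_def)
  obtain b where b: "P = (\<Sum>n\<le>M. smult (b n) (cheb n))" using cheb_span[OF deg(1)] by blast
  obtain b' where b': "Q = (\<Sum>n\<le>M. smult (b' n) (cheb n))" using cheb_span[OF deg(2)] by blast
  show ?thesis
  proof (rule that[of M "\<lambda>n. of_real (b n) + \<i> * of_real (b' n)"])
    fix k s
    show "cheb_sum (\<lambda>n. of_real (b n) + \<i> * of_real (b' n)) M k s
      = of_real (poly ((pderiv ^^ k) P) (s - 1)) + \<i> * of_real (poly ((pderiv ^^ k) Q) (s - 1))"
      by (subst b, subst b')
        (simp add: cheb_sum_def funpow_pderiv_sum_smult poly_sum distrib_right sum.distrib sum_distrib_left mult.assoc)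
  qed (simp add: M_def)
qed

lemma cheb_sum_deriv: "(cheb_sum a M k has_vector_derivative cheb_sum a M (Suc k) s) (at s within S)"
proof -
  have "((\<lambda>s. poly p (s - 1)) has_real_derivative poly (pderiv p) (s - 1)) (at s within S)" for p :: "real poly"
    by (auto intro!: derivative_eq_intros DERIV_subset[OF DERIV_chain2[OF poly_DERIV]])
  then show ?thesis
    unfolding cheb_sum_def[abs_def]
    by (auto intro!: has_vector_derivative_sum has_vector_derivative_mult_right has_vector_derivative_of_real)
qed

text \<open>Approximate the top derivative \<open>D m\<close> in \<open>L\<^sup>2\<close> and integrate \<open>m\<close> times, matching the derivatives at the
  centre \<open>s = 1\<close>.  All points have distance at most \<open>1\<close> from the centre, so a bound on the difference
  of the derivatives of order \<open>m - 1\<close> descends to order \<open>0\<close> unchanged.\<close>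

lemma polynomial_approximation_from_top_derivative:
  fixes D :: "nat \<Rightarrow> real \<Rightarrow> complex"
  defines "\<Omega> \<equiv> lebesgue_on {0..2}"
  assumes m: "m \<ge> 1"
    and der: "\<And>k s. k < m - 1 \<Longrightarrow> s \<in> {0..2} \<Longrightarrow> (D k has_vector_derivative D (Suc k) s) (at s)"
    and ftc: "\<And>a b. 0 \<le> a \<Longrightarrow> a \<le> b \<Longrightarrow> b \<le> 2 \<Longrightarrow> (D m has_integral (D (m - 1) b - D (m - 1) a)) {a..b}"
    and U: "D m \<in> borel_measurable \<Omega>" "integrable \<Omega> (\<lambda>s. (norm (D m s))\<^sup>2)"
    and "\<delta> > 0"
  obtains a M where "M \<ge> L" "\<And>s. s \<in> {0..2} \<Longrightarrow> norm (D 0 s - cheb_sum a M 0 s) \<le> \<delta>"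
    "(\<lambda>s. (norm (D m s - cheb_sum a M m s))\<^sup>2) integrable_on {0..2}"
    "integral {0..2} (\<lambda>s. (norm (D m s - cheb_sum a M m s))\<^sup>2) \<le> \<delta>"
proof -
  \<comment> \<open>The squared L2 distance below becomes at most 3 \<eta>; the first bound makes it small, the second
  makes sqrt (6 \<eta>), its L1 counterpart on an interval of length 2, at most \<delta>.\<close>
  define \<eta> where "\<eta> = min (\<delta> / 4) (\<delta>\<^sup>2 / 8)"
  have \<eta>: "\<eta> > 0" "4 * \<eta> \<le> \<delta>" "8 * \<eta> \<le> \<delta>\<^sup>2" using \<open>\<delta> > 0\<close> by (auto simp: \<eta>_def)
  obtain h where h: "continuous_on UNIV h" "integrable \<Omega> (\<lambda>s. (norm (D m s - h s))\<^sup>2)"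
    "integral\<^sup>L \<Omega> (\<lambda>s. (norm (D m s - h s))\<^sup>2) < \<eta>"
    using continuous_dense_L2[OF U[unfolded \<Omega>_def] \<eta>(1)] unfolding \<Omega>_def by blast
  define \<nu> where "\<nu> = sqrt \<eta> / 4"
  have \<nu>: "\<nu> > 0" "(2 * \<nu>)\<^sup>2 = \<eta> / 4" using \<eta>(1) by (simp_all add: \<nu>_def power_divide power_mult_distrib)
  have hc: "continuous_on {0..2} h" using h(1) by (rule continuous_on_subset) simp
  obtain p where p: "\<And>s. s \<in> {0..2} \<Longrightarrow> \<bar>Re (h s) - poly p (s - 1)\<bar> < \<nu>"
    using real_polynomial_dense[of "\<lambda>s. Re (h s)" \<nu>] hc \<nu> by (auto intro: continuous_intros)
  obtain q where q: "\<And>s. s \<in> {0..2} \<Longrightarrow> \<bar>Im (h s) - poly q (s - 1)\<bar> < \<nu>"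
    using real_polynomial_dense[of "\<lambda>s. Im (h s)" \<nu>] hc \<nu> by (auto intro: continuous_intros)
  obtain P where P: "(pderiv ^^ m) P = p" "\<forall>k<m. poly ((pderiv ^^ k) P) 0 = Re (D k 1)"
    using poly_iterated_antiderivative[of m p "\<lambda>k. Re (D k 1)"] by blast
  obtain Q where Q: "(pderiv ^^ m) Q = q" "\<forall>k<m. poly ((pderiv ^^ k) Q) 0 = Im (D k 1)"
    using poly_iterated_antiderivative[of m q "\<lambda>k. Im (D k 1)"] by blast
  obtain a M where aM: "M \<ge> L" "\<And>k s. cheb_sum a M k s = of_real (poly ((pderiv ^^ k) P) (s - 1)) + \<i> * of_real (poly ((pderiv ^^ k) Q) (s - 1))"
    by (rule cheb_sum_of_polys[of L P Q]) (rule that; blast)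
  define w where "w k s = D k s - cheb_sum a M k s" for k s
  have w1: "w k 1 = 0" if "k < m" for k
    using P(2) Q(2) that by (simp add: w_def aM(2) complex_eq_iff)
  have hq: "(norm (h s - cheb_sum a M m s))\<^sup>2 \<le> \<eta> / 4" if "s \<in> {0..2}" for s
  proof -
    have "norm (h s - cheb_sum a M m s) \<le> \<bar>Re (h s - cheb_sum a M m s)\<bar> + \<bar>Im (h s - cheb_sum a M m s)\<bar>"
      by (rule cmod_le)
    also have "\<dots> \<le> 2 * \<nu>" using p[OF that] q[OF that] by (simp add: aM(2) P(1) Q(1))
    finally have "(norm (h s - cheb_sum a M m s))\<^sup>2 \<le> (2 * \<nu>)\<^sup>2" by (intro power_mono) auto
    then show ?thesis using \<nu>(2) by simp
  qed
  have contq: "continuous_on {0..2} (cheb_sum a M m)" by (intro continuous_intros)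
  have qm: "cheb_sum a M m \<in> borel_measurable \<Omega>" unfolding \<Omega>_def
    by (rule continuous_imp_measurable_on_sets_lebesgue[OF contq]) simp
  have wm: "(\<lambda>s. (norm (w m s))\<^sup>2) \<in> borel_measurable \<Omega>" unfolding w_def using U(1) qm by measurable
  have le: "(norm (w m s))\<^sup>2 \<le> 2 * (norm (D m s - h s))\<^sup>2 + \<eta> / 2" if "s \<in> {0..2}" for s
    using norm_add_squared_le[of 1 "D m s - h s" "h s - cheb_sum a M m s"] hq[OF that] by (simp add: w_def)
  have \<Omega>fin: "finite_measure \<Omega>" unfolding \<Omega>_def by (rule finite_measure_lebesgue_on) auto
  have sp: "space \<Omega> = {0..2}" by (simp add: \<Omega>_def)
  have bi: "integrable \<Omega> (\<lambda>s. 2 * (norm (D m s - h s))\<^sup>2 + \<eta> / 2)"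
    using h(2) finite_measure.integrable_const[OF \<Omega>fin] by (intro Bochner_Integration.integrable_add integrable_mult_right)
  have wi: "integrable \<Omega> (\<lambda>s. (norm (w m s))\<^sup>2)"
    by (rule Bochner_Integration.integrable_bound[OF bi wm]) (use le sp \<eta>(1) in \<open>auto intro!: AE_I2\<close>)
  have "integral\<^sup>L \<Omega> (\<lambda>s. (norm (w m s))\<^sup>2) \<le> integral\<^sup>L \<Omega> (\<lambda>s. 2 * (norm (D m s - h s))\<^sup>2 + \<eta> / 2)"
    by (rule integral_mono[OF wi bi]) (use le sp in auto)
  also have "\<dots> = 2 * integral\<^sup>L \<Omega> (\<lambda>s. (norm (D m s - h s))\<^sup>2) + \<eta>"
    using h(2) finite_measure.integrable_const[OF \<Omega>fin] by (simp add: \<Omega>_def measure_restrict_space)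
  finally have wL: "integral\<^sup>L \<Omega> (\<lambda>s. (norm (w m s))\<^sup>2) \<le> 3 * \<eta>" using h(3) by simp
  have w_int: "(\<lambda>s. (norm (w m s))\<^sup>2) integrable_on {0..2}"
    using wi unfolding \<Omega>_def by (rule integrable_on_lebesgue_on) simp
  have w_eq: "integral\<^sup>L \<Omega> (\<lambda>s. (norm (w m s))\<^sup>2) = integral {0..2} (\<lambda>s. (norm (w m s))\<^sup>2)"
    using wi unfolding \<Omega>_def by (rule lebesgue_integral_eq_integral) simp
  have w_small: "integral {0..2} (\<lambda>s. (norm (w m s))\<^sup>2) \<le> 3 * \<eta>" using wL w_eq by simp
  have wm_int: "(w m has_integral (w (m - 1) b - w (m - 1) a')) {a'..b}" if "0 \<le> a'" "a' \<le> b" "b \<le> 2" for a' b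
  proof -
    have "(cheb_sum a M m has_integral (cheb_sum a M (m - 1) b - cheb_sum a M (m - 1) a')) {a'..b}"
      using cheb_sum_deriv[of a M "m - 1"] m that(2) by (intro fundamental_theorem_of_calculus) auto
    from has_integral_diff[OF ftc[OF that] this] show ?thesis
      by (simp add: w_def[abs_def] algebra_simps)
  qed
  have wnorm: "(\<lambda>s. norm (w m s)) integrable_on {0..2}"
  proof (rule measurable_bounded_by_integrable_imp_integrable)
    show "(\<lambda>s. norm (w m s)) \<in> borel_measurable (lebesgue_on {0..2})"
      unfolding w_def using U(1) qm unfolding \<Omega>_def by measurable
    show "(\<lambda>s. 1 + (norm (w m s))\<^sup>2) integrable_on {0..2}" using w_int by (intro integrable_add) auto
    show "norm (norm (w m s)) \<le> 1 + (norm (w m s))\<^sup>2" for s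
    proof -
      have "0 \<le> (norm (w m s) - 1)\<^sup>2" by simp
      then have "2 * norm (w m s) \<le> 1 + (norm (w m s))\<^sup>2" by (simp add: power2_eq_square algebra_simps)
      then have "norm (w m s) \<le> 1 + (norm (w m s))\<^sup>2" using norm_ge_zero[of "w m s"] by linarith
      then show ?thesis by (simp only: real_norm_def abs_norm_cancel)
    qed
  qed simp
  have L1: "integral {0..2} (\<lambda>s. norm (w m s)) \<le> \<delta>"
  proof -
    have "integral {0..2} (\<lambda>s. norm (w m s)) \<le> sqrt (integral {0..2} (\<lambda>s. (norm (w m s))\<^sup>2)) * sqrt 2"
    proof (rule integral_Cauchy_Schwarz[where g = "\<lambda>_. 1"])
      show "((\<lambda>s. (norm (w m s))\<^sup>2) has_integral integral {0..2} (\<lambda>s. (norm (w m s))\<^sup>2)) {0..2}"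
        using w_int by (rule integrable_integral)
      show "((\<lambda>s. norm (w m s) * 1) has_integral integral {0..2} (\<lambda>s. norm (w m s))) {0..2}"
        using integrable_integral[OF wnorm] by simp
      show "((\<lambda>s. 1\<^sup>2) has_integral (2::real)) {0..2::real}"
        using has_integral_const_real[of "1::real" 0 2] by simp
    qed
    also have "\<dots> \<le> sqrt (3 * \<eta>) * sqrt 2" using w_small by (intro mult_right_mono real_sqrt_le_mono) auto
    also have "\<dots> = sqrt (6 * \<eta>)" by (simp flip: real_sqrt_mult)
    also have "\<dots> \<le> sqrt (\<delta>\<^sup>2)" using \<eta> by (intro real_sqrt_le_mono) linarith
    also have "\<dots> = \<delta>" using \<open>\<delta> > 0\<close> by simp
    finally show ?thesis .
  qed
  have top: "norm (w (m - 1) s) \<le> \<delta>" if s: "s \<in> {0..2}" for s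
  proof -
    have 0: "w (m - 1) 1 = 0" using w1[of "m - 1"] m by simp
    define lo hi where "lo = min s 1" and "hi = max s 1"
    have lohi: "0 \<le> lo" "lo \<le> hi" "hi \<le> 2" using s by (auto simp: lo_def hi_def)
    have "norm (w (m - 1) s) = norm (w (m - 1) hi - w (m - 1) lo)"
      using 0 by (cases "s \<le> 1") (auto simp: lo_def hi_def)
    also have "\<dots> = norm (integral {lo..hi} (w m))" using wm_int[OF lohi] by (simp add: integral_unique)
    also have "\<dots> \<le> integral {lo..hi} (\<lambda>s. norm (w m s))"
    proof (rule integral_norm_bound_integral)
      show "w m integrable_on {lo..hi}" using wm_int[OF lohi] by blast
      show "(\<lambda>s. norm (w m s)) integrable_on {lo..hi}"
        by (rule integrable_on_subinterval[OF wnorm]) (use lohi in auto)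
    qed auto
    also have "\<dots> \<le> integral {0..2} (\<lambda>s. norm (w m s))"
      using lohi by (intro integral_subset_le wnorm integrable_on_subinterval[OF wnorm]) auto
    also have "\<dots> \<le> \<delta>" by (rule L1)
    finally show ?thesis .
  qed
  have all: "\<forall>s\<in>{0..2}. norm (w (m - 1 - i) s) \<le> \<delta>" if "i \<le> m - 1" for i
    using that
  proof (induction i)
    case (Suc i)
    define k where "k = m - 1 - Suc i"
    have k: "k < m - 1" "Suc k = m - 1 - i" using Suc.prems by (auto simp: k_def)
    have IH: "norm (w (Suc k) s) \<le> \<delta>" if "s \<in> {0..2}" for s using Suc that k by simp
    have dw: "(w k has_vector_derivative w (Suc k) s) (at s within {0..2})" if "s \<in> {0..2}" for s
      unfolding w_def[abs_def]
      by (intro has_vector_derivative_diff cheb_sum_deriv has_vector_derivative_at_within[OF der[OF k(1) that]])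
    have "norm (w k s) \<le> \<delta>" if s: "s \<in> {0..2}" for s
    proof -
      have "norm (w k s - w k 1) \<le> \<delta> * norm (s - 1)"
      proof (rule differentiable_bound[of "{0..2}" "w k" "\<lambda>s h. h *\<^sub>R w (Suc k) s"])
        show "(w k has_derivative (\<lambda>h. h *\<^sub>R w (Suc k) x)) (at x within {0..2})" if "x \<in> {0..2}" for x
          using dw[OF that] by (simp add: has_vector_derivative_def)
        show "onorm (\<lambda>h. h *\<^sub>R w (Suc k) x) \<le> \<delta>" if "x \<in> {0..2}" for x
        proof (rule onorm_bound)
          show "0 \<le> \<delta>" using \<open>\<delta> > 0\<close> by simp
          show "norm (h *\<^sub>R w (Suc k) x) \<le> \<delta> * norm h" for h
            using mult_right_mono[OF IH[OF that], of "\<bar>h\<bar>"] by (simp add: mult.commute)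
        qed
      qed (use s in auto)
      also have "\<dots> \<le> \<delta> * 1" using s \<open>\<delta> > 0\<close> by (intro mult_left_mono) (auto simp: abs_le_iff)
      finally show ?thesis using w1[of k] k by simp
    qed
    then show ?case by (simp add: k_def)
  qed (use top in simp)
  show ?thesis
  proof (rule that[OF aM(1)])
    show "norm (D 0 s - cheb_sum a M 0 s) \<le> \<delta>" if "s \<in> {0..2}" for s
      using all[of "m - 1"] that by (simp add: w_def)
    show "(\<lambda>s. (norm (D m s - cheb_sum a M m s))\<^sup>2) integrable_on {0..2}" using w_int by (simp add: w_def)
    show "integral {0..2} (\<lambda>s. (norm (D m s - cheb_sum a M m s))\<^sup>2) \<le> \<delta>" using w_small \<eta> by (simp add: w_def)
  qed
qed

text \<open>Dilate, then approximate the top derivative of the dilation.  Since \<open>rho m \<le> 1\<close>, closeness in the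
  unweighted \<open>L\<^sup>2\<close> norm is enough for the weighted one.\<close>

lemma polynomials_dense_in_weighted_norm:
  assumes adm: "admissible m f" and m: "m \<ge> 1" and fin: "rho_norm_finite m (nth_vderiv m f)" and "e > 0"
  obtains a M where "M \<ge> L" "\<And>s. s \<in> {0..2} \<Longrightarrow> norm (f s - cheb_sum a M 0 s) \<le> e"
    "cheb_energy a M m \<le> (1 + e) * (rho_norm m (nth_vderiv m f))\<^sup>2 + e"
proof -
  have "continuous_on {0..2} f" using adm by (simp add: admissible_def)
  then have "uniformly_continuous_on {0..2} f" by (rule compact_uniformly_continuous) simp
  then obtain d where "d > 0" and d: "\<And>s s'. s \<in> {0..2} \<Longrightarrow> s' \<in> {0..2} \<Longrightarrow> dist s' s < d \<Longrightarrow> dist (f s') (f s) < e / 2"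
    unfolding uniformly_continuous_on_def using \<open>e > 0\<close> by (meson half_gt_zero)
  \<comment> \<open>The dilation moves no point of [0, 2] by more than 1 - r < d.\<close>
  define r where "r = 1 - min (1/2) (d / 2)"
  have r: "0 < r" "r < 1" "1 - r < d" using \<open>d > 0\<close> by (auto simp: r_def min_def)
  define D where "D k s = of_real (r ^ k) * nth_vderiv k f (1 + r * (s - 1))" for k s
  define \<delta> where "\<delta> = min (e / 2) (e / (1 + 1 / e))"
  have \<delta>: "\<delta> > 0" "\<delta> \<le> e / 2" "(1 + 1 / e) * \<delta> \<le> e"
  proof -
    have pos: "1 + 1 / e > 0" using \<open>e > 0\<close> by (simp add: add_pos_pos)
    then show "\<delta> > 0" using \<open>e > 0\<close> by (simp add: \<delta>_def)
    show "\<delta> \<le> e / 2" unfolding \<delta>_def by (rule min.cobounded1)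
    have "(1 + 1 / e) * \<delta> \<le> (1 + 1 / e) * (e / (1 + 1 / e))" using pos by (intro mult_left_mono) (auto simp: \<delta>_def)
    then show "(1 + 1 / e) * \<delta> \<le> e" using pos by simp
  qed
  note sq = dilation_square_integrable[OF adm m r(1,2) fin, folded D_def]
  obtain a M where aM: "M \<ge> L" "\<And>s. s \<in> {0..2} \<Longrightarrow> norm (D 0 s - cheb_sum a M 0 s) \<le> \<delta>"
    "(\<lambda>s. (norm (D m s - cheb_sum a M m s))\<^sup>2) integrable_on {0..2}"
    "integral {0..2} (\<lambda>s. (norm (D m s - cheb_sum a M m s))\<^sup>2) \<le> \<delta>"
  proof (rule polynomial_approximation_from_top_derivative[where D = D, OF m _ _ sq(1,2) \<delta>(1), of L])
    show "(D k has_vector_derivative D (Suc k) s) (at s)" if "k < m - 1" "s \<in> {0..2}" for k s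
      unfolding D_def[abs_def] by (rule dilation_derivative[OF adm that r(1,2)])
    show "(D m has_integral D (m - 1) b - D (m - 1) a) {a..b}" if "0 \<le> a" "a \<le> b" "b \<le> 2" for a b
      unfolding D_def[abs_def] by (rule dilation_FTC[OF adm m r(1,2) that])
  qed (rule that; blast)
  show ?thesis
  proof (rule that[OF aM(1)])
    fix s :: real assume s: "s \<in> {0..2}"
    have "r * (- 1) \<le> r * (s - 1)" "r * (s - 1) \<le> r * 1" by (rule mult_left_mono; use s r in simp)+
    then have s': "1 + r * (s - 1) \<in> {0..2}" unfolding atLeastAtMost_iff using r by (intro conjI; linarith)
    have "\<bar>s - (1 + r * (s - 1))\<bar> = (1 - r) * \<bar>s - 1\<bar>"
    proof -
      have "s - (1 + r * (s - 1)) = (1 - r) * (s - 1)" by (simp add: algebra_simps)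
      then show ?thesis using r by (simp add: abs_mult)
    qed
    also have "\<dots> \<le> (1 - r) * 1" using s r by (intro mult_left_mono) (auto simp: abs_le_iff)
    finally have "dist s (1 + r * (s - 1)) < d" using r by (simp add: dist_real_def)
    from d[OF s' s this] have "norm (f s - D 0 s) < e / 2" by (simp add: D_def dist_norm)
    then show "norm (f s - cheb_sum a M 0 s) \<le> e"
      using aM(2)[OF s] \<delta>(2) norm_triangle_ineq[of "f s - D 0 s" "D 0 s - cheb_sum a M 0 s"] by simp
  next
    have "cheb_energy a M m
      \<le> integral {0..2} (\<lambda>s. (1 + e) * ((norm (D m s))\<^sup>2 * rho m s) + (1 + 1 / e) * (norm (D m s - cheb_sum a M m s))\<^sup>2)"
    proof (rule integral_le)
      show "(\<lambda>s. (norm (cheb_sum a M m s))\<^sup>2 * rho m s) integrable_on {0..2}"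
        using rho_norm_cheb_sum[OF m] by blast
      show "(\<lambda>s. (1 + e) * ((norm (D m s))\<^sup>2 * rho m s) + (1 + 1 / e) * (norm (D m s - cheb_sum a M m s))\<^sup>2) integrable_on {0..2}"
        by (intro integrable_add integrable_on_mult_right sq(4) aM(3))
      fix s :: real assume s: "s \<in> {0..2}"
      have "(norm (cheb_sum a M m s))\<^sup>2 \<le> (1 + e) * (norm (D m s))\<^sup>2 + (1 + 1 / e) * (norm (D m s - cheb_sum a M m s))\<^sup>2"
        using norm_add_squared_le[OF \<open>e > 0\<close>, of "D m s" "cheb_sum a M m s - D m s"] by (simp add: norm_minus_commute)
      then have "(norm (cheb_sum a M m s))\<^sup>2 * rho m s
        \<le> ((1 + e) * (norm (D m s))\<^sup>2 + (1 + 1 / e) * (norm (D m s - cheb_sum a M m s))\<^sup>2) * rho m s"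
        by (intro mult_right_mono rho_nonneg)
      also have "\<dots> = (1 + e) * ((norm (D m s))\<^sup>2 * rho m s) + (1 + 1 / e) * (norm (D m s - cheb_sum a M m s))\<^sup>2 * rho m s"
        by (simp only: distrib_right mult.assoc)
      also have "\<dots> \<le> (1 + e) * ((norm (D m s))\<^sup>2 * rho m s) + (1 + 1 / e) * (norm (D m s - cheb_sum a M m s))\<^sup>2"
        using rho_le_1[OF s m] rho_nonneg[of m s] \<open>e > 0\<close> by (intro add_left_mono mult_right_le_one_le) auto
      finally show "(norm (cheb_sum a M m s))\<^sup>2 * rho m s
        \<le> (1 + e) * ((norm (D m s))\<^sup>2 * rho m s) + (1 + 1 / e) * (norm (D m s - cheb_sum a M m s))\<^sup>2" .
    qed
    also have "\<dots> = (1 + e) * integral {0..2} (\<lambda>s. (norm (D m s))\<^sup>2 * rho m s) + (1 + 1 / e) * integral {0..2} (\<lambda>s. (norm (D m s - cheb_sum a M m s))\<^sup>2)"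
      by (subst integral_add) (auto intro!: integrable_on_mult_right sq(4) aM(3) simp del: distrib_right)
    also have "\<dots> \<le> (1 + e) * (rho_norm m (nth_vderiv m f))\<^sup>2 + (1 + 1 / e) * \<delta>"
      using sq(3) aM(4) \<open>e > 0\<close> by (intro add_mono mult_left_mono) auto
    also have "\<dots> \<le> (1 + e) * (rho_norm m (nth_vderiv m f))\<^sup>2 + e" using \<delta>(3) by simp
    finally show "cheb_energy a M m \<le> (1 + e) * (rho_norm m (nth_vderiv m f))\<^sup>2 + e" .
  qed
qed

lemma rho_norm_nonneg: "rho_norm m g \<ge> 0"
  unfolding rho_norm_def set_lebesgue_integral_def
  by (intro real_sqrt_ge_zero integral_nonneg_AE AE_I2) (simp add: rho_nonneg)

section \<open>The error estimates\<close>

text \<open>Both the error and the bound pass to the limit along the approximating polynomials.\<close>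

lemma quadrature_error_transfer:
  assumes adm: "admissible m f" and m: "m \<ge> 1" and fin: "rho_norm_finite m (nth_vderiv m f)"
    and L: "L \<ge> 1" and "B \<ge> 0"
    and bound: "\<And>a M. L \<le> M \<Longrightarrow> norm (quad_error L z (cheb_sum a M 0))
      \<le> B * sqrt (cheb_energy a M m)"
  shows "norm (quad_error L z f) \<le> B * rho_norm m (nth_vderiv m f)"
proof -
  define N where "N = rho_norm m (nth_vderiv m f)"
  have "continuous_on {0..2} f" using adm by (simp add: admissible_def)
  define K where "K = error_lipschitz L z"
  have le: "norm (quad_error L z f) \<le> K * e + B * sqrt ((1 + e) * N\<^sup>2 + e)" if "e > 0" for e
  proof -
    obtain a M where aM: "M \<ge> L" "\<And>s. s \<in> {0..2} \<Longrightarrow> norm (f s - cheb_sum a M 0 s) \<le> e"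
      "cheb_energy a M m \<le> (1 + e) * N\<^sup>2 + e"
      by (rule polynomials_dense_in_weighted_norm[OF adm m fin \<open>e > 0\<close>, of L, folded N_def]) (rule that; blast)
    have "norm ((quad_error L z f) - (quad_error L z (cheb_sum a M 0))) \<le> K * e"
      unfolding K_def
      by (rule cc_quadrature_error_lipschitz[OF L \<open>continuous_on {0..2} f\<close> continuous_on_cheb_sum aM(2)])
    moreover have "norm (quad_error L z (cheb_sum a M 0)) \<le> B * sqrt ((1 + e) * N\<^sup>2 + e)"
      by (rule order_trans[OF bound[OF aM(1)]]) (intro mult_left_mono real_sqrt_le_mono aM(3) \<open>B \<ge> 0\<close>)
    ultimately show ?thesis
      using norm_triangle_sub[of "quad_error L z f" "quad_error L z (cheb_sum a M 0)"]
      by linarith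
  qed
  have "((\<lambda>e. K * e + B * sqrt ((1 + e) * N\<^sup>2 + e)) \<longlongrightarrow> K * 0 + B * sqrt ((1 + 0) * N\<^sup>2 + 0)) (at_right 0)"
    by (intro tendsto_intros)
  then have "norm (quad_error L z f) \<le> K * 0 + B * sqrt ((1 + 0) * N\<^sup>2 + 0)"
    by (rule tendsto_lowerbound) (auto simp: eventually_at_right_field intro!: exI[of _ 1] le)
  then show ?thesis using rho_norm_nonneg[of m "nth_vderiv m f"] by (simp add: N_def)
qed

theorem theorem3p5:
  fixes \<mu>0 :: real
  assumes "\<mu>0 > 0"
  shows "(\<forall>m::nat. m \<ge> 1 \<longrightarrow>
      (\<exists>C::real. C > 0 \<and>
        (\<forall>L::nat. \<forall>z\<in>half_plane \<mu>0. \<forall>f.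
          L \<ge> 1 \<longrightarrow> L \<ge> m - 1 \<longrightarrow> admissible m f \<longrightarrow> rho_norm_finite m (nth_vderiv m f) \<longrightarrow>
          norm (fcc_rule L z f - osc_integral z f)
            \<le> C * real L powr (1 - real m) * (1 + \<bar>Re z\<bar>) powr (-(3/4))
                * (if z = 0 then 1 / real L
                   else min (1 / real L) (1 / norm z * (1 + \<bar>Re z\<bar>) powr (1/2)))
                * rho_norm m (nth_vderiv m f))))
    \<and> (\<forall>m0::real. \<forall>m::nat. m0 > 7/2 \<longrightarrow> real m \<ge> m0 \<longrightarrow>
      (\<exists>C'::real. C' > 0 \<and>
        (\<forall>L::nat. \<forall>z\<in>half_plane \<mu>0. \<forall>f.
          L \<ge> m - 1 \<longrightarrow> admissible m f \<longrightarrow> rho_norm_finite m (nth_vderiv m f) \<longrightarrow>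
          norm (fcc_rule L z f - osc_integral z f)
            \<le> C' * (1 + norm z) powr (-2) * real L powr (m0 - real m - 1)
                * (1 + (1 + \<bar>Re z\<bar>) powr (-(1/2)) * real L)
                * rho_norm m (nth_vderiv m f))))"
proof (intro conjI allI impI)
  fix m :: nat assume m: "m \<ge> 1"
  note C = error_const_pos[OF m, of \<mu>0]
  note b0 = cheb_sum_error_direct[OF m assms]
  note b1 = cheb_sum_error_one_parts[OF m assms]
  show "\<exists>C::real. C > 0 \<and>
        (\<forall>L::nat. \<forall>z\<in>half_plane \<mu>0. \<forall>f.
          L \<ge> 1 \<longrightarrow> L \<ge> m - 1 \<longrightarrow> admissible m f \<longrightarrow> rho_norm_finite m (nth_vderiv m f) \<longrightarrow>
          norm (quad_error L z f)
            \<le> C * real L powr (1 - real m) * (1 + \<bar>Re z\<bar>) powr (-(3/4))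
                * (if z = 0 then 1 / real L
                   else min (1 / real L) (1 / norm z * (1 + \<bar>Re z\<bar>) powr (1/2)))
                * rho_norm m (nth_vderiv m f))"
  proof (rule exI[of _ "error_const m \<mu>0"], intro conjI C allI impI ballI)
    fix L z f
    assume z: "z \<in> half_plane \<mu>0" and L: "L \<ge> 1" "L \<ge> m - 1" and adm: "admissible m f"
      and fin: "rho_norm_finite m (nth_vderiv m f)"
    define N where "N = rho_norm m (nth_vderiv m f)"
    define \<tau> where "\<tau> = 1 + \<bar>Re z\<bar>"
    define A where "A = real L powr (1 - real m)"
    have \<tau>: "\<tau> > 0" by (simp add: \<tau>_def add_pos_nonneg)
    have mL: "m \<le> L + 1" using L by simp
    have Re: "Re z \<le> \<mu>0" using z by (simp add: half_plane_def)
    have "norm (quad_error L z f) \<le> error_const m \<mu>0 * real L powr (- real m) * \<tau> powr (-(3/4)) * N"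
      unfolding N_def
      by (rule quadrature_error_transfer[OF adm m fin L(1)])
        (use C b0[OF L(1) mL _ Re] in \<open>auto simp: \<tau>_def\<close>)
    also have "real L powr (- real m) = A * (1 / real L)"
    proof -
      have "A * real L powr (- 1) = real L powr (1 - real m + - 1)" unfolding A_def by (simp only: powr_add)
      then show ?thesis using L(1) by (simp add: powr_minus inverse_eq_divide)
    qed
    finally have e0: "norm (quad_error L z f) \<le> error_const m \<mu>0 * A * \<tau> powr (-(3/4)) * (1 / real L) * N"
      by (simp add: mult_ac)
    show "norm (quad_error L z f)
            \<le> error_const m \<mu>0 * real L powr (1 - real m) * (1 + \<bar>Re z\<bar>) powr (-(3/4))
                * (if z = 0 then 1 / real L
                   else min (1 / real L) (1 / norm z * (1 + \<bar>Re z\<bar>) powr (1/2)))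
                * rho_norm m (nth_vderiv m f)"
    proof (cases "z = 0")
      case True
      then show ?thesis using e0 by (simp add: A_def \<tau>_def N_def)
    next
      case False
      then have nz: "norm z > 0" by simp
      have "norm (quad_error L z f) \<le> (error_const m \<mu>0 * A * \<tau> powr (-(1/4)) / norm z) * N"
        unfolding N_def
      proof (rule quadrature_error_transfer[OF adm m fin L(1)])
        show "0 \<le> error_const m \<mu>0 * A * \<tau> powr (-(1/4)) / norm z" using C by (simp add: A_def)
        show "norm (quad_error L z (cheb_sum a M 0))
          \<le> error_const m \<mu>0 * A * \<tau> powr (-(1/4)) / norm z * sqrt (cheb_energy a M m)"
          if "L \<le> M" for a M
          using b1[OF L(1) mL that Re, of a] nz by (simp add: field_simps A_def \<tau>_def)
      qed
      also have "\<tau> powr (-(1/4)) = \<tau> powr (-(3/4)) * \<tau> powr (1/2)" by (simp flip: powr_add)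
      finally have e1: "norm (quad_error L z f) \<le> error_const m \<mu>0 * A * \<tau> powr (-(3/4)) * (1 / norm z * \<tau> powr (1/2)) * N"
        by (simp add: mult_ac)
      have "norm (quad_error L z f)
        \<le> error_const m \<mu>0 * A * \<tau> powr (-(3/4)) * min (1 / real L) (1 / norm z * \<tau> powr (1/2)) * N"
        using e0 e1 by (cases "1 / real L \<le> 1 / norm z * \<tau> powr (1/2)") (simp_all add: min_absorb1 min_absorb2)
      then show ?thesis using False by (simp add: A_def \<tau>_def N_def)
    qed
  qed
next
  fix m0 :: real and m :: nat assume m0: "m0 > 7/2" "real m \<ge> m0"
  then have m4: "m \<ge> 4" by linarith
  then have m: "m \<ge> 1" by simp
  note C = error_const_pos[OF m, of \<mu>0]
  note b0 = cheb_sum_error_direct[OF m assms]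
  note b2 = cheb_sum_error_two_parts[OF m assms]
  show "\<exists>C'::real. C' > 0 \<and>
        (\<forall>L::nat. \<forall>z\<in>half_plane \<mu>0. \<forall>f.
          L \<ge> m - 1 \<longrightarrow> admissible m f \<longrightarrow> rho_norm_finite m (nth_vderiv m f) \<longrightarrow>
          norm (quad_error L z f)
            \<le> C' * (1 + norm z) powr (-2) * real L powr (m0 - real m - 1)
                * (1 + (1 + \<bar>Re z\<bar>) powr (-(1/2)) * real L)
                * rho_norm m (nth_vderiv m f))"
  proof (rule exI[of _ "4 * error_const m \<mu>0"], intro conjI allI impI ballI)
    show "4 * error_const m \<mu>0 > 0" using C by simp
    fix L z f
    assume z: "z \<in> half_plane \<mu>0" and L: "L \<ge> m - 1" and adm: "admissible m f"
      and fin: "rho_norm_finite m (nth_vderiv m f)"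
    define \<tau> where "\<tau> = 1 + \<bar>Re z\<bar>"
    define P where "P = real L powr (m0 - real m - 1)"
    define G where "G = 1 + \<tau> powr (-(1/2)) * real L"
    have \<tau>: "\<tau> \<ge> 1" by (simp add: \<tau>_def)
    have L1: "L \<ge> 1" using L m4 by simp
    have mL: "m \<le> L + 1" using L by simp
    have Re: "Re z \<le> \<mu>0" using z by (simp add: half_plane_def)
    have G: "G \<ge> 1" by (simp add: G_def)
    have P: "P \<ge> 0" by (simp add: P_def)
    have z1: "1 + norm z > 0" by (simp add: add_pos_nonneg)
    have powr2: "(1 + norm z) powr (-2) = 1 / (1 + norm z)\<^sup>2"
      using powr_realpow[OF z1, of 2] z1 by (simp add: powr_minus inverse_eq_divide)
    have "norm (quad_error L z f)
      \<le> (4 * error_const m \<mu>0 * (1 + norm z) powr (-2) * P * G) * rho_norm m (nth_vderiv m f)"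
    proof (rule quadrature_error_transfer[OF adm m fin L1])
      show "0 \<le> 4 * error_const m \<mu>0 * (1 + norm z) powr (-2) * P * G" using C G P by simp
      fix a M assume M: "L \<le> M"
      define E where "E = norm (quad_error L z (cheb_sum a M 0))"
      define S where "S = sqrt (cheb_energy a M m)"
      have "S \<ge> 0" unfolding S_def
        by (intro real_sqrt_ge_zero integral_nonneg) (use rho_norm_cheb_sum[OF m, of a M] in \<open>auto simp: rho_nonneg\<close>)
      have PGS: "error_const m \<mu>0 * P * G * S \<ge> 0" using C P G \<open>S \<ge> 0\<close> by simp
      show "E \<le> 4 * error_const m \<mu>0 * (1 + norm z) powr (-2) * P * G * S"
      \<comment> \<open>Small z are covered by the bound without integration by parts.  The factor 4 absorbs
      (1 + |z|)^2, which is at most 4 in this case and at most 4 |z|^2 in the other.\<close>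
      proof (cases "norm z < 1")
        case True
        have "E \<le> error_const m \<mu>0 * real L powr (- real m) * \<tau> powr (-(3/4)) * S"
          using b0[OF L1 mL M Re, of a] by (simp add: E_def S_def \<tau>_def)
        also have "\<dots> \<le> error_const m \<mu>0 * P * G * S"
        proof (intro mult_right_mono mult_mono \<open>S \<ge> 0\<close>)
          show "real L powr (- real m) \<le> P" unfolding P_def using m0 L1 by (intro powr_mono) auto
          have "\<tau> powr (-(3/4)) \<le> \<tau> powr 0" using \<tau> by (intro powr_mono) auto
          then show "\<tau> powr (-(3/4)) \<le> G" using \<tau> G by simp
        qed (use C P in auto)
        also have "\<dots> \<le> (4 / (1 + norm z)\<^sup>2) * (error_const m \<mu>0 * P * G * S)"
        proof -
          have "(1 + norm z)\<^sup>2 \<le> 2\<^sup>2" using True by (intro power_mono) auto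
          moreover have "(1 + norm z)\<^sup>2 > 0" using z1 by (rule zero_less_power)
          ultimately have "1 \<le> 4 / (1 + norm z)\<^sup>2" by (simp add: le_divide_eq)
          from mult_right_mono[OF this PGS] show ?thesis by (simp only: mult_1_left)
        qed
        finally show ?thesis unfolding powr2 by (simp add: mult_ac)
      next
        case False
        then have nz: "norm z \<ge> 1" by simp
        have "(norm z)\<^sup>2 * E \<le> error_const m \<mu>0 * real L powr (5/2 - real m) * G * S"
          using b2[OF L1 mL M Re m4, of a] by (simp add: E_def S_def \<tau>_def G_def)
        also have "\<dots> \<le> error_const m \<mu>0 * P * G * S"
          unfolding P_def using m0 L1 C G \<open>S \<ge> 0\<close> by (intro mult_right_mono mult_left_mono powr_mono) auto
        finally have E1: "(norm z)\<^sup>2 * E \<le> error_const m \<mu>0 * P * G * S" .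
        have "(1 + norm z)\<^sup>2 \<le> (2 * norm z)\<^sup>2" using nz by (intro power_mono) auto
        then have "(1 + norm z)\<^sup>2 * E \<le> (2 * norm z)\<^sup>2 * E" by (intro mult_right_mono) (auto simp: E_def)
        also have "\<dots> = 4 * ((norm z)\<^sup>2 * E)" by (simp add: power_mult_distrib)
        also have "\<dots> \<le> 4 * (error_const m \<mu>0 * P * G * S)" using E1 by simp
        finally have "(1 + norm z)\<^sup>2 * E \<le> 4 * (error_const m \<mu>0 * P * G * S)" .
        moreover have "(1 + norm z)\<^sup>2 > 0" using z1 by (rule zero_less_power)
        ultimately have "E \<le> 4 * (error_const m \<mu>0 * P * G * S) / (1 + norm z)\<^sup>2" by (simp add: pos_le_divide_eq mult.commute)
        then show ?thesis unfolding powr2 by (simp add: mult_ac)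
      qed
    qed
    then show "norm (quad_error L z f)
            \<le> 4 * error_const m \<mu>0 * (1 + norm z) powr (-2) * real L powr (m0 - real m - 1)
                * (1 + (1 + \<bar>Re z\<bar>) powr (-(1/2)) * real L)
                * rho_norm m (nth_vderiv m f)"
      by (simp add: P_def G_def \<tau>_def)
  qed
qed

end
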